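(* Suppose $\lambda\in kG$, $\lambda\neq0$, has no constant term. There is a two-parameter family of distinct simple $H_\lambda$-modules $S_{\alpha,\beta}$, $\alpha,\beta\in k$. If $\lambda$ is invertible in $kG$, all simple $H_\lambda$-modules are $p$-dimensional over $k$, while if $\lambda$ is a zero-divisor in $kG$ then the simple $H_\lambda$-modules over the smooth locus are $p$-dimensional while the simple modules over the singular locus are $1$-dimensional.
   Context: Let $p$ be an odd prime, $k$ an algebraically closed field of characteristic $p$, and $G=\langle g\rangle$ the cyclic group of order $p$ generated by $g=\begin{pmatrix}1&1\\0&1\end{pmatrix}\in \mathrm{SL}(2,p)$. $G$ acts on the free algebra $k\langle x,y\rangle$ by algebra automorphisms with $g\cdot x=x$, $g\cdot y=x+y$, and $k\langle x,y\rangle\rtimes G$ is the smash product (so $gf=(g\cdot f)g$). For $\lambda\in kG$ set $H_\lambda=(k\langle x,y\rangle\rtimes G)/(xy-yx-\lambda)$. The constant term of $\lambda=\sum c_ig^i$ is $c_0$. Modules are left modules. $\delta$ is the derivation of $R=k[x]\otimes kG$ with $\delta(x)=\lambda$, $\delta(g)=xg$, and $\delta^p(g)/\delta(g)$ is the element $r\in R$ with $r\,\delta(g)=\delta^p(g)$. Verma modules: $\Delta_\alpha=H_\lambda/(H_\lambda(x-\alpha)+H_\lambda(g-1))$, $\alpha\in k$. With $Y=y^p-y\,\delta^p(g)/\delta(g)$ (a central element), $S_{\alpha,\beta}$ is the quotient of $\Delta_\alpha$ by the submodule generated by the image of $Y-\beta$, except when $\lambda$ is a zero-divisor and $\alpha=0$,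 in which case $S_{0,\beta}$ is the quotient of $\Delta_0$ by the submodule generated by the image of $y-\beta$. Let $Z_\lambda$ be the center of $H_\lambda$, described in the paper as $Z_\lambda\cong k[A,B,C]/(A^p-B^2)$ with $B$ corresponding to $x^p$, so that the singular points of $\operatorname{Spec}Z_\lambda$ are those with $B=0$. A simple module lies over the smooth (resp. singular) locus if $Z_\lambda$ acts on it through a character that is a nonsingular (resp. singular) point of $\operatorname{Spec}Z_\lambda$, i.e. if $x^p$ acts by a nonzero scalar (resp. by $0$). *)

theory Defs
  imports
    "HOL-Library.Poly_Mapping"
    "HOL-Computational_Algebra.Polynomial"
    "HOL-Algebra.QuotRing"
    "Jordan_Normal_Form.VS_Connect"
begin

section \<open>Left modules over a not necessarily commutative ring\<close>

text \<open>The locale \<^locale>\<open>module\<close> of HOL-Algebra requires a commutative ring of scalars, so the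
  axioms are restated here over a ring; the record type of modules, \<open>Module.submodule\<close> and
  \<^const>\<open>LinearCombinations.module_hom\<close> do not refer to commutativity and are used unchanged.\<close>

locale left_module = R?: ring R + M?: abelian_group M
  for R :: "('a, 'c) ring_scheme" (structure) and M :: "('a, 'b, 'd) module_scheme" (structure) +
  assumes lsmult_closed:
      "\<lbrakk>a \<in> carrier R; m \<in> carrier M\<rbrakk> \<Longrightarrow> a \<odot>\<^bsub>M\<^esub> m \<in> carrier M"
    and lsmult_l_distr:
      "\<lbrakk>a \<in> carrier R; b \<in> carrier R; m \<in> carrier M\<rbrakk> \<Longrightarrow>
        (a \<oplus>\<^bsub>R\<^esub> b) \<odot>\<^bsub>M\<^esub> m = a \<odot>\<^bsub>M\<^esub> m \<oplus>\<^bsub>M\<^esub> b \<odot>\<^bsub>M\<^esub> m"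
    and lsmult_r_distr:
      "\<lbrakk>a \<in> carrier R; m \<in> carrier M; n \<in> carrier M\<rbrakk> \<Longrightarrow>
        a \<odot>\<^bsub>M\<^esub> (m \<oplus>\<^bsub>M\<^esub> n) = a \<odot>\<^bsub>M\<^esub> m \<oplus>\<^bsub>M\<^esub> a \<odot>\<^bsub>M\<^esub> n"
    and lsmult_assoc:
      "\<lbrakk>a \<in> carrier R; b \<in> carrier R; m \<in> carrier M\<rbrakk> \<Longrightarrow>
        (a \<otimes>\<^bsub>R\<^esub> b) \<odot>\<^bsub>M\<^esub> m = a \<odot>\<^bsub>M\<^esub> (b \<odot>\<^bsub>M\<^esub> m)"
    and lsmult_one: "m \<in> carrier M \<Longrightarrow> \<one>\<^bsub>R\<^esub> \<odot>\<^bsub>M\<^esub> m = m"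

definition simple_left_module :: "('a, 'c) ring_scheme \<Rightarrow> ('a, 'b, 'd) module_scheme \<Rightarrow> bool" where
  "simple_left_module R M \<longleftrightarrow>
     left_module R M \<and> carrier M \<noteq> {\<zero>\<^bsub>M\<^esub>} \<and>
     (\<forall>N. Module.submodule N R M \<longrightarrow> N = {\<zero>\<^bsub>M\<^esub>} \<or> N = carrier M)"

definition isomorphic_left_modules ::
    "('a, 'c) ring_scheme \<Rightarrow> ('a, 'b1, 'd1) module_scheme \<Rightarrow> ('a, 'b2, 'd2) module_scheme \<Rightarrow> bool" where
  "isomorphic_left_modules R M N \<longleftrightarrow>
     (\<exists>f \<in> LinearCombinations.module_hom R M N. bij_betw f (carrier M) (carrier N))"

text \<open>The fields \<^const>\<open>mult\<close> and \<^const>\<open>one\<close> of a module record carry no meaning.\<close>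

definition regular_module :: "('a, 'c) ring_scheme \<Rightarrow> ('a, 'a) module" where
  "regular_module R =
     \<lparr>carrier = carrier R, mult = undefined, one = undefined,
      zero = \<zero>\<^bsub>R\<^esub>, add = add R, smult = mult R\<rparr>"

definition quotient_module ::
    "('a, 'b, 'd) module_scheme \<Rightarrow> 'b set \<Rightarrow> ('a, 'b set) module" where
  "quotient_module M N =
     \<lparr>carrier = a_rcosets\<^bsub>M\<^esub> N, mult = undefined, one = undefined,
      zero = N, add = set_add M, smult = (\<lambda>a U. \<Union>u\<in>U. N +>\<^bsub>M\<^esub> (a \<odot>\<^bsub>M\<^esub> u))\<rparr>"

definition generated_submodule ::
    "('a, 'c) ring_scheme \<Rightarrow> ('a, 'b, 'd) module_scheme \<Rightarrow> 'b set \<Rightarrow> 'b set" where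
  "generated_submodule R M U = \<Inter>{N. Module.submodule N R M \<and> U \<subseteq> N}"


section \<open>The free algebra \<open>k\<langle>x,y\<rangle>\<close> and the action of \<open>g\<close>\<close>

datatype letter = LX | LY

datatype xy_word = Word (letters: "letter list")

instantiation xy_word :: monoid_add
begin

definition "0 = Word []"
definition "v + w = Word (letters v @ letters w)"

instance
  by standard (simp_all add: zero_xy_word_def plus_xy_word_def)

end

text \<open>Addition of words is concatenation, hence the convolution product of
  \<^typ>\<open>xy_word \<Rightarrow>\<^sub>0 'k\<close> is that of the free algebra.\<close>

type_synonym 'k free_alg = "xy_word \<Rightarrow>\<^sub>0 'k"

definition fscalar :: "'k \<Rightarrow> 'k::ring_1 free_alg" where
  "fscalar c = Poly_Mapping.single 0 c"

definition fvar :: "letter \<Rightarrow> 'k::ring_1 free_alg" where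
  "fvar l = Poly_Mapping.single (Word [l]) 1"

fun g_letter :: "letter \<Rightarrow> 'k::ring_1 free_alg" where
  "g_letter LX = fvar LX"
| "g_letter LY = fvar LX + fvar LY"

definition g_act :: "'k::ring_1 free_alg \<Rightarrow> 'k free_alg" where
  "g_act f = (\<Sum>w\<in>Poly_Mapping.keys f.
     fscalar (Poly_Mapping.lookup f w) * prod_list (map g_letter (letters w)))"


section \<open>Smash products with a cyclic group\<close>

text \<open>The smash product \<open>A \<rtimes> \<langle>g\<rangle>\<close> for \<open>g\<close> of order \<open>n\<close> acting on \<open>A\<close> by \<open>\<sigma>\<close>. The function \<open>u\<close>
  stands for the sum of the \<open>u i g\<^sup>i\<close> over \<open>i < n\<close>, and \<open>(a g\<^sup>i)(b g\<^sup>j) = a \<sigma>\<^sup>i(b) g\<^sup>i\<^sup>+\<^sup>j\<close>.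
  For the trivial action this is the group algebra \<open>A\<langle>g\<rangle>\<close>.\<close>

definition smash_cyclic :: "nat \<Rightarrow> ('a \<Rightarrow> 'a) \<Rightarrow> (nat \<Rightarrow> 'a::ring_1) ring" where
  "smash_cyclic n \<sigma> =
     \<lparr>carrier = {u. \<forall>i\<ge>n. u i = 0},
      mult = (\<lambda>u v m. \<Sum>(i, j) | i < n \<and> j < n \<and> (i + j) mod n = m. u i * (\<sigma> ^^ i) (v j)),
      one = (\<lambda>i. if i = 0 then 1 else 0),
      zero = (\<lambda>_. 0),
      add = (\<lambda>u v i. u i + v i)\<rparr>"

definition gmonom :: "'a::zero \<Rightarrow> nat \<Rightarrow> nat \<Rightarrow> 'a" where
  "gmonom a i = (\<lambda>j. if j = i then a else 0)"

definition kG :: "nat \<Rightarrow> (nat \<Rightarrow> 'k::field) ring" where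
  "kG p = smash_cyclic p id"

definition kG_zero_divisor :: "nat \<Rightarrow> (nat \<Rightarrow> 'k::field) \<Rightarrow> bool" where
  "kG_zero_divisor p lam \<longleftrightarrow>
     lam \<in> carrier (kG p) \<and>
     (\<exists>\<mu> \<in> carrier (kG p). \<mu> \<noteq> \<zero>\<^bsub>kG p\<^esub> \<and> lam \<otimes>\<^bsub>kG p\<^esub> \<mu> = \<zero>\<^bsub>kG p\<^esub>)"


section \<open>The derivation \<open>\<delta>\<close> of \<open>R = k[x] \<otimes> kG\<close>\<close>

text \<open>\<open>R\<close> is taken as the group algebra of \<open>G\<close> over \<open>k[x]\<close>.\<close>

definition Rx :: "nat \<Rightarrow> (nat \<Rightarrow> 'k::field poly) ring" where
  "Rx p = smash_cyclic p id"

definition Rx_derivation :: "nat \<Rightarrow> ((nat \<Rightarrow> 'k::field poly) \<Rightarrow> (nat \<Rightarrow> 'k poly)) \<Rightarrow> bool" where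
  "Rx_derivation p D \<longleftrightarrow>
     D \<in> carrier (Rx p) \<rightarrow> carrier (Rx p) \<and>
     (\<forall>u \<in> carrier (Rx p). \<forall>v \<in> carrier (Rx p). D (u \<oplus>\<^bsub>Rx p\<^esub> v) = D u \<oplus>\<^bsub>Rx p\<^esub> D v) \<and>
     (\<forall>c. \<forall>u \<in> carrier (Rx p). D (\<lambda>i. Polynomial.smult c (u i)) = (\<lambda>i. Polynomial.smult c (D u i))) \<and>
     (\<forall>u \<in> carrier (Rx p). \<forall>v \<in> carrier (Rx p).
        D (u \<otimes>\<^bsub>Rx p\<^esub> v) = D u \<otimes>\<^bsub>Rx p\<^esub> v \<oplus>\<^bsub>Rx p\<^esub> u \<otimes>\<^bsub>Rx p\<^esub> D v)"

definition delta :: "nat \<Rightarrow> (nat \<Rightarrow> 'k::field) \<Rightarrow> (nat \<Rightarrow> 'k poly) \<Rightarrow> (nat \<Rightarrow> 'k poly)" where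
  "delta p lam = (THE D. D \<in> extensional (carrier (Rx p)) \<and> Rx_derivation p D \<and>
     D (gmonom [:0, 1:] 0) = (\<lambda>i. [:lam i:]) \<and>
     D (gmonom 1 1) = gmonom [:0, 1:] 1)"

definition delta_quotient :: "nat \<Rightarrow> (nat \<Rightarrow> 'k::field) \<Rightarrow> (nat \<Rightarrow> 'k poly)" where
  "delta_quotient p lam = (THE r. r \<in> carrier (Rx p) \<and>
     r \<otimes>\<^bsub>Rx p\<^esub> delta p lam (gmonom 1 1) = (delta p lam ^^ p) (gmonom 1 1))"


section \<open>The algebra \<open>H\<^sub>\<lambda>\<close>\<close>

definition Sm :: "nat \<Rightarrow> (nat \<Rightarrow> 'k::field free_alg) ring" where
  "Sm p = smash_cyclic p g_act"

definition relator :: "nat \<Rightarrow> (nat \<Rightarrow> 'k::field) \<Rightarrow> (nat \<Rightarrow> 'k free_alg)" where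
  "relator p lam =
     (gmonom (fvar LX) 0 \<otimes>\<^bsub>Sm p\<^esub> gmonom (fvar LY) 0 \<ominus>\<^bsub>Sm p\<^esub>
      gmonom (fvar LY) 0 \<otimes>\<^bsub>Sm p\<^esub> gmonom (fvar LX) 0) \<ominus>\<^bsub>Sm p\<^esub> (\<lambda>i. fscalar (lam i))"

definition H_ideal :: "nat \<Rightarrow> (nat \<Rightarrow> 'k::field) \<Rightarrow> (nat \<Rightarrow> 'k free_alg) set" where
  "H_ideal p lam = Idl\<^bsub>Sm p\<^esub> {relator p lam}"

type_synonym 'k H_elem = "(nat \<Rightarrow> 'k free_alg) set"

definition Halg :: "nat \<Rightarrow> (nat \<Rightarrow> 'k::field) \<Rightarrow> 'k H_elem ring" where
  "Halg p lam = Sm p Quot H_ideal p lam"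

definition H_class :: "nat \<Rightarrow> (nat \<Rightarrow> 'k::field) \<Rightarrow> (nat \<Rightarrow> 'k free_alg) \<Rightarrow> 'k H_elem" where
  "H_class p lam u = H_ideal p lam +>\<^bsub>Sm p\<^esub> u"

definition Hx :: "nat \<Rightarrow> (nat \<Rightarrow> 'k::field) \<Rightarrow> 'k H_elem" where
  "Hx p lam = H_class p lam (gmonom (fvar LX) 0)"

definition Hy :: "nat \<Rightarrow> (nat \<Rightarrow> 'k::field) \<Rightarrow> 'k H_elem" where
  "Hy p lam = H_class p lam (gmonom (fvar LY) 0)"

definition Hg :: "nat \<Rightarrow> (nat \<Rightarrow> 'k::field) \<Rightarrow> 'k H_elem" where
  "Hg p lam = H_class p lam (gmonom 1 1)"

definition Hscalar :: "nat \<Rightarrow> (nat \<Rightarrow> 'k::field) \<Rightarrow> 'k \<Rightarrow> 'k H_elem" where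
  "Hscalar p lam c = H_class p lam (gmonom (fscalar c) 0)"

definition poly_in_x :: "'k::field poly \<Rightarrow> 'k free_alg" where
  "poly_in_x q = (\<Sum>j\<le>degree q. fscalar (coeff q j) * fvar LX ^ j)"

definition Rx_to_H :: "nat \<Rightarrow> (nat \<Rightarrow> 'k::field) \<Rightarrow> (nat \<Rightarrow> 'k poly) \<Rightarrow> 'k H_elem" where
  "Rx_to_H p lam u = H_class p lam (\<lambda>i. poly_in_x (u i))"

definition HY :: "nat \<Rightarrow> (nat \<Rightarrow> 'k::field) \<Rightarrow> 'k H_elem" where
  "HY p lam = Hy p lam [^]\<^bsub>Halg p lam\<^esub> p \<ominus>\<^bsub>Halg p lam\<^esub>
     Hy p lam \<otimes>\<^bsub>Halg p lam\<^esub> Rx_to_H p lam (delta_quotient p lam)"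


section \<open>Verma modules and the modules \<open>S\<^sub>\<alpha>\<^sub>,\<^sub>\<beta>\<close>\<close>

definition verma_ideal :: "nat \<Rightarrow> (nat \<Rightarrow> 'k::field) \<Rightarrow> 'k \<Rightarrow> 'k H_elem set" where
  "verma_ideal p lam \<alpha> =
     (carrier (Halg p lam) #>\<^bsub>Halg p lam\<^esub> (Hx p lam \<ominus>\<^bsub>Halg p lam\<^esub> Hscalar p lam \<alpha>)) <+>\<^bsub>Halg p lam\<^esub>
     (carrier (Halg p lam) #>\<^bsub>Halg p lam\<^esub> (Hg p lam \<ominus>\<^bsub>Halg p lam\<^esub> \<one>\<^bsub>Halg p lam\<^esub>))"

definition verma :: "nat \<Rightarrow> (nat \<Rightarrow> 'k::field) \<Rightarrow> 'k \<Rightarrow> ('k H_elem, 'k H_elem set) module" where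
  "verma p lam \<alpha> = quotient_module (regular_module (Halg p lam)) (verma_ideal p lam \<alpha>)"

definition verma_class :: "nat \<Rightarrow> (nat \<Rightarrow> 'k::field) \<Rightarrow> 'k \<Rightarrow> 'k H_elem \<Rightarrow> 'k H_elem set" where
  "verma_class p lam \<alpha> h = verma_ideal p lam \<alpha> +>\<^bsub>Halg p lam\<^esub> h"

definition Smod :: "nat \<Rightarrow> (nat \<Rightarrow> 'k::field) \<Rightarrow> 'k \<Rightarrow> 'k \<Rightarrow> ('k H_elem, 'k H_elem set set) module" where
  "Smod p lam \<alpha> \<beta> =
     (let h = (if kG_zero_divisor p lam \<and> \<alpha> = 0 then Hy p lam else HY p lam)
      in quotient_module (verma p lam \<alpha>)
           (generated_submodule (Halg p lam) (verma p lam \<alpha>)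
              {verma_class p lam \<alpha> (h \<ominus>\<^bsub>Halg p lam\<^esub> Hscalar p lam \<beta>)}))"


section \<open>Dimension over \<open>k\<close> and position relative to the singular locus\<close>

text \<open>The underlying \<open>k\<close>-space of an \<open>H\<^sub>\<lambda>\<close>-module.\<close>

definition k_space ::
    "nat \<Rightarrow> (nat \<Rightarrow> 'k::field) \<Rightarrow> ('k H_elem, 'm) module \<Rightarrow> ('k, 'm) module" where
  "k_space p lam M =
     \<lparr>carrier = carrier M, mult = undefined, one = undefined,
      zero = \<zero>\<^bsub>M\<^esub>, add = add M, smult = (\<lambda>c m. Hscalar p lam c \<odot>\<^bsub>M\<^esub> m)\<rparr>"

text \<open>\<open>vectorspace.dim\<close> is only meaningful for finite-dimensional spaces.\<close>

definition has_k_dim :: "nat \<Rightarrow> (nat \<Rightarrow> 'k::field) \<Rightarrow> ('k H_elem, 'm) module \<Rightarrow> nat \<Rightarrow> bool" where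
  "has_k_dim p lam M d \<longleftrightarrow>
     vectorspace class_ring (k_space p lam M) \<and>
     vectorspace.fin_dim class_ring (k_space p lam M) \<and>
     vectorspace.dim class_ring (k_space p lam M) = d"

text \<open>The singular points of \<open>Spec Z\<^sub>\<lambda>\<close> are those at which the central element \<open>x\<^sup>p\<close> vanishes, so
  the position of a simple module relative to the singular locus is read off from the scalar by
  which \<open>x\<^sup>p\<close> acts on it.\<close>

definition over_smooth_locus :: "nat \<Rightarrow> (nat \<Rightarrow> 'k::field) \<Rightarrow> ('k H_elem, 'm) module \<Rightarrow> bool" where
  "over_smooth_locus p lam M \<longleftrightarrow>
     (\<exists>c. c \<noteq> 0 \<and>
        (\<forall>m \<in> carrier M. (Hx p lam [^]\<^bsub>Halg p lam\<^esub> p) \<odot>\<^bsub>M\<^esub> m = Hscalar p lam c \<odot>\<^bsub>M\<^esub> m))"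

definition over_singular_locus :: "nat \<Rightarrow> (nat \<Rightarrow> 'k::field) \<Rightarrow> ('k H_elem, 'm) module \<Rightarrow> bool" where
  "over_singular_locus p lam M \<longleftrightarrow>
     (\<forall>m \<in> carrier M. (Hx p lam [^]\<^bsub>Halg p lam\<^esub> p) \<odot>\<^bsub>M\<^esub> m = \<zero>\<^bsub>M\<^esub>)"

end

theory Submission
  imports Defs
begin

text \<open>\<open>H\<^sub>\<lambda>\<close> is the Ore extension \<open>R[y; \<delta>]\<close>, where \<open>u y = y u + \<delta>(u)\<close>, so a Verma module has underlying
  space \<open>k[y]\<close>. As \<open>\<delta>(r) = 0\<close> for \<open>r = \<delta>\<^sup>p(g)/\<delta>(g)\<close>, the element \<open>Y\<close> is central and acts there as
  multiplication by \<open>y\<^sup>p - r(\<alpha>, 1) y\<close>. If \<open>\<alpha> \<noteq> 0\<close> then \<open>g - 1\<close>, and if \<open>\<lambda>\<close> has nonzero augmentation then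
  \<open>x - \<alpha>\<close>, lowers every degree between \<open>1\<close> and \<open>p - 1\<close> by one; hence the multiples of
  \<open>y\<^sup>p - r(\<alpha>, 1) y - \<beta>\<close> form a maximal submodule. In the remaining case \<open>x\<close> and \<open>g - 1\<close> preserve the
  multiples of \<open>y - \<beta>\<close>, which gives a quotient of dimension one.

  Conversely, a simple module is finitely generated over the central subalgebra \<open>k[x\<^sup>p, Y]\<close>. By
  Schur's lemma its annihilator there is a maximal ideal, so by the Nullstellensatz \<open>x\<^sup>p\<close> and \<open>Y\<close> act
  as scalars. Then \<open>x - \<alpha>\<close> (for some \<open>\<alpha>\<close>) and \<open>g - 1\<close> are nilpotent and commute, a joint eigenvector
  exhibits the module as a quotient of a Verma module, and the kernel is one of the submodules above.\<close>

section \<open>Derivations\<close>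

text \<open>Oddness of \<open>p\<close> is what makes \<open>r\<close> exist:
  \<open>\<delta>\<close> changes the parity of the \<open>x\<close>-degree, so
  \<open>\<delta>\<^sup>p(g)\<close> is odd in \<open>x\<close> and divisible by
  \<open>\<delta>(g) = x g\<close>, whereas
  \<open>\<delta>\<^sup>2(g) = (\<lambda> + x\<^sup>2) g\<close> is not. The missing constant term
  extends the identity \<open>\<delta>\<^sup>p = r \<delta>\<close> from \<open>g\<close> to
  \<open>x\<close>, and this identity cancels the commutators of \<open>y\<^sup>p\<close> and of
  \<open>y r\<close> with \<open>x\<close> and \<open>g\<close>. That a Verma module is no smaller
  than \<open>k[y]\<close> comes from a concrete action on \<open>k[y]\<close>, built on the free
  algebra, extended to the smash product and then seen to kill the defining relation. Only the
  augmentation of \<open>\<lambda>\<close> matters for the dimensions, because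
  \<open>\<lambda>\<^sup>p = \<epsilon>(\<lambda>)\<^sup>p\<close> by Frobenius:
  \<open>\<lambda>\<close> is nilpotent or a unit. Simple modules are not assumed to be
  finite-dimensional, so eigenvectors come from nilpotency, by \<open>(g - 1)\<^sup>p = 0\<close>
  and \<open>(x - \<alpha>)\<^sup>p = x\<^sup>p - \<alpha>\<^sup>p\<close>. The modules
  \<open>S\<^sub>\<alpha>\<^sub>,\<^sub>\<beta>\<close> and arbitrary simple modules are both
  brought to the form \<open>k[y]/(q)\<close>, where simplicity and dimension are settled
  once.\<close>

locale derivation =
  fixes D :: "'a::comm_ring_1 \<Rightarrow> 'a"
  assumes add: "D (u + v) = D u + D v"
    and mult: "D (u * v) = D u * v + u * D v"
begin

lemma additive: "additive D"
  by standard (rule add)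

lemmas zero = additive.zero[OF additive]
  and diff = additive.diff[OF additive]
  and sum = additive.sum[OF additive]

lemma one: "D 1 = 0"
  using mult[of 1 1] by simp

lemma power: "D (u ^ n) = of_nat n * u ^ (n - 1) * D u"
proof (induction n)
  case (Suc n)
  have "D (u ^ Suc n) = D u * u ^ n + u * (of_nat n * u ^ (n - 1) * D u)"
    by (simp add: mult Suc)
  also have "u * (of_nat n * u ^ (n - 1) * D u) = of_nat n * u ^ n * D u"
    by (cases n) (simp_all add: mult_ac)
  finally show ?case by (simp add: distrib_right distrib_left mult_ac)
qed (simp add: one)

lemma funpow_add: "(D ^^ n) (u + v) = (D ^^ n) u + (D ^^ n) v"
  by (induction n) (auto simp: add)

lemma funpow_mult:
  "(D ^^ n) (u * v) = (\<Sum>i\<le>n. of_nat (n choose i) * (D ^^ i) u * (D ^^ (n - i)) v)"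
proof (induction n)
  case (Suc n)
  let ?c = "\<lambda>n i. of_nat (n choose i) :: 'a"
  have of_nat: "D (of_nat k) = 0" for k
    by (induction k) (auto simp: add one zero)
  have "(D ^^ Suc n) (u * v) = (\<Sum>i\<le>n. D (?c n i * (D ^^ i) u * (D ^^ (n - i)) v))"
    using Suc by (simp add: sum)
  also have "\<dots> = (\<Sum>i\<le>n. ?c n i * (D ^^ Suc i) u * (D ^^ (n - i)) v) +
      (\<Sum>i\<le>n. ?c n i * (D ^^ i) u * (D ^^ (Suc n - i)) v)"
    unfolding sum.distrib[symmetric]
    by (intro sum.cong refl) (auto simp: mult of_nat algebra_simps Suc_diff_le)
  also have "(\<Sum>i\<le>n. ?c n i * (D ^^ i) u * (D ^^ (Suc n - i)) v) =
      u * (D ^^ Suc n) v + (\<Sum>i<n. ?c n (Suc i) * (D ^^ Suc i) u * (D ^^ (n - i)) v)"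
    by (subst lessThan_Suc_atMost[symmetric], subst sum.lessThan_Suc_shift) simp
  also have "(\<Sum>i<n. ?c n (Suc i) * (D ^^ Suc i) u * (D ^^ (n - i)) v) =
      (\<Sum>i\<le>n. ?c n (Suc i) * (D ^^ Suc i) u * (D ^^ (n - i)) v)"
    by (rule sum.mono_neutral_left) (auto simp: binomial_eq_0)
  also have "(\<Sum>i\<le>n. ?c n i * (D ^^ Suc i) u * (D ^^ (n - i)) v) + (u * (D ^^ Suc n) v + \<dots>) =
      u * (D ^^ Suc n) v + (\<Sum>i\<le>n. ?c (Suc n) (Suc i) * (D ^^ Suc i) u * (D ^^ (n - i)) v)"
    by (simp add: sum.distrib distrib_right add_ac)
  also have "\<dots> = (\<Sum>i\<le>Suc n. ?c (Suc n) i * (D ^^ i) u * (D ^^ (Suc n - i)) v)"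
    by (subst sum.atMost_Suc_shift) (simp del: binomial_Suc_Suc)
  finally show ?case .
qed simp

end

section \<open>Iterated derivations in characteristic p\<close>

lemma of_nat_choose_prime_char:
  assumes "prime p" "CHAR('a::comm_ring_1) = p" "0 < i" "i < p"
  shows "of_nat (p choose i) = (0::'a)"
  using assms dvd_choose_prime[of i p] by (simp add: of_nat_eq_0_iff_char_dvd)

text \<open>Of the Leibniz expansion only the terms \<open>i = 0\<close> and \<open>i = p\<close>
  survive, so the \<open>p\<close>-th iterate obeys the product rule again.\<close>

lemma derivation_funpow_char:
  fixes D :: "'a::comm_ring_1 \<Rightarrow> 'a"
  assumes "derivation D" "prime p" "CHAR('a) = p"
  shows "derivation (D ^^ p)"
proof -
  interpret derivation D by fact
  have p: "p > 0" using assms(2) by (simp add: prime_gt_0_nat)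
  show ?thesis
  proof
    fix u v
    have "(D ^^ p) (u * v) = (\<Sum>i\<in>{0, p}. of_nat (p choose i) * (D ^^ i) u * (D ^^ (p - i)) v)"
      unfolding funpow_mult
      by (rule sum.mono_neutral_right) (auto simp: of_nat_choose_prime_char[OF assms(2,3)])
    then show "(D ^^ p) (u * v) = (D ^^ p) u * v + u * (D ^^ p) v"
      using p by simp
  qed (rule funpow_add)
qed

section \<open>The action of an Ore extension on polynomials in \<open>y\<close>\<close>

text \<open>If \<open>u y - y u = D u\<close>, then a base element \<open>u\<close> moves past powers of \<open>y\<close> by
  \<open>u (a + y f) = u a + y (u f) + (D u) f\<close>; base elements that reach the right end are evaluated
  by the homomorphism \<open>e\<close>.\<close>

definition rho :: "('p::comm_ring_1 \<Rightarrow> 'c::comm_ring_1) \<Rightarrow> ('p \<Rightarrow> 'p) \<Rightarrow> 'p \<Rightarrow> 'c poly \<Rightarrow> 'c poly"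
  where "rho e D u f =
    fold_coeffs (\<lambda>a F u. pCons (e u * a) (F u) + F (D u)) f (\<lambda>_. 0) u"

lemma rho_0 [simp]: "rho e D u 0 = 0"
  by (simp add: rho_def)

lemma rho_pCons: "rho e D u (pCons a f) = pCons (e u * a) (rho e D u f) + rho e D (D u) f"
  by (cases "a = 0 \<and> f = 0") (auto simp: rho_def)

text \<open>Two instances matter. With \<open>e\<close> the identity, \<open>rho\<close> describes
  normal ordering inside the algebra itself; with \<open>e\<close> an evaluation at joint
  eigenvalues of \<open>x\<close> and \<open>g\<close>, it describes a Verma module.\<close>

locale ore_verma = derivation D for D :: "'p::comm_ring_1 \<Rightarrow> 'p" +
  fixes e :: "'p \<Rightarrow> 'c::comm_ring_1"
  assumes e_add: "e (u + v) = e u + e v"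
    and e_mult: "e (u * v) = e u * e v"
    and e_one: "e 1 = 1"
begin

abbreviation act where "act \<equiv> rho e D"

lemma e_0 [simp]: "e 0 = 0"
  using e_add[of 0 0] by simp

lemma act_zero_left [simp]: "act 0 f = 0"
  by (induction f) (auto simp: rho_pCons zero)

lemma act_add_left: "act (u + v) f = act u f + act v f"
proof (induction f arbitrary: u v)
  case (pCons a f)
  then show ?case
    by (intro poly_eqI)
      (auto simp: rho_pCons add e_add coeff_pCons distrib_right add_ac split: nat.split)
qed simp

lemma act_add: "act u (f + h) = act u f + act u h"
proof (induction f h arbitrary: u rule: poly_induct2)
  case (pCons a f b h)
  then show ?case
    by (intro poly_eqI)
      (auto simp: rho_pCons coeff_pCons distrib_left add_ac split: nat.split)
qed simp

lemma act_smult: "act u (Polynomial.smult c f) = Polynomial.smult c (act u f)"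
  by (induction f arbitrary: u) (auto simp: rho_pCons smult_add_right mult_ac)

text \<open>The product rule of \<open>D\<close> is what makes the commutation rule compatible with
  products of base elements, so that \<open>rho\<close> is an action of the base ring.\<close>

lemma act_mult_left: "act (u * v) f = act u (act v f)"
proof (induction f arbitrary: u v)
  case (pCons a f)
  have "act (u * v) (pCons a f) =
      pCons (e u * e v * a) (act u (act v f)) + (act (D u) (act v f) + act u (act (D v) f))"
    by (simp add: rho_pCons e_mult mult act_add_left pCons.IH)
  also have "\<dots> = act u (act v (pCons a f))"
    by (simp add: rho_pCons act_add mult_ac)
  finally show ?case .
qed simp

text \<open>Constants of \<open>D\<close> pass all powers of \<open>y\<close> unchanged and are
  evaluated only at the right end. This is how \<open>x^p\<close>, \<open>g^p\<close> and
  \<open>r\<close> come to act by scalars.\<close>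

lemma act_const: "D u = 0 \<Longrightarrow> act u f = Polynomial.smult (e u) f"
  by (induction f) (auto simp: rho_pCons)

lemma act_one [simp]: "act 1 f = f"
  by (simp add: act_const one e_one)

lemma act_pCons_0: "act u (pCons 0 f) = pCons 0 (act u f) + act (D u) f"
  by (simp add: rho_pCons)

text \<open>The expansion \<open>u y^n = sum_m (n choose m) y^m D^(n-m)(u)\<close>, with the base
  elements evaluated by \<open>e\<close> at the right end.\<close>

lemma act_monom_coeff:
  "coeff (act u (monom 1 n)) m =
     (if m \<le> n then of_nat (n choose m) * e ((D ^^ (n - m)) u) else 0)"
proof (induction n arbitrary: u m)
  case 0
  then show ?case by (auto simp: monom_0 rho_pCons coeff_pCons split: nat.split)
next
  case (Suc n)
  show ?case
  proof (cases m)
    case 0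
    then show ?thesis by (simp add: monom_Suc act_pCons_0 Suc funpow_swap1)
  next
    case (Suc m')
    have "coeff (act u (monom 1 (Suc n))) m =
        coeff (act u (monom 1 n)) m' + coeff (act (D u) (monom 1 n)) (Suc m')"
      by (simp add: monom_Suc act_pCons_0 Suc)
    also have "\<dots> = (if m' \<le> n then of_nat (Suc n choose Suc m') * e ((D ^^ (n - m')) u) else 0)"
    proof (cases "Suc m' \<le> n")
      case True
      then have "(D ^^ (n - Suc m')) (D u) = (D ^^ (n - m')) u"
        using funpow_Suc_right[of "n - Suc m'" D] by (simp add: Suc_diff_Suc del: funpow.simps)
      then show ?thesis using True by (simp add: Suc.IH distrib_right add.commute)
    next
      case False
      then show ?thesis by (auto simp: Suc.IH binomial_eq_0)
    qed
    finally show ?thesis by (simp add: Suc)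
  qed
qed

text \<open>Each of the \<open>n\<close> powers of \<open>y\<close> that are passed contributes one
  \<open>D u\<close> just below the top. Subtracting \<open>e u\<close> times \<open>f\<close>
  cancels the top coefficient and leaves this contribution visible.\<close>

lemma act_top:
  assumes "degree f \<le> n"
  shows "(\<forall>i>n. coeff (act u f) i = 0) \<and> coeff (act u f) n = e u * coeff f n \<and>
    (\<forall>m. n = Suc m \<longrightarrow>
       coeff (act u f) m = e u * coeff f m + of_nat n * e (D u) * coeff f n)"
  using assms
proof (induction f arbitrary: n u)
  case (pCons a f)
  show ?case
  proof (cases n)
    case 0
    with pCons(2,3) have "f = 0" by (auto split: if_splits)
    then show ?thesis using 0 by (auto simp: rho_pCons coeff_pCons split: nat.split)
  next
    case (Suc k)
    with pCons.prems have k: "degree f \<le> k" by (auto split: if_splits)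
    note IH = pCons.IH[OF this, THEN conjunct1, rule_format]
      pCons.IH[OF this, THEN conjunct2, THEN conjunct1]
      pCons.IH[OF this, THEN conjunct2, THEN conjunct2, rule_format]
    have "coeff (act u (pCons a f)) i = 0" if i: "i > Suc k" for i
      using that by (cases i) (simp_all add: rho_pCons IH)
    moreover have "coeff (act u (pCons a f)) (Suc k) = e u * coeff f k"
      by (simp add: rho_pCons IH)
    moreover have "coeff (act u (pCons a f)) k =
        e u * coeff (pCons a f) k + of_nat (Suc k) * e (D u) * coeff f k"
      using IH(2)[of "D u"] IH(3)[of _ u]
      by (cases k) (simp_all add: rho_pCons algebra_simps)
    ultimately show ?thesis
      by (simp add: Suc)
  qed
qed auto

end

section \<open>The derivation on \<open>k[x][T]\<close>\<close>

text \<open>The derivation \<open>\<delta>\<close> of \<open>k[x] \<otimes> kG\<close> is induced from the polynomial ring \<open>k[x][T]\<close>, where \<open>T\<close>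
  maps to \<open>g\<close>. Working there avoids zero divisors.\<close>

definition lamT :: "nat \<Rightarrow> (nat \<Rightarrow> 'k::field) \<Rightarrow> 'k poly poly" where
  "lamT p lam = (\<Sum>i<p. monom [:lam i:] i)"

text \<open>The vector field \<open>lam * d/dx + x T * d/dT\<close>, with inner variable
  \<open>x\<close> and outer variable \<open>T\<close>; \<open>map_poly pderiv\<close> is
  \<open>d/dx\<close>.\<close>

definition deltaT :: "nat \<Rightarrow> (nat \<Rightarrow> 'k::field) \<Rightarrow> 'k poly poly \<Rightarrow> 'k poly poly" where
  "deltaT p lam q = lamT p lam * map_poly pderiv q + [:0, [:0, 1:]:] * pderiv q"

lemma derivation_pderiv: "derivation (pderiv :: 'a::{comm_ring_1,semiring_no_zero_divisors} poly \<Rightarrow> _)"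
  by standard (auto simp: pderiv_add pderiv_mult)

lemma map_poly_pderiv_pCons:
  "map_poly pderiv (pCons c q) = pCons (pderiv c) (map_poly pderiv q)"
  by (rule map_poly_pCons) simp

lemma derivation_map_poly_pderiv:
  "derivation (map_poly pderiv :: 'a::{comm_ring_1,semiring_no_zero_divisors} poly poly \<Rightarrow> _)"
proof
  show add: "map_poly pderiv (u + v) = map_poly pderiv u + map_poly pderiv v"
    for u v :: "'a poly poly"
    by (rule poly_eqI) (simp add: coeff_map_poly pderiv_add)
  have smult: "map_poly pderiv (Polynomial.smult c v) =
      Polynomial.smult (pderiv c) v + Polynomial.smult c (map_poly pderiv v)" for c and v :: "'a poly poly"
    by (rule poly_eqI) (simp add: coeff_map_poly pderiv_mult algebra_simps)
  show "map_poly pderiv (u * v) = map_poly pderiv u * v + u * map_poly pderiv v"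
    for u v :: "'a poly poly"
    by (induction u) (simp_all add: map_poly_pderiv_pCons add smult)
qed

lemma derivation_linear_combination:
  assumes "derivation D" "derivation D'"
  shows "derivation (\<lambda>q. a * D q + b * D' q)"
  using assms by (simp add: derivation_def algebra_simps)

lemma derivation_deltaT: "derivation (deltaT p lam)"
  unfolding deltaT_def
  by (rule derivation_linear_combination[OF derivation_map_poly_pderiv derivation_pderiv])

interpretation deltaT: derivation "deltaT p lam"
  by (rule derivation_deltaT)

lemma deltaT_const [simp]: "deltaT p lam [:[:c:]:] = 0"
  by (simp add: deltaT_def map_poly_pderiv_pCons)

lemma deltaT_x: "deltaT p lam [:[:0, 1:]:] = lamT p lam"
  by (simp add: deltaT_def map_poly_pderiv_pCons pderiv_pCons flip: one_pCons)

lemma deltaT_T: "deltaT p lam [:0, 1:] = [:0, [:0, 1:]:]"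
  by (simp add: deltaT_def map_poly_pderiv_pCons pderiv_pCons)

text \<open>Chain rule, by induction over both layers of coefficients. It serves for the
  \<open>p\<close>-th iterate of \<open>deltaT\<close>, of which only the values at \<open>x\<close>
  and \<open>T\<close> then have to be known.\<close>

lemma derivation_eq_partials:
  fixes D :: "'k::field poly poly \<Rightarrow> 'k poly poly"
  assumes "derivation D" and const: "\<And>c. D [:[:c:]:] = 0"
  shows "D q = map_poly pderiv q * D [:[:0, 1:]:] + pderiv q * D [:0, 1:]"
proof -
  interpret derivation D by fact
  have inner: "D [:c:] = [:pderiv c:] * D [:[:0, 1:]:]" for c
  proof (induction c)
    case (pCons a c)
    have "D [:pCons a c:] = D ([:[:a:]:] + [:[:0, 1:]:] * [:c:])" by simp
    moreover have "[:pderiv (pCons a c):] = [:c:] + [:[:0, 1:]:] * [:pderiv c:]"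
      by (simp add: pderiv_pCons)
    ultimately show ?case
      by (simp only: add mult const pCons ring_distribs mult_ac add_ac add_0_left add_0_right)
  qed (simp add: zero)
  show ?thesis
  proof (induction q)
    case (pCons c q)
    have "D (pCons c q) = D ([:c:] + [:0, 1:] * q)" by simp
    moreover have "map_poly pderiv (pCons c q) = [:pderiv c:] + [:0, 1:] * map_poly pderiv q"
      by (simp add: map_poly_pderiv_pCons)
    moreover have "pderiv (pCons c q) = q + [:0, 1:] * pderiv q"
      by (simp add: pderiv_pCons)
    ultimately show ?case
      by (simp only: add mult inner[of c] pCons ring_distribs mult_ac add_ac)
  qed (simp add: zero)
qed

section \<open>Divisibility of the iterated derivatives of T\<close>

definition x_parity :: "nat \<Rightarrow> 'k::zero poly poly \<Rightarrow> bool" where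
  "x_parity e q \<longleftrightarrow> (\<forall>i j. odd (j + e) \<longrightarrow> coeff (coeff q i) j = 0)"

lemma x_parityD: "x_parity e q \<Longrightarrow> odd (j + e) \<Longrightarrow> coeff (coeff q i) j = 0"
  by (simp add: x_parity_def)

lemma x_parity_add: "x_parity e q \<Longrightarrow> x_parity e q' \<Longrightarrow> x_parity e (q + q')"
  for q :: "'k::comm_monoid_add poly poly"
  by (simp add: x_parity_def)

lemma x_parity_sum: "(\<And>i. i \<in> I \<Longrightarrow> x_parity e (f i)) \<Longrightarrow> x_parity e (sum f I)"
  for f :: "_ \<Rightarrow> 'k::comm_monoid_add poly poly"
  by (simp add: x_parity_def coeff_sum)

lemma x_parity_lamT_mult:
  assumes "x_parity e q"
  shows "x_parity e (lamT p lam * q)"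
proof -
  have "x_parity e (monom [:c:] i * q)" for c i
    using assms by (simp add: x_parity_def coeff_monom_mult)
  then show ?thesis
    unfolding lamT_def sum_distrib_right by (intro x_parity_sum)
qed

text \<open>\<open>lam\<close> does not involve \<open>x\<close>, so \<open>lam * d/dx\<close>
  lowers the \<open>x\<close>-degree by one while \<open>x T * d/dT\<close> raises it by one: either
  summand flips the parity.\<close>

lemma x_parity_deltaT:
  assumes "x_parity e q"
  shows "x_parity (Suc e) (deltaT p lam q)"
  unfolding deltaT_def
proof (intro x_parity_add x_parity_lamT_mult)
  show "x_parity (Suc e) (map_poly pderiv q)"
    using x_parityD[OF assms, of "Suc _"] by (simp add: x_parity_def coeff_map_poly coeff_pderiv)
  have "coeff (coeff ([:0, [:0, 1:]:] * pderiv q) i) j = 0" if "odd (j + Suc e)" for i j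
    using that x_parityD[OF assms, of "j - 1" i]
    by (cases i; cases j) (simp_all add: coeff_pderiv of_nat_poly)
  then show "x_parity (Suc e) ([:0, [:0, 1:]:] * pderiv q)"
    unfolding x_parity_def by blast
qed

lemma x_parity_deltaT_funpow: "x_parity n ((deltaT p lam ^^ n) [:0, 1:])"
proof (induction n)
  case 0
  show ?case by (auto simp: x_parity_def coeff_pCons odd_pos split: nat.splits)
qed (simp add: x_parity_deltaT)

lemma deltaT_funpow_T_dvd: "\<exists>v. (deltaT p lam ^^ n) [:0, 1:] = pCons 0 v"
proof (induction n)
  case (Suc n)
  then obtain v where "(deltaT p lam ^^ n) [:0, 1:] = [:0, 1:] * v" by auto
  then have "(deltaT p lam ^^ Suc n) [:0, 1:] = [:0, [:0, 1:]:] * v + [:0, 1:] * deltaT p lam v"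
    by (simp only: funpow.simps o_apply deltaT.mult deltaT_T)
  also have "\<dots> = pCons 0 (Polynomial.smult [:0, 1:] v + deltaT p lam v)"
    by simp
  finally show ?case by blast
qed auto

text \<open>The divisor is \<open>x T\<close>. Every iterate is divisible by \<open>T\<close>; for
  odd \<open>n\<close> all exponents of \<open>x\<close> are odd as well, which supplies the factor
  \<open>x\<close>.\<close>

lemma deltaT_funpow_T:
  assumes "odd n"
  shows "\<exists>r. (deltaT p lam ^^ n) [:0, 1:] = r * deltaT p lam [:0, 1:]"
proof -
  obtain v where v: "(deltaT p lam ^^ n) [:0, 1:] = pCons 0 v"
    using deltaT_funpow_T_dvd by blast
  have "coeff (coeff v i) 0 = 0" for i
    using x_parity_deltaT_funpow[of n p lam] assms
    by (auto simp: v dest: x_parityD[where i = "Suc i" and j = 0])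
  \<comment> \<open>Each coefficient of \<open>v\<close> vanishes at \<open>x = 0\<close>, and
    \<open>poly_shift 1\<close> divides it by \<open>x\<close>.\<close>
  then have "v = Polynomial.smult [:0, 1:] (map_poly (poly_shift 1) v)"
    by (intro poly_eqI) (auto simp: coeff_map_poly coeff_pCons coeff_poly_shift split: nat.split)
  then have "(deltaT p lam ^^ n) [:0, 1:] = map_poly (poly_shift 1) v * deltaT p lam [:0, 1:]"
    by (simp add: v deltaT_T)
  then show ?thesis by blast
qed

text \<open>A lift of \<open>\<delta>\<^sup>p(g)/\<delta>(g)\<close>. The choice is harmless because
  \<open>k[x][T]\<close> is a domain and \<open>x T\<close> is nonzero.\<close>

definition rT :: "nat \<Rightarrow> (nat \<Rightarrow> 'k::field) \<Rightarrow> 'k poly poly" where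
  "rT p lam = (SOME r. (deltaT p lam ^^ p) [:0, 1:] = r * deltaT p lam [:0, 1:])"

lemma deltaT_funpow_p_T:
  "odd p \<Longrightarrow> (deltaT p lam ^^ p) [:0, 1:] = rT p lam * deltaT p lam [:0, 1:]"
  unfolding rT_def by (rule someI_ex[OF deltaT_funpow_T])

text \<open>As \<open>\<lambda>\<close> has no constant term, it is \<open>T \<mu>'\<close> for some \<open>\<mu>\<close>, and then \<open>\<delta>\<close> kills \<open>x\<^sup>2 - 2 \<mu>\<close>. Applying
  the derivation \<open>\<delta>\<^sup>p\<close> to this element yields its value at \<open>x\<close> from its value at \<open>T\<close>.\<close>

lemma deltaT_funpow_p:
  fixes lam :: "nat \<Rightarrow> 'k::field"
  assumes "prime p" "odd p" "CHAR('k) = p" "lam 0 = 0"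
  shows "(deltaT p lam ^^ p) q = rT p lam * deltaT p lam q"
proof -
  let ?D = "deltaT p lam" and ?x = "[:[:0, 1:]:] :: 'k poly poly"
    and ?T = "[:0, 1:] :: 'k poly poly" and ?r = "rT p lam"
  have p0: "p \<noteq> 0" using assms(1) by (auto)
  have der: "derivation (?D ^^ p)"
    by (rule derivation_funpow_char) (use assms derivation_deltaT in auto)
  interpret P: derivation "?D ^^ p" by (rule der)
  have zero: "(?D ^^ p) u = 0" if "?D u = 0" for u
  proof -
    have "(?D ^^ p) u = (?D ^^ (p - 1)) (?D u)"
      using p0 by (metis Suc_diff_1 funpow_Suc_right neq0_conv o_apply)
    moreover have "(?D ^^ k) 0 = 0" for k
      by (induction k) (auto simp: deltaT.zero)
    ultimately show ?thesis using that by simp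
  qed
  have const: "(?D ^^ p) [:[:c:]:] = 0" for c
    by (rule zero) simp
  \<comment> \<open>An antiderivative, with \<open>T * pderiv mu = lamT p lam\<close>. Division by
    \<open>i\<close> is legitimate for \<open>0 < i < p\<close>, and the term \<open>i = 0\<close>
    is \<open>0 / 0 = 0\<close>, in accordance with \<open>lam 0 = 0\<close>.\<close>
  define mu :: "'k poly poly" where "mu = (\<Sum>i<p. monom [:lam i / of_nat i:] i)"
  have "?T * pderiv (monom [:lam i / of_nat i:] i) = monom [:lam i:] i" if "i < p" for i
  proof (cases i)
    case (Suc j)
    have "\<not> CHAR('k) dvd i"
      using that assms(3) Suc by (auto dest: dvd_imp_le)
    then have "of_nat i \<noteq> (0::'k)"
      by (simp only: of_nat_eq_0_iff_char_dvd not_False_eq_True)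
    then have "pderiv (monom [:lam i / of_nat i:] i) = monom [:lam i:] j"
      by (simp add: Suc pderiv_monom of_nat_poly del: of_nat_Suc)
    then show ?thesis
      by (simp add: monom_Suc Suc)
  qed (simp add: assms(4))
  then have mu1: "?T * pderiv mu = lamT p lam"
    unfolding mu_def lamT_def derivation.sum[OF derivation_pderiv] sum_distrib_left by (intro sum.cong) auto
  have mu2: "map_poly pderiv mu = 0"
    unfolding mu_def derivation.sum[OF derivation_map_poly_pderiv]
    by (intro sum.neutral) (auto simp: map_poly_monom)
  \<comment> \<open>Stated for a general \<open>D\<close> because it is applied twice: to
    \<open>deltaT\<close>, where the value is zero, and to its \<open>p\<close>-th iterate, where it
    links the values at \<open>x\<close> and \<open>T\<close>.\<close>
  have xmu: "D (?x\<^sup>2 - 2 * mu) = 2 * (?x * D ?x - pderiv mu * D ?T)"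
    if "derivation D" "\<And>c. D [:[:c:]:] = 0" for D
  proof -
    interpret D: derivation D by fact
    have mu: "D mu = pderiv mu * D ?T"
      using derivation_eq_partials[OF that, of mu] by (simp add: mu2)
    have "D (?x\<^sup>2 - (mu + mu)) = ?x * D ?x + ?x * D ?x - (D mu + D mu)"
      by (simp only: power2_eq_square D.diff D.add D.mult) (simp add: mult.commute)
    then show ?thesis by (simp add: mu mult_2 [symmetric] algebra_simps)
  qed
  have xT: "?D ?T = ?x * ?T" by (simp add: deltaT_T)
  have "?D (?x\<^sup>2 - 2 * mu) = 2 * (?x * lamT p lam - ?x * (?T * pderiv mu))"
    by (subst xmu[OF derivation_deltaT deltaT_const]) (simp only: deltaT_x xT mult_ac)
  then have "(?D ^^ p) (?x\<^sup>2 - 2 * mu) = 0"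
    by (intro zero) (simp only: mu1 diff_self mult_zero_right)
  then have "2 * (?x * (?D ^^ p) ?x - pderiv mu * (?D ^^ p) ?T) = 0"
    by (subst (asm) xmu[OF der const])
  \<comment> \<open>The factor \<open>2\<close> from differentiating the square can be cancelled
    because \<open>p\<close> is odd.\<close>
  moreover have "(2 :: 'k poly poly) \<noteq> 0"
  proof
    assume "(2 :: 'k poly poly) = 0"
    then have "of_nat 2 = (0 :: 'k poly poly)" by simp
    then have "p dvd 2" unfolding of_nat_eq_0_iff_char_dvd by (simp add: assms(3))
    then show False using assms(1,2) by (metis dvd_refl primes_dvd_imp_eq two_is_prime_nat)
  qed
  ultimately have "?x * (?D ^^ p) ?x = pderiv mu * (?D ^^ p) ?T"
    by (metis mult_eq_0_iff right_minus_eq)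
  also have "\<dots> = ?x * (?r * (?T * pderiv mu))"
    by (simp only: deltaT_funpow_p_T[OF assms(2)] xT mult_ac)
  finally have "?x * (?D ^^ p) ?x = ?x * (?r * lamT p lam)"
    by (simp only: mu1)
  then have x: "(?D ^^ p) ?x = ?r * lamT p lam"
    by (subst (asm) mult_left_cancel) auto
  show ?thesis
    unfolding derivation_eq_partials[OF der const, of q]
    by (simp only: x deltaT_funpow_p_T[OF assms(2)] deltaT_T deltaT_def[of p lam q]
        ring_distribs mult_ac)
qed

text \<open>\<open>\<delta>\<close> commutes with its \<open>p\<close>-th iterate. Comparing both
  orders at \<open>T\<close> gives \<open>\<delta>(r) \<delta>(T) = 0\<close>, and
  \<open>\<delta>(T)\<close> is not a zero divisor.\<close>

lemma deltaT_rT: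
  fixes lam :: "nat \<Rightarrow> 'k::field"
  assumes "prime p" "odd p" "CHAR('k) = p" "lam 0 = 0"
  shows "deltaT p lam (rT p lam) = 0"
proof -
  let ?D = "deltaT p lam" and ?T = "[:0, 1:] :: 'k poly poly" and ?r = "rT p lam"
  have "?D ((?D ^^ p) ?T) = (?D ^^ p) (?D ?T)"
    by (rule funpow_swap1)
  then have "?D ?r * ?D ?T = 0"
    by (simp add: deltaT_funpow_p[where lam = lam, OF assms] deltaT.mult)
  then show ?thesis by (simp add: deltaT_T)
qed

text \<open>Evaluation at \<open>x = \<alpha>\<close>, \<open>T = 1\<close>, the eigenvalues of
  \<open>x\<close> and \<open>g\<close> on the generator of the Verma module.\<close>

definition evT :: "'k::field \<Rightarrow> 'k poly poly \<Rightarrow> 'k" where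
  "evT \<alpha> q = poly (poly q 1) \<alpha>"

lemma evT_simps [simp]:
  "evT \<alpha> (u + v) = evT \<alpha> u + evT \<alpha> v" "evT \<alpha> (u * v) = evT \<alpha> u * evT \<alpha> v"
  "evT \<alpha> 1 = 1" "evT \<alpha> 0 = 0" "evT \<alpha> (pCons c q) = poly c \<alpha> + evT \<alpha> q"
  by (simp_all add: evT_def)

lemma evT_lamT: "evT \<alpha> (lamT p lam) = (\<Sum>i<p. lam i)"
  by (simp add: evT_def lamT_def poly_sum poly_monom)

interpretation verma: ore_verma "deltaT p lam" "evT \<alpha>"
  by standard simp_all

section \<open>Nullstellensatz for two variables\<close>

text \<open>\<open>inverse_mod\<close> says that the quotient is a field. Maximality is put this way
  because Schur's lemma delivers it in this form.\<close>

locale maximal_ideal_set =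
  fixes I :: "'a::comm_ring_1 set"
  assumes add_mem: "a \<in> I \<Longrightarrow> b \<in> I \<Longrightarrow> a + b \<in> I"
    and mult_mem: "a \<in> I \<Longrightarrow> r * a \<in> I"
    and one_notin: "1 \<notin> I"
    and inverse_mod: "a \<notin> I \<Longrightarrow> \<exists>b. 1 - a * b \<in> I"
begin

lemma mult_mem': "a \<in> I \<Longrightarrow> a * r \<in> I"
  using mult_mem[of a r] by (simp add: mult.commute)

lemma prime_mem: "a * b \<in> I \<Longrightarrow> a \<in> I \<or> b \<in> I"
proof (rule disjCI)
  assume ab: "a * b \<in> I" and "b \<notin> I"
  then obtain w where "1 - b * w \<in> I" using inverse_mod by blast
  from add_mem[OF mult_mem[OF this, of a] mult_mem'[OF ab, of w]]
  show "a \<in> I" by (simp add: algebra_simps)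
qed

text \<open>\<open>t\<close> splits into linear factors and a constant. The ideal is prime, so one
  factor is mapped into \<open>I\<close>, and it cannot be the constant, which is a unit.\<close>

lemma linear_factor_mem:
  fixes \<phi> :: "'k::alg_closed_field poly \<Rightarrow> 'a"
  assumes \<phi>: "\<And>s t. \<phi> (s * t) = \<phi> s * \<phi> t" "\<phi> 1 = 1"
    and t: "\<phi> t \<in> I" "t \<noteq> 0"
  shows "\<exists>c. \<phi> [:- c, 1:] \<in> I"
  using t
proof (induction "degree t" arbitrary: t)
  case 0
  then obtain a where t: "t = [:a:]" by (metis degree_eq_zeroE)
  with 0 have "[:inverse a:] * t = 1" by (simp flip: one_pCons)
  then have "1 \<in> I" using mult_mem[OF 0(2), of "\<phi> [:inverse a:]"] by (metis \<phi>)
  then show ?case using one_notin by blast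
next
  case (Suc n)
  then obtain c where "poly t c = 0" using alg_closed_imp_poly_has_root[of t] by auto
  then obtain t' where t': "t = [:- c, 1:] * t'" by (auto simp: poly_eq_0_iff_dvd)
  with Suc have t'0: "t' \<noteq> 0" by auto
  have "degree t = degree [:- c, 1:] + degree t'"
    unfolding t' by (rule degree_mult_eq) (use t'0 in auto)
  then have "n = degree t'" using Suc(2) by simp
  moreover have "\<phi> [:- c, 1:] * \<phi> t' \<in> I"
    using Suc(3) unfolding t' \<phi>(1) .
  ultimately show ?case
    using Suc(1)[of t'] t'0 prime_mem by blast
qed

end

text \<open>When \<open>s\<close> is not constant, \<open>s - 1\<close> has a root, and there
  \<open>s\<close> takes the value \<open>1\<close>.\<close>

lemma alg_closed_poly_nonzero:
  fixes s :: "'k::alg_closed_field poly"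
  assumes "s \<noteq> 0"
  shows "\<exists>c. poly s c \<noteq> 0"
proof (cases "degree s = 0")
  case True
  then obtain a where "s = [:a:]" by (metis degree_eq_zeroE)
  then show ?thesis using assms by auto
next
  case False
  then have "degree (s - 1) > 0"
    using degree_add_eq_left[of "- 1" s] by (simp only: degree_minus degree_1 diff_conv_add_uminus)
  then obtain c where "poly (s - 1) c = 0" using alg_closed_imp_poly_has_root by blast
  then show ?thesis by (intro exI[of _ c]) simp
qed

text \<open>If \<open>I\<close> contained no \<open>x - c\<close>, it would meet \<open>k[x]\<close>
  only in \<open>0\<close>, and every \<open>x - c\<close> would be invertible modulo
  \<open>I\<close>. A nonzero element of least \<open>T\<close>-degree gives a common denominator
  for these inverses, up to powers of its leading coefficient; a point \<open>c\<close> where that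
  coefficient does not vanish yields a contradiction. Modulo \<open>x - c\<close> only polynomials
  in \<open>T\<close> remain.\<close>

theorem maximal_ideal_bivariate:
  fixes I :: "'k::alg_closed_field poly poly set"
  assumes "maximal_ideal_set I"
  shows "\<exists>c d. [:[:- c, 1:]:] \<in> I \<and> [:[:- d:], 1:] \<in> I"
proof -
  interpret maximal_ideal_set I by fact
  have ex_c: "\<exists>c. [:[:- c, 1:]:] \<in> I"
  proof (rule ccontr)
    assume "\<not> ?thesis"
    then have no_c: "[:[:- c, 1:]:] \<notin> I" for c by blast
    have const: "t = 0" if "[:t:] \<in> I" for t
      using linear_factor_mem[of "\<lambda>t. [:t:]", OF _ _ that] no_c by (auto simp: one_pCons)
    \<comment> \<open>This inverse of \<open>x\<close> serves to produce a nonzero element of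
      \<open>I\<close>.\<close>
    obtain w where w: "1 - [:[:0, 1:]:] * w \<in> I"
      using inverse_mod[of "[:[:0, 1:]:]"] no_c[of 0] by auto
    have "poly (coeff (1 - [:[:0, 1:]:] * w) 0) 0 = 1" by simp
    then have "1 - [:[:0, 1:]:] * w \<noteq> 0"
      by (metis coeff_0 poly_0 zero_neq_one)
    with w have "\<exists>q. q \<in> I \<and> q \<noteq> 0" by blast
    then obtain q where q: "q \<in> I" "q \<noteq> 0"
      and min: "\<And>r. r \<in> I \<Longrightarrow> r \<noteq> 0 \<Longrightarrow> degree q \<le> degree r"
      using ex_has_least_nat[of "\<lambda>q. q \<in> I \<and> q \<noteq> 0" _ degree] by metis
    have n: "degree q > 0"
      using const q by (metis degree_eq_zeroE neq0_conv pCons_0_0)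
    obtain c where c: "poly (lead_coeff q) c \<noteq> 0"
      using alg_closed_poly_nonzero[of "lead_coeff q"] q by auto
    obtain v where v: "1 - [:[:- c, 1:]:] * v \<in> I"
      using inverse_mod[OF no_c] by blast
    \<comment> \<open>Dividing \<open>v\<close> by \<open>q\<close> requires a power of the leading
      coefficient, since the coefficients lie in \<open>k[x]\<close>, which is not a field.\<close>
    obtain h r where hr: "pseudo_divmod v q = (h, r)" by fastforce
    obtain e where vr: "Polynomial.smult (lead_coeff q ^ e) v = q * h + r"
      and r: "r = 0 \<or> degree r < degree q"
      using pseudo_divmod[OF q(2) hr] by metis
    let ?s = "lead_coeff q ^ e"
    have "[:?s:] * (1 - [:[:- c, 1:]:] * v) + q * (h * [:[:- c, 1:]:]) \<in> I"
      by (intro add_mem mult_mem mult_mem' v q)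
    also have "[:?s:] * (1 - [:[:- c, 1:]:] * v) + q * (h * [:[:- c, 1:]:]) =
        [:?s:] - [:[:- c, 1:]:] * (Polynomial.smult ?s v - q * h)"
      by (simp add: algebra_simps)
    also have "Polynomial.smult ?s v - q * h = r" by (simp add: vr)
    finally have mem: "[:?s:] - [:[:- c, 1:]:] * r \<in> I" .
    \<comment> \<open>An element of \<open>I\<close> of degree below the minimum must vanish. This
      forces \<open>x - c\<close> to divide \<open>?s\<close>, although \<open>?s\<close> is nonzero
      at \<open>c\<close>.\<close>
    have "degree ([:?s:] - [:[:- c, 1:]:] * r) < degree q"
      using r n by (intro degree_diff_less) auto
    with mem min have "[:?s:] = [:[:- c, 1:]:] * r" by force
    from arg_cong[OF this, of "\<lambda>q. coeff q 0"] have "?s = [:- c, 1:] * coeff r 0"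
      by (simp only: coeff_pCons_0 coeff_mult_0)
    then have "poly ?s c = 0" by simp
    with c show False by simp
  qed
  then obtain c where c: "[:[:- c, 1:]:] \<in> I" by blast
  let ?\<phi> = "map_poly (\<lambda>a. [:a:]) :: 'k poly \<Rightarrow> 'k poly poly"
  have add: "?\<phi> (s + t) = ?\<phi> s + ?\<phi> t" for s t
    by (rule poly_eqI) (simp add: coeff_map_poly)
  have smult: "?\<phi> (Polynomial.smult a t) = Polynomial.smult [:a:] (?\<phi> t)" for a t
    by (rule poly_eqI) (simp add: coeff_map_poly)
  have mult: "?\<phi> (s * t) = ?\<phi> s * ?\<phi> t" for s t
    by (induction s) (simp_all add: add smult map_poly_pCons)
  have one: "?\<phi> 1 = 1" by (simp add: map_poly_pCons one_pCons)
  have diff: "?\<phi> (s - t) = ?\<phi> s - ?\<phi> t" for s t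
    by (rule poly_eqI) (simp add: coeff_map_poly)
  have x: "?\<phi> [:0, 1:] = [:0, 1:]" by (simp add: map_poly_pCons one_pCons)
  have reduce: "w - ?\<phi> (map_poly (\<lambda>a. poly a c) w) \<in> I" for w
  proof (induction w)
    case 0
    show ?case using mult_mem[OF c, of 0] by simp
  next
    case (pCons a w)
    have "[:- c, 1:] dvd a - [:poly a c:]"
      by (simp flip: poly_eq_0_iff_dvd)
    then obtain b where b: "a - [:poly a c:] = [:- c, 1:] * b" by blast
    have "[:a - [:poly a c:]:] + [:0, 1:] * (w - ?\<phi> (map_poly (\<lambda>a. poly a c) w)) \<in> I"
      using mult_mem[OF c, of "[:b:]"] by (intro add_mem mult_mem pCons) (simp add: b mult.commute)
    then show ?case by (simp add: map_poly_pCons)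
  qed
  \<comment> \<open>Either \<open>T\<close> lies in \<open>I\<close>, or it has an inverse
    \<open>w\<close> modulo \<open>I\<close>; then specialising \<open>1 - T w\<close> at
    \<open>x = c\<close> keeps the constant term \<open>1\<close> and gives a nonzero polynomial in
    \<open>T\<close> alone.\<close>
  have "\<exists>t. t \<noteq> 0 \<and> ?\<phi> t \<in> I"
  proof (cases "[:0, 1:] \<in> I")
    case True
    then have "?\<phi> [:0, 1:] \<in> I" by (simp only: x)
    then show ?thesis by (intro exI[of _ "[:0, 1:]"]) simp
  next
    case False
    then obtain w where w: "1 - [:0, 1:] * w \<in> I" using inverse_mod by blast
    let ?t = "1 - [:0, 1:] * map_poly (\<lambda>a. poly a c) w"
    have "?\<phi> ?t = 1 - [:0, 1:] * w + [:0, 1:] * (w - ?\<phi> (map_poly (\<lambda>a. poly a c) w))"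
      by (simp only: diff mult one x right_diff_distrib) (simp only: add_diff_eq diff_add_cancel)
    then have "?\<phi> ?t \<in> I" by (simp only:) (intro add_mem mult_mem w reduce)
    moreover have "coeff ?t 0 = 1" by simp
    then have "?t \<noteq> 0" by (metis coeff_0 zero_neq_one)
    ultimately show ?thesis by blast
  qed
  then obtain d where "?\<phi> [:- d, 1:] \<in> I"
    using linear_factor_mem[of ?\<phi>, OF mult one] by blast
  with c show ?thesis by (auto simp: map_poly_pCons one_pCons)
qed

section \<open>Simple modules that are finitely generated over a central subring\<close>

locale comm_ring_action = M?: abelian_group M
  for M :: "('m, 'd) ring_scheme" (structure) +
  fixes act :: "'c::comm_ring_1 \<Rightarrow> 'm \<Rightarrow> 'm"
  assumes act_closed [simp]: "m \<in> carrier M \<Longrightarrow> act c m \<in> carrier M"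
    and act_add: "m \<in> carrier M \<Longrightarrow> n \<in> carrier M \<Longrightarrow> act c (m \<oplus> n) = act c m \<oplus> act c n"
    and act_add_left: "m \<in> carrier M \<Longrightarrow> act (c + d) m = act c m \<oplus> act d m"
    and act_mult_left: "m \<in> carrier M \<Longrightarrow> act (c * d) m = act c (act d m)"
    and act_one: "m \<in> carrier M \<Longrightarrow> act 1 m = m"
begin

primrec lspan :: "'m list \<Rightarrow> 'm set" where
  "lspan [] = {\<zero>}"
| "lspan (m # ms) = {act c m \<oplus> v | c v. v \<in> lspan ms}"

lemma act_zero [simp]: "act c \<zero> = \<zero>"
  using act_add[of \<zero> \<zero> c] by (metis M.add.l_cancel_one' M.zero_closed act_closed M.l_zero)

lemma act_zero_left: "m \<in> carrier M \<Longrightarrow> act 0 m = \<zero>"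
  using act_add_left[of m 0 0] by (metis M.add.l_cancel_one' act_closed add_0)

lemma lspan_closed: "set ms \<subseteq> carrier M \<Longrightarrow> lspan ms \<subseteq> carrier M"
  by (induction ms) auto

lemma zero_lspan: "set ms \<subseteq> carrier M \<Longrightarrow> \<zero> \<in> lspan ms"
proof (induction ms)
  case (Cons m ms)
  then show ?case
    by (auto intro!: exI[of _ "0::'c"] exI[of _ \<zero>] simp: act_zero_left)
qed simp

lemma lspan_add:
  "set ms \<subseteq> carrier M \<Longrightarrow> u \<in> lspan ms \<Longrightarrow> v \<in> lspan ms \<Longrightarrow> u \<oplus> v \<in> lspan ms"
proof (induction ms arbitrary: u v)
  case (Cons m ms)
  then obtain c d u' v' where *: "u = act c m \<oplus> u'" "v = act d m \<oplus> v'"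
    "u' \<in> lspan ms" "v' \<in> lspan ms" by auto
  then have "u' \<in> carrier M" "v' \<in> carrier M" "m \<in> carrier M" "u' \<oplus> v' \<in> lspan ms"
    using Cons lspan_closed[of ms] by auto
  then show ?case
    by (auto intro!: exI[of _ "c + d"] exI[of _ "u' \<oplus> v'"] simp: * act_add_left M.a_ac)
qed simp

lemma lspan_act: "set ms \<subseteq> carrier M \<Longrightarrow> u \<in> lspan ms \<Longrightarrow> act c u \<in> lspan ms"
proof (induction ms arbitrary: u)
  case (Cons m ms)
  then obtain d u' where *: "u = act d m \<oplus> u'" "u' \<in> lspan ms" by auto
  then have "u' \<in> carrier M" "m \<in> carrier M" "act c u' \<in> lspan ms"
    using Cons lspan_closed[of ms] by auto
  then show ?case
    by (auto intro!: exI[of _ "c * d"] exI[of _ "act c u'"] simp: * act_add act_mult_left)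
qed simp

lemma lspan_mem: "set ms \<subseteq> carrier M \<Longrightarrow> m \<in> set ms \<Longrightarrow> m \<in> lspan ms"
proof (induction ms)
  case (Cons m' ms)
  then have m': "m' \<in> carrier M" "m \<in> carrier M" "set ms \<subseteq> carrier M" by auto
  show ?case
  proof (cases "m = m'")
    case True
    then show ?thesis using m' zero_lspan[of ms]
      by (auto intro!: exI[of _ "1::'c"] exI[of _ \<zero>] simp: act_one)
  next
    case False
    then show ?thesis using m' Cons
      by (auto intro!: exI[of _ "0::'c"] exI[of _ m] simp: act_zero_left)
  qed
qed simp

lemma lspan_least:
  assumes "\<zero> \<in> N" "\<And>u v. u \<in> N \<Longrightarrow> v \<in> N \<Longrightarrow> u \<oplus> v \<in> N" "\<And>c u. u \<in> N \<Longrightarrow> act c u \<in> N"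
  shows "set ms \<subseteq> N \<Longrightarrow> lspan ms \<subseteq> N"
  by (induction ms) (auto intro: assms)

lemma lspan_mono: "set ms \<subseteq> set ms' \<Longrightarrow> set ms' \<subseteq> carrier M \<Longrightarrow> lspan ms \<subseteq> lspan ms'"
  by (rule lspan_least) (auto intro: zero_lspan lspan_add lspan_act lspan_mem)

text \<open>Take a shortest generating list \<open>m # ms\<close>. If \<open>z\<close> is surjective then \<open>m = z (c m + v)\<close>, so
  \<open>(1 - z c) m\<close> lies in the span of \<open>ms\<close>; were \<open>1 - z c\<close> surjective too, \<open>ms\<close> would generate.\<close>

theorem annihilator_maximal:
  assumes schur: "\<And>c. (\<forall>m \<in> carrier M. act c m = \<zero>) \<or> act c ` carrier M = carrier M"
    and fg: "set ms \<subseteq> carrier M" "carrier M \<subseteq> lspan ms"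
    and nontrivial: "carrier M \<noteq> {\<zero>}"
  shows "maximal_ideal_set {c. \<forall>m \<in> carrier M. act c m = \<zero>}"
proof -
  let ?P = "\<lambda>ms. set ms \<subseteq> carrier M \<and> carrier M \<subseteq> lspan ms"
  obtain ms where ms: "?P ms" and min: "\<And>ns. ?P ns \<Longrightarrow> length ms \<le> length ns"
    using ex_has_least_nat[of ?P ms length] fg by blast
  have "ms \<noteq> []" using ms nontrivial by auto
  then obtain m ms' where m: "ms = m # ms'" by (meson neq_Nil_conv)
  then have mM: "m \<in> carrier M" "set ms' \<subseteq> carrier M" using ms by auto
  note sub = lspan_closed[OF mM(2)]
  have diff: "act (c - d) n = act c n \<ominus> act d n" if "n \<in> carrier M" for c d n
    using act_add_left[of n "c - d" d] that
    by (metis M.add.inv_solve_right M.minus_eq act_closed diff_add_cancel)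
  show ?thesis
  proof
    show "\<exists>b. 1 - a * b \<in> {c. \<forall>m \<in> carrier M. act c m = \<zero>}"
      if a: "a \<notin> {c. \<forall>m \<in> carrier M. act c m = \<zero>}" for a
    proof -
      from a schur have surj: "act a ` carrier M = carrier M" by blast
      then obtain n where n: "n \<in> carrier M" "m = act a n" using mM by (metis imageE)
      with ms m obtain c v where cv: "n = act c m \<oplus> v" "v \<in> lspan ms'" by auto
      then have v: "v \<in> carrier M" using sub by blast
      have "m = act (a * c) m \<oplus> act a v"
        using cv v mM n by (metis act_add act_closed act_mult_left)
      then have "act (1 - a * c) m = act a v"
        using mM v by (subst diff) (auto simp: act_one M.minus_eq M.a_ac M.r_neg2
            intro: M.add.inv_solve_right'[THEN iffD2])
      then have small: "act (1 - a * c) m \<in> lspan ms'"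
        using lspan_act[OF mM(2) cv(2)] by simp
      have False if "act (1 - a * c) ` carrier M = carrier M"
      proof -
        have "act (1 - a * c) u \<in> lspan ms'" if u: "u \<in> carrier M" for u
        proof -
          from u ms m obtain d w where dw: "u = act d m \<oplus> w" "w \<in> lspan ms'" by auto
          then have w: "w \<in> carrier M" using sub by blast
          have "act (1 - a * c) u = act d (act (1 - a * c) m) \<oplus> act (1 - a * c) w"
            using w mM by (simp add: dw act_add mult.commute flip: act_mult_left)
          then show ?thesis
            using lspan_add[OF mM(2) lspan_act[OF mM(2) small] lspan_act[OF mM(2) dw(2)]] by simp
        qed
        then have "carrier M \<subseteq> lspan ms'" using that by (metis image_subset_iff subsetI)
        then show False using min[of ms'] mM m by simp
      qed
      then show ?thesis using schur[of "1 - a * c"] by blast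
    qed
    show "1 \<notin> {c. \<forall>m \<in> carrier M. act c m = \<zero>}"
      using nontrivial by (auto simp: act_one)
  qed (auto simp: act_add_left act_mult_left)
qed

end

section \<open>The free algebra and the automorphism \<open>g\<close>\<close>

lemma poly_mapping_single_induct [case_names zero single add]:
  fixes f :: "'a \<Rightarrow>\<^sub>0 'b::comm_monoid_add"
  assumes zero: "P 0" and single: "\<And>w c. P (Poly_Mapping.single w c)"
    and add: "\<And>f h. P f \<Longrightarrow> P h \<Longrightarrow> P (f + h)"
  shows "P f"
proof (induction f rule: Poly_Mapping.update_induct)
  case (update f w c)
  have "Poly_Mapping.update w c f = f + Poly_Mapping.single w c"
    using update(1)
    by (intro poly_mapping_eqI)
      (auto simp: lookup_add lookup_single Poly_Mapping.lookup_update when_def in_keys_iff)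
  then show ?case using update single add by metis
qed (rule zero)

text \<open>Terms may cancel in \<open>f + f'\<close>, so both sides are first extended to the union
  of the supports. It gives additivity of \<open>g_act\<close> and of the action of the free algebra
  on \<open>k[y]\<close>.\<close>

lemma sum_keys_add:
  fixes h :: "'w \<Rightarrow> 'k::ab_group_add \<Rightarrow> 'b::ab_group_add"
  assumes "\<And>w a b. h w (a + b) = h w a + h w b"
  shows "(\<Sum>w\<in>Poly_Mapping.keys (f + f'). h w (Poly_Mapping.lookup (f + f') w)) =
    (\<Sum>w\<in>Poly_Mapping.keys f. h w (Poly_Mapping.lookup f w)) +
    (\<Sum>w\<in>Poly_Mapping.keys f'. h w (Poly_Mapping.lookup f' w))"
proof -
  have 0: "h w 0 = 0" for w using assms[of w 0 0] by simp
  let ?K = "Poly_Mapping.keys f \<union> Poly_Mapping.keys f'"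
  have eq: "(\<Sum>w\<in>Poly_Mapping.keys p. h w (Poly_Mapping.lookup p w)) =
      (\<Sum>w\<in>?K. h w (Poly_Mapping.lookup p w))" if "Poly_Mapping.keys p \<subseteq> ?K" for p
    using that by (intro sum.mono_neutral_left) (auto simp: in_keys_iff 0)
  show ?thesis
    unfolding eq[OF Poly_Mapping.keys_add] eq[of f, OF Un_upper1] eq[of f', OF Un_upper2]
    by (simp add: lookup_add assms sum.distrib)
qed

lemma fscalar_simps [simp]:
  "fscalar 0 = 0" "fscalar 1 = 1" "fscalar (a + b) = fscalar a + fscalar b"
  "fscalar (a * b) = fscalar a * fscalar b"
  by (simp_all add: fscalar_def single_add mult_single)

lemma fscalar_commute: "fscalar c * f = f * fscalar (c::'k::comm_ring_1)"
  by (induction f rule: poly_mapping_single_induct)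
    (simp_all add: fscalar_def mult_single distrib_left distrib_right mult.commute)

lemma single_Word_Cons:
  "Poly_Mapping.single (Word (l # ws)) c = fvar l * Poly_Mapping.single (Word ws) (c::'k::ring_1)"
  by (simp add: fvar_def mult_single plus_xy_word_def)

lemma single_Word_Nil: "Poly_Mapping.single (Word []) c = fscalar c"
  by (simp add: fscalar_def zero_xy_word_def)

lemma free_alg_induct [case_names scalar letter add]:
  fixes f :: "'k::ring_1 free_alg"
  assumes "\<And>c. P (fscalar c)" and "\<And>l f. P f \<Longrightarrow> P (fvar l * f)"
    and "\<And>f h. P f \<Longrightarrow> P h \<Longrightarrow> P (f + h)"
  shows "P f"
proof (induction f rule: poly_mapping_single_induct)
  case zero
  show ?case using assms(1)[of 0] by simp
next
  case (single w c)
  have "P (Poly_Mapping.single (Word ws) c)" for ws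
    by (induction ws) (auto simp: single_Word_Cons single_Word_Nil assms)
  then show ?case by (cases w) simp
qed (rule assms(3))

lemma g_act_single:
  "g_act (Poly_Mapping.single w c) = fscalar c * prod_list (map g_letter (letters w))"
  by (cases "c = 0") (auto simp: g_act_def)

lemma g_act_add: "g_act (f + h) = g_act f + g_act h"
  unfolding g_act_def by (rule sum_keys_add) (simp add: distrib_right)

lemma g_act_zero [simp]: "g_act 0 = 0"
  by (simp add: g_act_def)

lemma g_act_scalar [simp]: "g_act (fscalar c) = fscalar c"
  using g_act_single[of "Word []" c] by (simp add: single_Word_Nil)

lemma g_act_letter_mult: "g_act (fvar l * f) = g_letter l * g_act (f :: 'k::comm_ring_1 free_alg)"
proof (induction f rule: poly_mapping_single_induct)
  case (single w c)
  obtain ws where w: "w = Word ws" by (cases w)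
  have "g_act (fvar l * Poly_Mapping.single w c) =
      fscalar c * (g_letter l * prod_list (map g_letter ws))"
    by (simp add: w g_act_single flip: single_Word_Cons)
  also have "\<dots> = g_letter l * g_act (Poly_Mapping.single w c)"
    by (simp add: w g_act_single fscalar_commute mult.assoc)
  finally show ?case .
qed (simp_all add: distrib_left g_act_add)

lemma g_act_fvar [simp]: "g_act (fvar l) = g_letter l" for l :: letter
  using g_act_single[of "Word [l]" 1] by (simp add: fvar_def)

lemma g_act_scalar_mult: "g_act (fscalar c * f) = fscalar c * g_act (f :: 'k::comm_ring_1 free_alg)"
proof (induction f rule: free_alg_induct)
  case (scalar d)
  then show ?case by (simp flip: fscalar_simps)
next
  case (letter l f)
  have "g_act (fscalar c * (fvar l * f)) = g_act (fvar l * (fscalar c * f))"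
    by (simp add: fscalar_commute mult.assoc)
  also have "\<dots> = fscalar c * g_act (fvar l * f)"
    by (simp add: g_act_letter_mult letter) (simp add: fscalar_commute mult.assoc)
  finally show ?case .
qed (simp add: distrib_left g_act_add)

lemma g_act_mult: "g_act (f * h) = g_act f * g_act (h :: 'k::comm_ring_1 free_alg)"
  by (induction f rule: free_alg_induct)
    (simp_all add: g_act_scalar_mult g_act_letter_mult g_act_add distrib_right mult.assoc)

lemma g_act_one [simp]: "g_act 1 = 1"
  using g_act_scalar[of 1] by simp

text \<open>The \<open>n\<close>-th power sends \<open>y\<close> to \<open>n x + y\<close>, so the
  \<open>p\<close>-th power fixes both generators.\<close>

lemma g_act_funpow_char:
  assumes "CHAR('k::comm_ring_1) = p"
  shows "(g_act ^^ p) = (id :: 'k free_alg \<Rightarrow> _)"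
proof
  fix f :: "'k free_alg"
  have add: "(g_act ^^ n) (f + h) = (g_act ^^ n) f + (g_act ^^ n) h" for n and f h :: "'k free_alg"
    by (induction n) (auto simp: g_act_add)
  have mult: "(g_act ^^ n) (f * h) = (g_act ^^ n) f * (g_act ^^ n) h" for n and f h :: "'k free_alg"
    by (induction n) (auto simp: g_act_mult)
  have scalar: "(g_act ^^ n) (fscalar c :: 'k free_alg) = fscalar c" for n c
    by (induction n) auto
  have X: "(g_act ^^ n) (fvar LX :: 'k free_alg) = fvar LX" for n
    by (induction n) auto
  have Y: "(g_act ^^ n) (fvar LY :: 'k free_alg) = fscalar (of_nat n) * fvar LX + fvar LY" for n
    by (induction n) (auto simp: g_act_add g_act_mult distrib_right)
  have "(of_nat p :: 'k) = 0" unfolding of_nat_eq_0_iff_char_dvd by (simp add: assms)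
  then have "(g_act ^^ p) (fvar l :: 'k free_alg) = fvar l" for l
    using X[of p] Y[of p] by (cases l) simp_all
  then show "(g_act ^^ p) f = id f"
    by (induction f rule: free_alg_induct) (simp_all add: add mult scalar)
qed

section \<open>Smash products\<close>

lemma if_add_zero:
  "(if P then a + b else 0) = (if P then a else 0) + (if P then b else (0::'a::monoid_add))"
  by simp

locale cyclic_smash =
  fixes n :: nat and \<sigma> :: "'a::ring_1 \<Rightarrow> 'a"
  assumes pos: "n > 0" and \<sigma>_add: "\<sigma> (a + b) = \<sigma> a + \<sigma> b" and \<sigma>_mult: "\<sigma> (a * b) = \<sigma> a * \<sigma> b"
    and \<sigma>_one: "\<sigma> 1 = 1" and \<sigma>_order: "\<sigma> ^^ n = id"
begin

abbreviation S where "S \<equiv> smash_cyclic n \<sigma>"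

lemma carrier_iff: "u \<in> carrier S \<longleftrightarrow> (\<forall>i\<ge>n. u i = 0)"
  by (simp add: smash_cyclic_def)

lemma zero_S [simp]: "\<zero>\<^bsub>S\<^esub> = (\<lambda>_. 0)" and add_S [simp]: "u \<oplus>\<^bsub>S\<^esub> v = (\<lambda>i. u i + v i)"
  and one_S: "\<one>\<^bsub>S\<^esub> = gmonom 1 0"
  by (auto simp: smash_cyclic_def gmonom_def)

lemma mult_S:
  "(u \<otimes>\<^bsub>S\<^esub> v) m = (\<Sum>i<n. \<Sum>j<n. if (i + j) mod n = m then u i * (\<sigma> ^^ i) (v j) else 0)"
proof -
  have "(\<Sum>i<n. \<Sum>j<n. if (i + j) mod n = m then u i * (\<sigma> ^^ i) (v j) else 0) =
      (\<Sum>(i, j)\<in>{..<n} \<times> {..<n}. if (i + j) mod n = m then u i * (\<sigma> ^^ i) (v j) else 0)"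
    by (simp add: sum.cartesian_product)
  also have "\<dots> = (\<Sum>(i, j)\<in>{(i, j). i < n \<and> j < n \<and> (i + j) mod n = m}. u i * (\<sigma> ^^ i) (v j))"
    by (intro sum.mono_neutral_cong_right) (auto split: if_splits)
  finally show ?thesis by (simp add: smash_cyclic_def)
qed

lemma \<sigma>_0: "\<sigma> 0 = 0"
  using \<sigma>_add[of 0 0] by simp

lemma pow_add: "(\<sigma> ^^ k) (a + b) = (\<sigma> ^^ k) a + (\<sigma> ^^ k) b"
  by (induction k) (auto simp: \<sigma>_add)

lemma pow_mult: "(\<sigma> ^^ k) (a * b) = (\<sigma> ^^ k) a * (\<sigma> ^^ k) b"
  by (induction k) (auto simp: \<sigma>_mult)

lemma pow_0 [simp]: "(\<sigma> ^^ k) 0 = 0"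
  by (induction k) (auto simp: \<sigma>_0)

lemma pow_1 [simp]: "(\<sigma> ^^ k) 1 = 1"
  by (induction k) (auto simp: \<sigma>_one)

lemma pow_sum: "(\<sigma> ^^ k) (sum f A) = (\<Sum>i\<in>A. (\<sigma> ^^ k) (f i))"
  by (induction A rule: infinite_finite_induct) (auto simp: pow_add)

lemma pow_mod: "\<sigma> ^^ (k mod n) = \<sigma> ^^ k"
proof -
  have "\<sigma> ^^ k = \<sigma> ^^ (k mod n + n * (k div n))" by simp
  also have "\<dots> = \<sigma> ^^ (k mod n) \<circ> ((\<sigma> ^^ n) ^^ (k div n))"
    by (simp only: funpow_add funpow_mult mult.commute)
  finally show ?thesis by (simp add: \<sigma>_order)
qed

text \<open>Associativity, multiplicativity of the augmentation and the action of the smash product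
  on \<open>k[y]\<close> are all instances of this regrouping by the pairs
  \<open>(i, j)\<close>.\<close>

lemma sum_mult_S:
  fixes \<phi> :: "nat \<Rightarrow> 'a \<Rightarrow> 'b::ab_group_add"
  assumes add: "\<And>l a b. \<phi> l (a + b) = \<phi> l a + \<phi> l b"
  shows "(\<Sum>l<n. \<phi> l ((u \<otimes>\<^bsub>S\<^esub> v) l)) = (\<Sum>i<n. \<Sum>j<n. \<phi> ((i + j) mod n) (u i * (\<sigma> ^^ i) (v j)))"
proof -
  have 0: "\<phi> l 0 = 0" for l using add[of l 0 0] by simp
  have sum: "\<phi> l (sum f A) = (\<Sum>i\<in>A. \<phi> l (f i))" for l f and A :: "nat set"
    by (induction A rule: infinite_finite_induct) (auto simp: add 0)
  have "(\<Sum>l<n. \<phi> l ((u \<otimes>\<^bsub>S\<^esub> v) l)) =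
      (\<Sum>l<n. \<Sum>i<n. \<Sum>j<n. if (i + j) mod n = l then \<phi> l (u i * (\<sigma> ^^ i) (v j)) else 0)"
    by (simp add: mult_S sum if_distrib 0 cong: if_cong)
  also have "\<dots> = (\<Sum>i<n. \<Sum>l<n. \<Sum>j<n. if (i + j) mod n = l then \<phi> l (u i * (\<sigma> ^^ i) (v j)) else 0)"
    by (rule sum.swap)
  also have "\<dots> = (\<Sum>i<n. \<Sum>j<n. \<Sum>l<n. if (i + j) mod n = l then \<phi> l (u i * (\<sigma> ^^ i) (v j)) else 0)"
    by (intro sum.cong refl sum.swap)
  also have "\<dots> = (\<Sum>i<n. \<Sum>j<n. \<phi> ((i + j) mod n) (u i * (\<sigma> ^^ i) (v j)))"
    using pos by (intro sum.cong refl) (simp add: sum.delta)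
  finally show ?thesis .
qed

lemma gmonom_carrier [simp]: "i < n \<Longrightarrow> gmonom a i \<in> carrier S"
  by (auto simp: carrier_iff gmonom_def)

lemma gmonom_mult:
  assumes "i < n" "j < n"
  shows "gmonom a i \<otimes>\<^bsub>S\<^esub> gmonom b j = gmonom (a * (\<sigma> ^^ i) b) ((i + j) mod n)"
proof
  fix m
  have "(gmonom a i \<otimes>\<^bsub>S\<^esub> gmonom b j) m =
      (\<Sum>i'<n. \<Sum>j'<n. if j' = j then (if i' = i then (if (i + j) mod n = m then a * (\<sigma> ^^ i) b else 0) else 0) else 0)"
    unfolding mult_S by (intro sum.cong refl) (auto simp: gmonom_def)
  also have "\<dots> = (if (i + j) mod n = m then a * (\<sigma> ^^ i) b else 0)"
    using assms by simp
  finally show "(gmonom a i \<otimes>\<^bsub>S\<^esub> gmonom b j) m = gmonom (a * (\<sigma> ^^ i) b) ((i + j) mod n) m"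
    by (auto simp: gmonom_def)
qed

lemma S_induct [consumes 1, case_names monom add]:
  assumes u: "u \<in> carrier S"
    and monom: "\<And>a i. i < n \<Longrightarrow> P (gmonom a i)"
    and add: "\<And>u v. u \<in> carrier S \<Longrightarrow> v \<in> carrier S \<Longrightarrow> P u \<Longrightarrow> P v \<Longrightarrow> P (u \<oplus>\<^bsub>S\<^esub> v)"
  shows "P u"
proof -
  have "k \<le> n \<Longrightarrow> P (\<lambda>i. if i < k then u i else 0)" for k
  proof (induction k)
    case 0
    have "gmonom 0 0 = (\<lambda>i. if i < (0::nat) then u i else 0)" by (auto simp: gmonom_def)
    then show ?case using monom[of 0 0] pos by simp
  next
    case (Suc k)
    let ?v = "\<lambda>i. if i < k then u i else 0"
    have "(\<lambda>i. if i < Suc k then u i else 0) = ?v \<oplus>\<^bsub>S\<^esub> gmonom (u k) k"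
      by (auto simp: gmonom_def less_Suc_eq)
    moreover have "P (?v \<oplus>\<^bsub>S\<^esub> gmonom (u k) k)"
      using Suc by (intro add monom) (auto simp: carrier_iff gmonom_def)
    ultimately show ?case by simp
  qed
  from this[of n] have "P (\<lambda>i. if i < n then u i else 0)" by simp
  also have "(\<lambda>i. if i < n then u i else 0) = u" using u by (auto simp: carrier_iff)
  finally show ?thesis .
qed

lemma mult_S_closed: "u \<otimes>\<^bsub>S\<^esub> v \<in> carrier S"
proof -
  have "(if (i + j) mod n = m then u i * (\<sigma> ^^ i) (v j) else 0) = 0" if "m \<ge> n" for i j m
    using mod_less_divisor[OF pos, of "i + j"] that by auto
  then show ?thesis by (simp add: carrier_iff mult_S)
qed

lemma mult_S_assoc: "(u \<otimes>\<^bsub>S\<^esub> v) \<otimes>\<^bsub>S\<^esub> w = u \<otimes>\<^bsub>S\<^esub> (v \<otimes>\<^bsub>S\<^esub> w)"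
proof
  fix m
  let ?t = "\<lambda>i j k. if (i + j + k) mod n = m then u i * (\<sigma> ^^ i) (v j) * (\<sigma> ^^ (i + j)) (w k) else 0"
  have "((u \<otimes>\<^bsub>S\<^esub> v) \<otimes>\<^bsub>S\<^esub> w) m =
      (\<Sum>l<n. (\<lambda>l a. \<Sum>k<n. if (l + k) mod n = m then a * (\<sigma> ^^ l) (w k) else 0) l ((u \<otimes>\<^bsub>S\<^esub> v) l))"
    by (simp only: mult_S[of "u \<otimes>\<^bsub>S\<^esub> v"])
  also have "\<dots> = (\<Sum>i<n. \<Sum>j<n. \<Sum>k<n. ?t i j k)"
    by (subst sum_mult_S[where \<phi> = "\<lambda>l a. \<Sum>k<n. if (l + k) mod n = m then a * (\<sigma> ^^ l) (w k) else 0"])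
      (simp_all add: distrib_right if_add_zero sum.distrib mod_add_left_eq pow_mod cong: if_cong)
  also have "\<dots> = (\<Sum>i<n. \<Sum>l<n. (\<lambda>l a. if (i + l) mod n = m then u i * (\<sigma> ^^ i) a else 0) l ((v \<otimes>\<^bsub>S\<^esub> w) l))"
  proof (rule sum.cong)
    fix i
    show "(\<Sum>j<n. \<Sum>k<n. ?t i j k) =
        (\<Sum>l<n. (\<lambda>l a. if (i + l) mod n = m then u i * (\<sigma> ^^ i) a else 0) l ((v \<otimes>\<^bsub>S\<^esub> w) l))"
      by (subst sum_mult_S[where \<phi> = "\<lambda>l a. if (i + l) mod n = m then u i * (\<sigma> ^^ i) a else 0"])
        (simp_all add: pow_add pow_mult distrib_left mod_add_right_eq add.assoc mult.assoc funpow_add cong: if_cong)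
  qed simp
  also have "\<dots> = (u \<otimes>\<^bsub>S\<^esub> (v \<otimes>\<^bsub>S\<^esub> w)) m"
    by (simp only: mult_S[of u])
  finally show "((u \<otimes>\<^bsub>S\<^esub> v) \<otimes>\<^bsub>S\<^esub> w) m = (u \<otimes>\<^bsub>S\<^esub> (v \<otimes>\<^bsub>S\<^esub> w)) m" .
qed

lemma mult_S_add_left: "(u \<oplus>\<^bsub>S\<^esub> v) \<otimes>\<^bsub>S\<^esub> w = (u \<otimes>\<^bsub>S\<^esub> w) \<oplus>\<^bsub>S\<^esub> (v \<otimes>\<^bsub>S\<^esub> w)"
  by (rule ext) (simp add: mult_S distrib_right if_add_zero sum.distrib cong: if_cong)

lemma mult_S_add_right: "w \<otimes>\<^bsub>S\<^esub> (u \<oplus>\<^bsub>S\<^esub> v) = (w \<otimes>\<^bsub>S\<^esub> u) \<oplus>\<^bsub>S\<^esub> (w \<otimes>\<^bsub>S\<^esub> v)"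
  by (rule ext) (simp add: mult_S distrib_left pow_add if_add_zero sum.distrib cong: if_cong)

lemma one_mult_S: "u \<in> carrier S \<Longrightarrow> \<one>\<^bsub>S\<^esub> \<otimes>\<^bsub>S\<^esub> u = u"
  by (induction rule: S_induct)
    (simp_all only: mult_S_add_right, simp_all add: one_S gmonom_mult pos)

lemma mult_one_S: "u \<in> carrier S \<Longrightarrow> u \<otimes>\<^bsub>S\<^esub> \<one>\<^bsub>S\<^esub> = u"
  by (induction rule: S_induct)
    (simp_all only: mult_S_add_left, simp_all add: one_S gmonom_mult pos)

lemma ring_S: "ring S"
proof (rule ringI)
  show "abelian_group S"
  proof (rule abelian_groupI)
    show "\<exists>y\<in>carrier S. y \<oplus>\<^bsub>S\<^esub> x = \<zero>\<^bsub>S\<^esub>" if "x \<in> carrier S" for x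
      using that by (intro bexI[of _ "\<lambda>i. - x i"]) (auto simp: carrier_iff)
  qed (auto simp: carrier_iff algebra_simps)
  have "\<one>\<^bsub>S\<^esub> \<in> carrier S" using pos by (simp add: one_S)
  then show "monoid S"
    by (intro monoidI) (auto simp: mult_S_closed mult_S_assoc one_mult_S mult_one_S)
qed (simp_all only: mult_S_add_left mult_S_add_right)

declare zero_S [simp del] add_S [simp del]

end

lemma cyclic_smash_id: "n > 0 \<Longrightarrow> cyclic_smash n id"
  by standard (auto simp: id_funpow)

lemma cring_smash_id:
  assumes "n > 0"
  shows "cring (smash_cyclic n (id :: 'a::comm_ring_1 \<Rightarrow> 'a))"
proof -
  interpret cyclic_smash n "id :: 'a \<Rightarrow> 'a" by (rule cyclic_smash_id) fact
  interpret ring S by (rule ring_S)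
  have "u \<otimes>\<^bsub>S\<^esub> v = v \<otimes>\<^bsub>S\<^esub> u" for u v
  proof
    fix m
    have "(u \<otimes>\<^bsub>S\<^esub> v) m = (\<Sum>j<n. \<Sum>i<n. if (i + j) mod n = m then u i * v j else 0)"
      unfolding mult_S by (subst sum.swap) (simp add: id_funpow cong: if_cong)
    also have "\<dots> = (v \<otimes>\<^bsub>S\<^esub> u) m"
      unfolding mult_S by (intro sum.cong refl) (simp add: id_funpow add.commute mult.commute cong: if_cong)
    finally show "(u \<otimes>\<^bsub>S\<^esub> v) m = (v \<otimes>\<^bsub>S\<^esub> u) m" .
  qed
  then show ?thesis by unfold_locales auto
qed

section \<open>Evaluation of polynomials in a ring\<close>

text \<open>If the adjoined element commutes with the image of \<open>\<phi>\<close>, evaluation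
  there is a homomorphism of the same kind. In this way the maps from \<open>k\<close>,
  \<open>k[x]\<close> and \<open>k[x][T]\<close> are stacked on one another.\<close>

locale ring_eval = ring S for S :: "('s, 'd) ring_scheme" (structure) +
  fixes \<phi> :: "'c::comm_ring_1 \<Rightarrow> 's"
  assumes \<phi>_closed [simp]: "\<phi> c \<in> carrier S"
    and \<phi>_add: "\<phi> (c + d) = \<phi> c \<oplus> \<phi> d"
    and \<phi>_mult: "\<phi> (c * d) = \<phi> c \<otimes> \<phi> d"
    and \<phi>_one: "\<phi> 1 = \<one>"
begin

lemma \<phi>_zero [simp]: "\<phi> 0 = \<zero>"
  using \<phi>_add[of 0 0] by (metis \<phi>_closed add.l_cancel_one' add_0)

text \<open>Coefficients stand to the right of the powers of \<open>b\<close>. Multiplicativity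
  requires \<open>b\<close> to commute with the coefficients; additivity does not, and is what is
  used for normal ordering in \<open>y\<close>.\<close>

definition ev :: "'s \<Rightarrow> 'c poly \<Rightarrow> 's" where
  "ev b q = fold_coeffs (\<lambda>c h. \<phi> c \<oplus> b \<otimes> h) q \<zero>"

lemma ev_0 [simp]: "ev b 0 = \<zero>"
  by (simp add: ev_def)

lemma ev_pCons: "b \<in> carrier S \<Longrightarrow> ev b (pCons a q) = \<phi> a \<oplus> b \<otimes> ev b q"
  by (cases "a = 0 \<and> q = 0") (auto simp: ev_def)

lemma ev_closed [simp]: "b \<in> carrier S \<Longrightarrow> ev b q \<in> carrier S"
  by (induction q) (auto simp: ev_pCons)

lemma ev_const: "b \<in> carrier S \<Longrightarrow> ev b [:a:] = \<phi> a"
  by (simp add: ev_pCons)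

lemma ev_var: "b \<in> carrier S \<Longrightarrow> ev b [:0, 1:] = b"
  by (simp add: ev_pCons \<phi>_one)

lemma ev_add: "b \<in> carrier S \<Longrightarrow> ev b (q + q') = ev b q \<oplus> ev b q'"
  by (induction q q' rule: poly_induct2) (simp_all add: ev_pCons \<phi>_add r_distr a_ac)

lemma ev_commute:
  assumes "z \<in> carrier S" "b \<in> carrier S" "z \<otimes> b = b \<otimes> z" "\<And>c. z \<otimes> \<phi> c = \<phi> c \<otimes> z"
  shows "z \<otimes> ev b q = ev b q \<otimes> z"
proof (induction q)
  case (pCons a q)
  have "z \<otimes> (b \<otimes> ev b q) = (b \<otimes> ev b q) \<otimes> z"
    using assms by (metis pCons.IH ev_closed m_assoc)
  then show ?case using assms by (simp add: ev_pCons l_distr r_distr)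
qed (use assms in simp)

lemma ev_smult:
  assumes b: "b \<in> carrier S" and comm: "\<And>c. \<phi> c \<otimes> b = b \<otimes> \<phi> c"
  shows "ev b (Polynomial.smult c q) = \<phi> c \<otimes> ev b q"
proof (induction q)
  case (pCons a q)
  have "b \<otimes> (\<phi> c \<otimes> ev b q) = \<phi> c \<otimes> (b \<otimes> ev b q)"
    using b comm by (metis \<phi>_closed ev_closed m_assoc)
  then show ?case using b by (simp add: ev_pCons \<phi>_mult r_distr pCons.IH)
qed simp

lemma ev_mult:
  assumes b: "b \<in> carrier S" and comm: "\<And>c. \<phi> c \<otimes> b = b \<otimes> \<phi> c"
  shows "ev b (q * q') = ev b q \<otimes> ev b q'"
  using b by (induction q) (simp_all add: ev_add ev_smult[OF b comm] ev_pCons l_distr m_assoc)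

lemma ev_ring_eval:
  assumes b: "b \<in> carrier S" and comm: "\<And>c. \<phi> c \<otimes> b = b \<otimes> \<phi> c"
  shows "ring_eval S (ev b)"
  by unfold_locales (use b in \<open>auto simp: ev_add ev_mult[OF b comm] one_pCons ev_const \<phi>_one\<close>)

lemma \<phi>_diff: "\<phi> (c - d) = \<phi> c \<ominus> \<phi> d"
  using \<phi>_add[of "c - d" d] by (metis \<phi>_closed add.inv_solve_right diff_add_cancel minus_eq)

lemma \<phi>_power: "\<phi> (c ^ n) = \<phi> c [^] n"
  by (induction n) (auto simp: \<phi>_one \<phi>_mult power_Suc2 simp del: power_Suc)

end

section \<open>Group algebras of cyclic groups\<close>

lemma of_nat_mod_char:
  assumes "CHAR('a::comm_ring_1) = p"
  shows "of_nat (n mod p) = (of_nat n :: 'a)"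
proof -
  have "(of_nat p :: 'a) = 0" unfolding of_nat_eq_0_iff_char_dvd by (simp add: assms)
  moreover have "(of_nat n :: 'a) = of_nat (n mod p + p * (n div p))" by simp
  ultimately show ?thesis by (simp only: of_nat_add of_nat_mult) simp
qed

lemma poly_monom_induct [case_names monom add]:
  assumes "\<And>a i. P (monom a i)" and "\<And>q q'. P q \<Longrightarrow> P q' \<Longrightarrow> P (q + q')"
  shows "P q"
proof -
  have "P (\<Sum>i\<le>m. monom (coeff q i) i)" for m
    by (induction m) (auto intro: assms)
  from this[of "degree q"] show ?thesis by (simp add: poly_as_sum_of_monoms)
qed

locale cyclic_group_ring =
  fixes n :: nat and ty :: "'c::comm_ring_1 itself"
  assumes gt_1: "n > 1"
begin

sublocale smash: cyclic_smash n "id :: 'c \<Rightarrow> 'c"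
  by (rule cyclic_smash_id) (use gt_1 in simp)

sublocale cring "smash_cyclic n (id :: 'c \<Rightarrow> 'c)"
  by (rule cring_smash_id) (use gt_1 in simp)

abbreviation A where "A \<equiv> smash_cyclic n (id :: 'c \<Rightarrow> 'c)"

lemma gmonom_mult: "i < n \<Longrightarrow> j < n \<Longrightarrow>
    gmonom a i \<otimes>\<^bsub>A\<^esub> gmonom b j = gmonom (a * b) ((i + j) mod n)"
  by (simp add: smash.gmonom_mult id_funpow)

lemma gmonom_add: "gmonom a i \<oplus>\<^bsub>A\<^esub> gmonom b i = gmonom (a + b) i"
  by (auto simp: gmonom_def smash.add_S)

lemma gmonom_0: "gmonom 0 i = \<zero>\<^bsub>A\<^esub>"
  by (auto simp: gmonom_def smash.zero_S)

sublocale ring_eval A "\<lambda>c. gmonom c 0"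
  by unfold_locales
    (use gt_1 in \<open>simp_all only: smash.gmonom_carrier gmonom_add gmonom_mult smash.one_S, simp_all\<close>)

text \<open>The quotient map \<open>T \<mapsto> g\<close> onto the group algebra; identities are
  proved for polynomials and transported along it.\<close>

definition proj :: "'c poly \<Rightarrow> nat \<Rightarrow> 'c" where
  "proj = ev (gmonom 1 1)"

lemma g_carrier: "gmonom 1 1 \<in> carrier A"
  using gt_1 by (rule smash.gmonom_carrier)

lemma proj_closed [simp]: "proj q \<in> carrier A"
  unfolding proj_def by (rule ev_closed[OF g_carrier])

lemma proj_add: "proj (q + q') = proj q \<oplus>\<^bsub>A\<^esub> proj q'"
  unfolding proj_def by (rule ev_add[OF g_carrier])

lemma proj_mult: "proj (q * q') = proj q \<otimes>\<^bsub>A\<^esub> proj q'"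
  unfolding proj_def by (rule ev_mult[OF g_carrier]) (rule m_comm[OF \<phi>_closed g_carrier])

lemma proj_0: "proj 0 = \<zero>\<^bsub>A\<^esub>"
  by (simp only: proj_def ev_0)

lemma proj_const: "proj [:a:] = gmonom a 0"
  unfolding proj_def by (rule ev_const[OF g_carrier])

lemma proj_1: "proj 1 = \<one>\<^bsub>A\<^esub>"
  by (simp only: one_pCons proj_const smash.one_S)

lemma proj_var: "proj [:0, 1:] = gmonom 1 1"
  unfolding proj_def by (rule ev_var[OF g_carrier])

lemma proj_sum: "proj (sum f B) i = (\<Sum>b\<in>B. proj (f b) i)"
  by (induction B rule: infinite_finite_induct) (simp_all add: proj_0 proj_add smash.add_S smash.zero_S)

lemma proj_monom: "proj (monom a i) = gmonom a (i mod n)"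
proof (induction i)
  case 0
  show ?case by (simp add: monom_0 proj_const)
next
  case (Suc i)
  have "proj (monom a (Suc i)) = proj [:0, 1:] \<otimes>\<^bsub>A\<^esub> proj (monom a i)"
    by (simp flip: proj_mult add: monom_Suc)
  also have "\<dots> = gmonom a (Suc i mod n)"
    using gt_1 by (simp add: Suc proj_var gmonom_mult mod_Suc_eq)
  finally show ?case .
qed

lemma proj_power: "proj (q ^ m) = proj q [^]\<^bsub>A\<^esub> m"
  by (induction m) (simp_all only: power_Suc2 proj_mult nat_pow_Suc power_0 nat_pow_0 proj_1)

lemma proj_lift: "u \<in> carrier A \<Longrightarrow> proj (\<Sum>i<n. monom (u i) i) = u"
  by (rule ext) (auto simp: proj_sum proj_monom gmonom_def smash.carrier_iff)

lemma mult_gmonom_0: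
  assumes "u \<in> carrier A"
  shows "u \<otimes>\<^bsub>A\<^esub> gmonom a 0 = (\<lambda>i. u i * a)"
  using assms
proof (induction rule: smash.S_induct)
  case (monom b i)
  then have "gmonom b i \<otimes>\<^bsub>A\<^esub> gmonom a 0 = gmonom (b * a) i"
    using gt_1 gmonom_mult[of i 0 b a] by simp
  moreover have "(\<lambda>j. gmonom b i j * a) = gmonom (b * a) i"
    by (auto simp: gmonom_def)
  ultimately show ?case by (simp only:)
next
  case (add u v)
  then show ?case by (simp only: smash.mult_S_add_left) (simp only: smash.add_S distrib_right)
qed

definition aug :: "(nat \<Rightarrow> 'c) \<Rightarrow> 'c" where
  "aug u = (\<Sum>i<n. u i)"

lemma aug_mult: "aug (u \<otimes>\<^bsub>A\<^esub> v) = aug u * aug v"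
  using smash.sum_mult_S[of "\<lambda>l a. a" u v] by (simp add: aug_def id_funpow sum_product)

lemma aug_one: "aug \<one>\<^bsub>A\<^esub> = 1"
  using gt_1 by (simp add: aug_def smash.one_S gmonom_def)

text \<open>By the freshman's dream the power is the sum of the \<open>u_i^n g^(i n)\<close>, and
  \<open>g^n = 1\<close> collapses it to a scalar.\<close>

lemma power_char:
  assumes u: "u \<in> carrier A" and n: "prime n" "CHAR('c) = n"
  shows "u [^]\<^bsub>A\<^esub> n = gmonom (aug u ^ n) 0"
proof -
  have n': "prime CHAR('c poly)" "n = CHAR('c poly)" using n by simp_all
  have mp: "monom (u i) i ^ n = monom (u i ^ n) (i * n)" for i
    by (rule monom_power)
  have "u [^]\<^bsub>A\<^esub> n = proj ((\<Sum>i<n. monom (u i) i) ^ n)"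
    by (simp only: proj_power proj_lift[OF u])
  also have "(\<Sum>i<n. monom (u i) i) ^ n = (\<Sum>i<n. monom (u i ^ n) (i * n))"
    by (simp only: freshmans_dream_sum[OF n'] mp)
  also have "proj \<dots> = gmonom (\<Sum>i<n. u i ^ n) 0"
    by (rule ext) (simp add: proj_sum proj_monom, simp add: gmonom_def)
  also have "(\<Sum>i<n. u i ^ n) = aug u ^ n"
    unfolding aug_def by (rule freshmans_dream_sum[symmetric]) (use n in simp_all)
  finally show ?thesis .
qed

end

section \<open>The derivation \<open>\<delta>\<close>\<close>

locale heisenberg_setting =
  fixes p :: nat and lam :: "nat \<Rightarrow> 'k::alg_closed_field"
  assumes p_prime: "prime p" and p_odd: "odd p" and char_p: "CHAR('k) = p"
    and lam_carrier: "lam \<in> carrier (kG p)" and lam_nonzero: "lam \<noteq> \<zero>\<^bsub>kG p\<^esub>"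
    and lam_0: "lam 0 = 0"
begin

lemma p_gt_1: "p > 1"
  using p_prime by (rule prime_gt_1_nat)

lemma lam_ge: "i \<ge> p \<Longrightarrow> lam i = 0"
  using lam_carrier by (simp add: kG_def smash_cyclic_def)

sublocale K: cyclic_group_ring p "TYPE('k)"
  rewrites "smash_cyclic p (id :: 'k \<Rightarrow> 'k) \<equiv> kG p"
proof -
  show "cyclic_group_ring p" by (rule cyclic_group_ring.intro) (rule p_gt_1)
qed (simp add: kG_def)

sublocale Rx: cyclic_group_ring p "TYPE('k poly)"
  rewrites "smash_cyclic p (id :: 'k poly \<Rightarrow> 'k poly) \<equiv> Rx p"
proof -
  show "cyclic_group_ring p" by (rule cyclic_group_ring.intro) (rule p_gt_1)
qed (simp add: Rx_def)

text \<open>\<open>lam^p\<close> is the scalar \<open>K.aug lam ^ p\<close>. A nonzero scalar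
  annihilates nothing; if the scalar is zero, the last nonvanishing power of \<open>lam\<close> is
  annihilated by \<open>lam\<close>.\<close>

lemma kG_zero_divisor_iff: "kG_zero_divisor p lam \<longleftrightarrow> K.aug lam = 0"
proof
  assume "kG_zero_divisor p lam"
  then obtain \<mu> where \<mu>: "\<mu> \<in> carrier (kG p)" "\<mu> \<noteq> \<zero>\<^bsub>kG p\<^esub>" "lam \<otimes>\<^bsub>kG p\<^esub> \<mu> = \<zero>\<^bsub>kG p\<^esub>"
    by (auto simp: kG_zero_divisor_def)
  have "lam [^]\<^bsub>kG p\<^esub> p \<otimes>\<^bsub>kG p\<^esub> \<mu> = \<zero>\<^bsub>kG p\<^esub>"
  proof -
    have "lam [^]\<^bsub>kG p\<^esub> Suc (p - 1) \<otimes>\<^bsub>kG p\<^esub> \<mu> = lam [^]\<^bsub>kG p\<^esub> (p - 1) \<otimes>\<^bsub>kG p\<^esub> (lam \<otimes>\<^bsub>kG p\<^esub> \<mu>)"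
      using \<mu> lam_carrier by (simp only: K.nat_pow_Suc K.m_assoc K.nat_pow_closed)
    then show ?thesis using \<mu> lam_carrier p_gt_1 by (simp only: K.r_null K.nat_pow_closed) simp
  qed
  then have "\<mu> \<otimes>\<^bsub>kG p\<^esub> gmonom (K.aug lam ^ p) 0 = \<zero>\<^bsub>kG p\<^esub>"
    using \<mu> K.power_char[OF lam_carrier p_prime char_p] K.m_comm[OF \<mu>(1) K.\<phi>_closed] by simp
  then have "\<mu> i * K.aug lam ^ p = 0" for i
    using K.mult_gmonom_0[OF \<mu>(1)] by (metis K.smash.zero_S)
  then show "K.aug lam = 0" using \<mu>(2) by (auto simp: fun_eq_iff K.smash.zero_S)
next
  assume "K.aug lam = 0"
  then have "lam [^]\<^bsub>kG p\<^esub> p = \<zero>\<^bsub>kG p\<^esub>"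
    using K.power_char[OF lam_carrier p_prime char_p] p_gt_1
    by (simp add: K.gmonom_0 power_0_left)
  moreover have "lam [^]\<^bsub>kG p\<^esub> (0::nat) \<noteq> \<zero>\<^bsub>kG p\<^esub>"
    using K.aug_one by (auto simp: K.aug_def K.smash.zero_S)
  ultimately obtain m where "lam [^]\<^bsub>kG p\<^esub> m \<noteq> \<zero>\<^bsub>kG p\<^esub>" "lam [^]\<^bsub>kG p\<^esub> Suc m = \<zero>\<^bsub>kG p\<^esub>"
    using ex_least_nat_less[of "\<lambda>m. lam [^]\<^bsub>kG p\<^esub> m = \<zero>\<^bsub>kG p\<^esub>" p] by blast
  then show "kG_zero_divisor p lam"
    unfolding kG_zero_divisor_def using lam_carrier
    by (intro conjI bexI[of _ "lam [^]\<^bsub>kG p\<^esub> m"])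
      (simp_all only: K.nat_pow_Suc2 K.nat_pow_closed not_False_eq_True)
qed

lemma Units_aug: "lam \<in> Units (kG p) \<Longrightarrow> K.aug lam \<noteq> 0"
  unfolding Units_def by clarsimp (metis K.aug_mult K.aug_one mult_zero_left zero_neq_one)

section \<open>The derivation of R, descended from k[x][T]\<close>

definition D0 :: "(nat \<Rightarrow> 'k poly) \<Rightarrow> nat \<Rightarrow> 'k poly" where
  "D0 u = (\<lambda>i. pderiv (u i)) \<otimes>\<^bsub>Rx p\<^esub> (\<lambda>i. [:lam i:]) \<oplus>\<^bsub>Rx p\<^esub> (\<lambda>i. of_nat i * ([:0, 1:] * u i))"

lemma D0_add: "D0 (u \<oplus>\<^bsub>Rx p\<^esub> v) = D0 u \<oplus>\<^bsub>Rx p\<^esub> D0 v"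
proof -
  have "(\<lambda>i. pderiv ((u \<oplus>\<^bsub>Rx p\<^esub> v) i)) = (\<lambda>i. pderiv (u i)) \<oplus>\<^bsub>Rx p\<^esub> (\<lambda>i. pderiv (v i))"
    by (simp add: pderiv_add Rx.smash.add_S)
  then show ?thesis
    unfolding D0_def by (simp only: Rx.smash.mult_S_add_left) (auto simp: Rx.smash.add_S algebra_simps)
qed

lemma proj_lamT: "Rx.proj (lamT p lam) = (\<lambda>i. [:lam i:])"
proof -
  have "(\<lambda>i. [:lam i:]) \<in> carrier (Rx p)"
    by (simp add: Rx.smash.carrier_iff lam_ge)
  from Rx.proj_lift[OF this] show ?thesis by (simp add: lamT_def)
qed

text \<open>On \<open>a T^i\<close> the multiplier \<open>i\<close> equals \<open>i mod p\<close> in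
  characteristic \<open>p\<close>, so the derivation is compatible with \<open>T^p = 1\<close>. As
  \<open>proj\<close> is onto, \<open>D0\<close> inherits the properties of a derivation.\<close>

lemma D0_proj: "D0 (Rx.proj q) = Rx.proj (deltaT p lam q)"
proof -
  have monom: "D0 (Rx.proj (monom a i)) = Rx.proj (deltaT p lam (monom a i))" for a i
  proof -
    have r: "i mod p < p" using p_gt_1 by simp
    have "(of_nat (i mod p) :: 'k poly) = of_nat i"
      by (rule of_nat_mod_char) (simp add: char_p)
    then have "D0 (Rx.proj (monom a i)) =
        gmonom (pderiv a) (i mod p) \<otimes>\<^bsub>Rx p\<^esub> Rx.proj (lamT p lam) \<oplus>\<^bsub>Rx p\<^esub>
        gmonom (of_nat i * ([:0, 1:] * a)) (i mod p)"
      unfolding D0_def Rx.proj_monom proj_lamT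
      by (intro arg_cong2[where f = "\<lambda>u v. u \<otimes>\<^bsub>Rx p\<^esub> _ \<oplus>\<^bsub>Rx p\<^esub> v"]) (auto simp: gmonom_def)
    also have "\<dots> = Rx.proj (lamT p lam * monom (pderiv a) i + monom (of_nat i * ([:0, 1:] * a)) i)"
      by (simp only: Rx.proj_add Rx.proj_mult Rx.proj_monom
          Rx.m_comm[OF Rx.smash.gmonom_carrier[OF r] Rx.proj_closed])
    also have "lamT p lam * monom (pderiv a) i + monom (of_nat i * ([:0, 1:] * a)) i =
        deltaT p lam (monom a i)"
    proof -
      have "[:0, [:0, 1:]:] * monom c j = monom ([:0, 1:] * c) (Suc j)" for c :: "'k poly" and j
        by (simp add: monom_Suc smult_monom)
      then have "[:0, [:0, 1:]:] * pderiv (monom a i) = monom (of_nat i * ([:0, 1:] * a)) i"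
        by (cases i) (simp_all only: pderiv_monom diff_Suc_1 mult.left_commute, simp_all)
      moreover have "map_poly pderiv (monom a i) = monom (pderiv a) i"
        by (simp add: map_poly_monom)
      ultimately show ?thesis
        by (simp only: deltaT_def)
    qed
    finally show ?thesis .
  qed
  show ?thesis
  proof (induction q rule: poly_monom_induct)
    case (add q q')
    then show ?case by (simp only: Rx.proj_add D0_add deltaT.add)
  qed (rule monom)
qed

lemma Rx_derivation_D0: "Rx_derivation p D0"
  unfolding Rx_derivation_def
proof (intro conjI ballI allI funcsetI)
  have lift: "\<exists>q. u = Rx.proj q" if "u \<in> carrier (Rx p)" for u
    using Rx.proj_lift[OF that] by metis
  show "D0 u \<in> carrier (Rx p)" if "u \<in> carrier (Rx p)" for u
    using lift[OF that] by (auto simp: D0_proj)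
  show "D0 (\<lambda>i. Polynomial.smult c (u i)) = (\<lambda>i. Polynomial.smult c (D0 u i))"
    if u: "u \<in> carrier (Rx p)" for c u
  proof -
    obtain q where q: "u = Rx.proj q" using lift[OF u] by blast
    have smult: "(\<lambda>i. Polynomial.smult c (Rx.proj q i)) = Rx.proj ([:[:c:]:] * q)" for q
      using Rx.mult_gmonom_0[of "Rx.proj q" "[:c:]"]
      by (simp only: mult.commute[of "[:[:c:]:]"] Rx.proj_mult Rx.proj_const Rx.proj_closed) simp
    show ?thesis
      unfolding q smult D0_proj by (simp only: deltaT.mult deltaT_const) simp
  qed
  show "D0 (u \<otimes>\<^bsub>Rx p\<^esub> v) = D0 u \<otimes>\<^bsub>Rx p\<^esub> v \<oplus>\<^bsub>Rx p\<^esub> u \<otimes>\<^bsub>Rx p\<^esub> D0 v"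
    if uv: "u \<in> carrier (Rx p)" "v \<in> carrier (Rx p)" for u v
  proof -
    obtain a b where "u = Rx.proj a" "v = Rx.proj b" using lift uv by blast
    then show ?thesis
      by (simp only: Rx.proj_mult[symmetric] Rx.proj_add[symmetric] D0_proj deltaT.mult)
  qed
qed (rule D0_add)

lemma proj_xT: "Rx.proj [:0, [:0, 1:]:] = gmonom [:0, 1:] 1"
proof -
  have "[:0, [:0, 1:]:] = monom ([:0, 1:] :: 'k poly) 1"
    by (simp add: monom_Suc monom_0)
  then show ?thesis using p_gt_1 by (simp only: Rx.proj_monom mod_less)
qed

text \<open>Uniqueness of \<open>\<delta>\<close>: \<open>x\<close> and \<open>g\<close> generate
  \<open>R\<close> over \<open>k\<close>, and the constants are killed because
  \<open>D 1 = D 1 + D 1\<close>.\<close>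

lemma Rx_derivation_proj:
  assumes D: "Rx_derivation p D"
    and x: "D (gmonom [:0, 1:] 0) = (\<lambda>i. [:lam i:])" and g: "D (gmonom 1 1) = gmonom [:0, 1:] 1"
  shows "D (Rx.proj q) = Rx.proj (deltaT p lam q)"
proof -
  from D have closed: "D u \<in> carrier (Rx p)" if "u \<in> carrier (Rx p)" for u
    using that by (auto simp: Rx_derivation_def)
  have add: "D (Rx.proj a \<oplus>\<^bsub>Rx p\<^esub> Rx.proj b) = D (Rx.proj a) \<oplus>\<^bsub>Rx p\<^esub> D (Rx.proj b)"
    and mult: "D (Rx.proj a \<otimes>\<^bsub>Rx p\<^esub> Rx.proj b) =
      D (Rx.proj a) \<otimes>\<^bsub>Rx p\<^esub> Rx.proj b \<oplus>\<^bsub>Rx p\<^esub> Rx.proj a \<otimes>\<^bsub>Rx p\<^esub> D (Rx.proj b)"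
    and smult: "D (\<lambda>i. Polynomial.smult c (Rx.proj a i)) = (\<lambda>i. Polynomial.smult c (D (Rx.proj a) i))"
    for a b c
    using D unfolding Rx_derivation_def by (blast intro: Rx.proj_closed)+
  have "D (Rx.proj 1) = D (Rx.proj 1) \<oplus>\<^bsub>Rx p\<^esub> D (Rx.proj 1)"
    using mult[of 1 1] closed[OF Rx.proj_closed, of 1]
    by (simp only: Rx.proj_1 Rx.r_one Rx.l_one Rx.one_closed)
  then have "D (Rx.proj 1) i = D (Rx.proj 1) i + D (Rx.proj 1) i" for i
    by (metis Rx.smash.add_S)
  then have "D (Rx.proj 1) i = 0" for i
    by (metis add_cancel_left_right)
  then have one: "D (Rx.proj 1) = \<zero>\<^bsub>Rx p\<^esub>"
    by (simp add: Rx.smash.zero_S fun_eq_iff)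
  have const: "D (Rx.proj [:[:c:]:]) = \<zero>\<^bsub>Rx p\<^esub>" for c
  proof -
    have "Rx.proj [:[:c:]:] = (\<lambda>i. Polynomial.smult c (Rx.proj 1 i))"
      by (auto simp: one_pCons Rx.proj_const gmonom_def)
    then show ?thesis by (simp only: smult one) (simp add: Rx.smash.zero_S)
  qed
  have x': "D (Rx.proj [:[:0, 1:]:]) = Rx.proj (deltaT p lam [:[:0, 1:]:])"
    by (simp only: Rx.proj_const x deltaT_x proj_lamT)
  have g': "D (Rx.proj [:0, 1:]) = Rx.proj (deltaT p lam [:0, 1:])"
    by (simp only: Rx.proj_var g deltaT_T proj_xT)
  have const': "D (Rx.proj [:[:c:]:]) = Rx.proj (deltaT p lam [:[:c:]:])" for c
    by (simp only: const deltaT_const Rx.proj_0)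
  have step: "D (Rx.proj (a + b * c)) = Rx.proj (deltaT p lam (a + b * c))"
    if "D (Rx.proj a) = Rx.proj (deltaT p lam a)" "D (Rx.proj b) = Rx.proj (deltaT p lam b)"
      "D (Rx.proj c) = Rx.proj (deltaT p lam c)" for a b c
  proof -
    have "D (Rx.proj (a + b * c)) = D (Rx.proj a) \<oplus>\<^bsub>Rx p\<^esub> D (Rx.proj (b * c))"
      unfolding Rx.proj_add by (rule add)
    also have "D (Rx.proj (b * c)) = D (Rx.proj b) \<otimes>\<^bsub>Rx p\<^esub> Rx.proj c \<oplus>\<^bsub>Rx p\<^esub> Rx.proj b \<otimes>\<^bsub>Rx p\<^esub> D (Rx.proj c)"
      unfolding Rx.proj_mult by (rule mult)
    finally show ?thesis
      by (simp only: that deltaT.add deltaT.mult Rx.proj_add Rx.proj_mult)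
  qed
  have zero: "D (Rx.proj 0) = Rx.proj (deltaT p lam 0)"
    using const'[of 0] by simp
  have inner: "D (Rx.proj [:c:]) = Rx.proj (deltaT p lam [:c:])" for c
  proof (induction c)
    case (pCons a c)
    then show ?case using step[OF const' x' pCons.IH, of a] by simp
  qed (use zero in simp)
  show ?thesis
  proof (induction q)
    case (pCons c q)
    then show ?case using step[OF inner g' pCons.IH, of c] by simp
  qed (rule zero)
qed

text \<open>Resolves the definite description: \<open>D0\<close> gives existence,
  \<open>Rx_derivation_proj\<close> uniqueness on the carrier, and restriction fixes the values
  outside it.\<close>

lemma delta_proj: "delta p lam (Rx.proj q) = Rx.proj (deltaT p lam q)"
proof -
  have x: "gmonom [:0, 1:] 0 = Rx.proj [:[:0, 1:]:]" by (simp only: Rx.proj_const)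
  have g: "gmonom 1 1 = Rx.proj [:0, 1:]" by (simp only: Rx.proj_var)
  have xg: "gmonom [:0, 1:] 1 = Rx.proj [:0, [:0, 1:]:]"
    by (rule proj_xT[symmetric])
  let ?Q = "\<lambda>D. D \<in> extensional (carrier (Rx p)) \<and> Rx_derivation p D \<and>
     D (gmonom [:0, 1:] 0) = (\<lambda>i. [:lam i:]) \<and> D (gmonom 1 1) = gmonom [:0, 1:] 1"
  have eq: "D = restrict D0 (carrier (Rx p))" if "?Q D" for D :: "(nat \<Rightarrow> 'k poly) \<Rightarrow> nat \<Rightarrow> 'k poly"
  proof (rule extensionalityI[of _ "carrier (Rx p)"])
    fix u :: "nat \<Rightarrow> 'k poly" assume u: "u \<in> carrier (Rx p)"
    then obtain q where "u = Rx.proj q" using Rx.proj_lift by metis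
    then show "D u = restrict D0 (carrier (Rx p)) u"
      using Rx_derivation_proj[of D q] that u by (simp add: D0_proj)
  qed (use that in simp_all)
  have "(\<lambda>i. Polynomial.smult c (u i)) \<in> carrier (Rx p)" if "u \<in> carrier (Rx p)"
    for c and u :: "nat \<Rightarrow> 'k poly"
    using that by (simp add: Rx.smash.carrier_iff)
  then have "Rx_derivation p (restrict D0 (carrier (Rx p)))"
    using Rx_derivation_D0 unfolding Rx_derivation_def by (simp add: Pi_iff)
  then have "?Q (restrict D0 (carrier (Rx p)))"
    unfolding x g xg using Rx.proj_closed
    by (simp only: restrict_apply' D0_proj deltaT_x deltaT_T proj_lamT restrict_extensional simp_thms)
  then have "delta p lam = restrict D0 (carrier (Rx p))"
    unfolding delta_def by (intro the_equality eq)
  then show ?thesis by (simp add: D0_proj)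
qed

lemma delta_funpow_proj: "(delta p lam ^^ n) (Rx.proj q) = Rx.proj ((deltaT p lam ^^ n) q)"
  by (induction n) (simp_all only: funpow.simps id_apply o_apply delta_proj)

text \<open>\<open>R\<close> has zero divisors, but \<open>x g\<close> can be cancelled: multiplying
  by \<open>g^(p-1)\<close> turns it into \<open>x\<close>, which cancels in each coefficient. Hence
  the quotient is unique.\<close>

lemma delta_quotient_eq: "delta_quotient p lam = Rx.proj (rT p lam)"
  unfolding delta_quotient_def
proof (rule the_equality, goal_cases)
  have g: "gmonom 1 1 = Rx.proj [:0, 1:]" by (simp only: Rx.proj_var)
  note * = g delta_proj delta_funpow_proj deltaT_funpow_p_T[OF p_odd] Rx.proj_mult
  case 1
  show ?case unfolding * by simp
  case (2 r)
  let ?xg = "Rx.proj (deltaT p lam [:0, 1:])" and ?h = "gmonom (1 :: 'k poly) (p - 1)"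
  have h: "?h \<in> carrier (Rx p)" using p_gt_1 by (intro Rx.smash.gmonom_carrier) simp
  have "?xg = gmonom [:0, 1:] 1"
    by (simp only: deltaT_T proj_xT)
  then have xgh: "?xg \<otimes>\<^bsub>Rx p\<^esub> ?h = gmonom [:0, 1:] 0"
    using p_gt_1 by (simp add: Rx.proj_monom Rx.gmonom_mult)
  have r: "r \<in> carrier (Rx p)" "r \<otimes>\<^bsub>Rx p\<^esub> ?xg = Rx.proj (rT p lam) \<otimes>\<^bsub>Rx p\<^esub> ?xg"
    using 2 unfolding * by auto
  have "r \<otimes>\<^bsub>Rx p\<^esub> gmonom [:0, 1:] 0 = Rx.proj (rT p lam) \<otimes>\<^bsub>Rx p\<^esub> gmonom [:0, 1:] 0"
    unfolding xgh[symmetric] using r h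
    by (simp only: Rx.m_assoc[symmetric] Rx.proj_closed)
  then have "r i * [:0, 1:] = Rx.proj (rT p lam) i * [:0, 1:]" for i
    by (simp only: Rx.mult_gmonom_0 r Rx.proj_closed) meson
  then show ?case by (intro ext) (metis mult_right_cancel one_neq_zero pCons_eq_0_iff)
qed

end

section \<open>The algebra \<open>H\<^sub>\<lambda>\<close>\<close>

lemma (in ring_eval) ev_monom:
  assumes b: "b \<in> carrier S"
  shows "ev b (monom a i) = b [^] i \<otimes> \<phi> a"
proof (induction i)
  case 0
  show ?case using b by (simp add: monom_0 ev_const)
next
  case (Suc i)
  have "ev b (monom a (Suc i)) = b \<otimes> (b [^] i \<otimes> \<phi> a)"
    using b by (simp add: monom_Suc ev_pCons Suc)
  also have "\<dots> = b [^] Suc i \<otimes> \<phi> a"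
    using b by (metis m_assoc nat_pow_Suc2 nat_pow_closed \<phi>_closed)
  finally show ?case .
qed

lemma poly_in_x_pCons: "poly_in_x (pCons a q) = fscalar a + fvar LX * poly_in_x (q :: 'k::field poly)"
proof -
  have bound: "poly_in_x q = (\<Sum>j<n. fscalar (coeff q j) * fvar LX ^ j)" if "degree q < n" for n and q :: "'k poly"
    unfolding poly_in_x_def
    by (rule sum.mono_neutral_left) (use that in \<open>auto simp: coeff_eq_0\<close>)
  have "degree (pCons a q) < Suc (Suc (degree q))"
    using degree_pCons_le[of a q] by simp
  from bound[OF this] bound[of q "Suc (degree q)"] show ?thesis
    by (simp add: sum.lessThan_Suc_shift sum_distrib_left distrib_left fscalar_commute mult.assoc
        del: sum.lessThan_Suc)
qed

lemma poly_in_x_0 [simp]: "poly_in_x 0 = 0"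
  by (simp add: poly_in_x_def)

lemma poly_in_x_add: "poly_in_x (q + q') = poly_in_x q + poly_in_x q'"
  by (induction q q' rule: poly_induct2) (simp_all add: poly_in_x_pCons distrib_left)

text \<open>In characteristic \<open>p\<close> the expansion of \<open>u y^p\<close> keeps only its
  two extreme terms.\<close>

lemma (in ore_verma) act_monom_char:
  assumes "prime p" "CHAR('c) = p"
  shows "act u (monom 1 p) = monom (e u) p + [:e ((D ^^ p) u):]"
proof (rule poly_eqI)
  fix m
  have const: "coeff [:c:] k = (if k = 0 then c else 0)" for c :: 'c and k
    by (cases k) simp_all
  consider "m = 0" | "m = p" | "0 < m" "m < p" | "m > p" by linarith
  then show "coeff (act u (monom 1 p)) m = coeff (monom (e u) p + [:e ((D ^^ p) u):]) m"
    using prime_gt_0_nat[OF assms(1)]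
    by cases (simp_all add: act_monom_coeff const of_nat_choose_prime_char[OF assms])
qed

context heisenberg_setting
begin

section \<open>Generators and relations of H\<close>

sublocale Sm: cyclic_smash p "g_act :: 'k free_alg \<Rightarrow> 'k free_alg"
  rewrites "smash_cyclic p (g_act :: 'k free_alg \<Rightarrow> 'k free_alg) \<equiv> Sm p"
proof -
  show "cyclic_smash p (g_act :: 'k free_alg \<Rightarrow> 'k free_alg)"
    by unfold_locales (use p_gt_1 g_act_funpow_char[OF char_p] in \<open>auto simp: g_act_add g_act_mult\<close>)
qed (simp add: Sm_def)

sublocale Sm: ring "Sm p :: (nat \<Rightarrow> 'k free_alg) ring"
  by (rule Sm.ring_S)

abbreviation HH :: "'k H_elem ring" where "HH \<equiv> Halg p lam"

abbreviation smon :: "'k free_alg \<Rightarrow> nat \<Rightarrow> nat \<Rightarrow> 'k free_alg" where "smon \<equiv> gmonom"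

lemma smon_carrier: "smon a 0 \<in> carrier (Sm p)" "smon a 1 \<in> carrier (Sm p)"
  using p_gt_1 by (auto intro: Sm.gmonom_carrier)

lemma lam_Sm_carrier: "(\<lambda>i. fscalar (lam i)) \<in> carrier (Sm p)"
  by (simp add: Sm.carrier_iff lam_ge)

lemma relator_carrier: "relator p lam \<in> carrier (Sm p)"
  unfolding relator_def
  by (intro Sm.minus_closed Sm.m_closed smon_carrier lam_Sm_carrier)

sublocale Hid: ideal "H_ideal p lam" "Sm p"
  unfolding H_ideal_def by (rule Sm.genideal_ideal) (use relator_carrier in simp)

sublocale H: ring HH
  unfolding Halg_def by (rule Hid.quotient_is_ring)

lemma H_class_hom: "H_class p lam \<in> Ring.ring_hom (Sm p) HH"
  unfolding H_class_def Halg_def by (rule Hid.rcos_ring_hom)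

lemma H_class_closed [simp]: "u \<in> carrier (Sm p) \<Longrightarrow> H_class p lam u \<in> carrier HH"
  using H_class_hom by (rule Ring.ring_hom_closed)

lemmas H_class_mult = Ring.ring_hom_mult[OF H_class_hom]
  and H_class_add = Ring.ring_hom_add[OF H_class_hom]
  and H_class_one = Ring.ring_hom_one[OF H_class_hom]

lemma H_class_surj: "h \<in> carrier HH \<Longrightarrow> \<exists>u \<in> carrier (Sm p). h = H_class p lam u"
  by (auto simp: Halg_def FactRing_def A_RCOSETS_def' H_class_def)

lemma H_class_eq_iff:
  assumes "u \<in> carrier (Sm p)" "v \<in> carrier (Sm p)"
  shows "H_class p lam u = H_class p lam v \<longleftrightarrow> u \<ominus>\<^bsub>Sm p\<^esub> v \<in> H_ideal p lam"
  unfolding H_class_def using Sm.quotient_eq_iff_same_a_r_cos[OF Hid.ideal_axioms] assms by metis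

lemma Hx_closed [simp]: "Hx p lam \<in> carrier HH" and Hy_closed [simp]: "Hy p lam \<in> carrier HH"
  and Hg_closed [simp]: "Hg p lam \<in> carrier HH" and Hscalar_closed [simp]: "Hscalar p lam c \<in> carrier HH"
  unfolding Hx_def Hy_def Hg_def Hscalar_def by (auto intro: H_class_closed smon_carrier simp del: One_nat_def)

lemma smon_add: "smon a i \<oplus>\<^bsub>Sm p\<^esub> smon b i = smon (a + b) i"
  by (auto simp: gmonom_def Sm.add_S)

lemma smon_mult: "i < p \<Longrightarrow> j < p \<Longrightarrow>
    smon a i \<otimes>\<^bsub>Sm p\<^esub> smon b j = smon (a * (g_act ^^ i) b) ((i + j) mod p)"
  by (rule Sm.gmonom_mult)

lemma smon_mult_0: "j < p \<Longrightarrow> smon a 0 \<otimes>\<^bsub>Sm p\<^esub> smon b j = smon (a * b) j"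
  using p_gt_1 by (subst smon_mult) auto

sublocale HS: ring_eval HH "Hscalar p lam"
proof (unfold_locales, goal_cases)
  case (2 c d)
  show ?case unfolding Hscalar_def fscalar_simps smon_add[symmetric]
    by (intro H_class_add smon_carrier)
next
  case (3 c d)
  have "smon (fscalar (c * d)) 0 = smon (fscalar c) 0 \<otimes>\<^bsub>Sm p\<^esub> smon (fscalar d) 0"
    using p_gt_1 by (simp add: smon_mult_0)
  then show ?case unfolding Hscalar_def by (simp only: H_class_mult smon_carrier)
next
  case 4
  show ?case unfolding Hscalar_def fscalar_simps H_class_one[symmetric] Sm.one_S ..
qed simp

lemma Hscalar_central:
  assumes "h \<in> carrier HH"
  shows "Hscalar p lam c \<otimes>\<^bsub>HH\<^esub> h = h \<otimes>\<^bsub>HH\<^esub> Hscalar p lam c"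
proof -
  have pow: "(g_act ^^ i) (fscalar c :: 'k free_alg) = fscalar c" for i
    by (induction i) auto
  have comm: "smon (fscalar c) 0 \<otimes>\<^bsub>Sm p\<^esub> u = u \<otimes>\<^bsub>Sm p\<^esub> smon (fscalar c) 0" if "u \<in> carrier (Sm p)" for u
    using that
  proof (induction rule: Sm.S_induct)
    case (monom a i)
    then show ?case using smon_mult[of 0 i] smon_mult[of i 0] p_gt_1 by (simp add: pow fscalar_commute)
  next
    case (add u v)
    then show ?case by (simp only: Sm.r_distr Sm.l_distr smon_carrier)
  qed
  obtain u where u: "u \<in> carrier (Sm p)" "h = H_class p lam u"
    using H_class_surj[OF assms] by blast
  then show ?thesis
    unfolding Hscalar_def u(2) by (simp only: comm H_class_mult[symmetric] smon_carrier)
qed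

lemma Hg_Hx: "Hg p lam \<otimes>\<^bsub>HH\<^esub> Hx p lam = Hx p lam \<otimes>\<^bsub>HH\<^esub> Hg p lam"
proof -
  have "smon 1 1 \<otimes>\<^bsub>Sm p\<^esub> smon (fvar LX) 0 = smon (fvar LX) 0 \<otimes>\<^bsub>Sm p\<^esub> smon 1 1"
    using p_gt_1 smon_mult[of 1 0 1 "fvar LX"] smon_mult[of 0 1 "fvar LX" 1] by simp
  then show ?thesis unfolding Hg_def Hx_def by (simp only: H_class_mult[symmetric] smon_carrier)
qed

lemma Hg_Hy: "Hg p lam \<otimes>\<^bsub>HH\<^esub> Hy p lam =
    Hy p lam \<otimes>\<^bsub>HH\<^esub> Hg p lam \<oplus>\<^bsub>HH\<^esub> Hx p lam \<otimes>\<^bsub>HH\<^esub> Hg p lam"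
proof -
  have "smon 1 1 \<otimes>\<^bsub>Sm p\<^esub> smon (fvar LY) 0 =
      smon (fvar LY) 0 \<otimes>\<^bsub>Sm p\<^esub> smon 1 1 \<oplus>\<^bsub>Sm p\<^esub> smon (fvar LX) 0 \<otimes>\<^bsub>Sm p\<^esub> smon 1 1"
    using p_gt_1 smon_mult[of 1 0 1 "fvar LY"] smon_mult[of 0 1 "fvar LX" 1] smon_mult[of 0 1 "fvar LY" 1]
    by (simp add: smon_add add.commute)
  then show ?thesis unfolding Hg_def Hx_def Hy_def
    by (simp only: H_class_mult[symmetric] H_class_add[symmetric] smon_carrier Sm.m_closed)
qed

lemma Hx_Hy: "Hx p lam \<otimes>\<^bsub>HH\<^esub> Hy p lam =
    Hy p lam \<otimes>\<^bsub>HH\<^esub> Hx p lam \<oplus>\<^bsub>HH\<^esub> H_class p lam (\<lambda>i. fscalar (lam i))"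
proof -
  let ?x = "smon (fvar LX) 0" and ?y = "smon (fvar LY) 0" and ?l = "\<lambda>i. fscalar (lam i) :: 'k free_alg"
  have "relator p lam \<in> H_ideal p lam"
    unfolding H_ideal_def using Sm.genideal_self[of "{relator p lam}"] relator_carrier by simp
  moreover have "relator p lam = ?x \<otimes>\<^bsub>Sm p\<^esub> ?y \<ominus>\<^bsub>Sm p\<^esub> (?y \<otimes>\<^bsub>Sm p\<^esub> ?x \<oplus>\<^bsub>Sm p\<^esub> ?l)"
    unfolding relator_def using smon_carrier lam_Sm_carrier
    by (simp add: a_minus_def Sm.minus_add Sm.a_assoc)
  ultimately have "H_class p lam (?x \<otimes>\<^bsub>Sm p\<^esub> ?y) = H_class p lam (?y \<otimes>\<^bsub>Sm p\<^esub> ?x \<oplus>\<^bsub>Sm p\<^esub> ?l)"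
    by (subst H_class_eq_iff) (auto intro: smon_carrier lam_Sm_carrier)
  then show ?thesis unfolding Hx_def Hy_def
    by (simp only: H_class_mult[symmetric] H_class_add[symmetric] smon_carrier lam_Sm_carrier Sm.m_closed)
qed

lemma Hg_pow: "Hg p lam [^]\<^bsub>HH\<^esub> i = H_class p lam (smon 1 (i mod p))"
proof (induction i)
  case 0
  show ?case by (simp add: Sm.one_S[symmetric] H_class_one)
next
  case (Suc i)
  have i: "i mod p < p" using p_gt_1 by simp
  have "smon 1 (i mod p) \<otimes>\<^bsub>Sm p\<^esub> smon 1 1 = smon 1 (Suc i mod p)"
    using p_gt_1 smon_mult[OF i, of 1 1 1] by (simp add: mod_Suc_eq)
  then show ?case
    using Suc i by (simp only: H.nat_pow_Suc Hg_def H_class_mult[symmetric] smon_carrier Sm.gmonom_carrier)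
qed

lemma Hg_pow_p: "Hg p lam [^]\<^bsub>HH\<^esub> p = \<one>\<^bsub>HH\<^esub>"
  using Hg_pow[of p] Hg_pow[of 0] by simp

text \<open>Every class is a sum of products of a class from the free algebra with a power of
  \<open>g\<close>, so properties of \<open>H\<close> can be checked on scalars and three
  generators.\<close>

lemma H_induct [consumes 1, case_names scalar x y g add mult]:
  assumes h: "h \<in> carrier HH"
    and scalar: "\<And>c. P (Hscalar p lam c)" and x: "P (Hx p lam)" and y: "P (Hy p lam)" and g: "P (Hg p lam)"
    and add: "\<And>a b. a \<in> carrier HH \<Longrightarrow> b \<in> carrier HH \<Longrightarrow> P a \<Longrightarrow> P b \<Longrightarrow> P (a \<oplus>\<^bsub>HH\<^esub> b)"
    and mult: "\<And>a b. a \<in> carrier HH \<Longrightarrow> b \<in> carrier HH \<Longrightarrow> P a \<Longrightarrow> P b \<Longrightarrow> P (a \<otimes>\<^bsub>HH\<^esub> b)"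
  shows "P h"
proof -
  have free: "P (H_class p lam (smon a 0))" for a
  proof (induction a rule: free_alg_induct)
    case (scalar c)
    show ?case using assms(2) by (simp add: Hscalar_def)
  next
    case (letter l f)
    have "H_class p lam (smon (fvar l * f) 0) = H_class p lam (smon (fvar l) 0) \<otimes>\<^bsub>HH\<^esub> H_class p lam (smon f 0)"
      using smon_mult_0[of 0 "fvar l" f] p_gt_1 by (simp add: H_class_mult[symmetric] smon_carrier)
    moreover have "P (H_class p lam (smon (fvar l) 0))"
      using x y by (cases l) (simp_all add: Hx_def Hy_def)
    ultimately show ?case using letter by (auto intro!: mult H_class_closed smon_carrier)
  next
    case (add f h)
    then show ?case unfolding smon_add[symmetric]
      by (subst H_class_add) (auto intro!: assms(6) H_class_closed smon_carrier)
  qed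
  have g_pow: "P (Hg p lam [^]\<^bsub>HH\<^esub> i)" for i :: nat
  proof (induction i)
    case 0
    have "\<one>\<^bsub>HH\<^esub> = Hscalar p lam 1" by (rule HS.\<phi>_one[symmetric])
    then show ?case using scalar[of 1] by simp
  qed (auto intro: mult g)
  obtain u where u: "u \<in> carrier (Sm p)" "h = H_class p lam u" using H_class_surj[OF h] by blast
  from u(1) have "P (H_class p lam u)"
  proof (induction rule: Sm.S_induct)
    case (monom a i)
    have "smon a i = smon a 0 \<otimes>\<^bsub>Sm p\<^esub> smon 1 i"
      using monom smon_mult_0[of i a 1] by simp
    then have "H_class p lam (smon a i) = H_class p lam (smon a 0) \<otimes>\<^bsub>HH\<^esub> Hg p lam [^]\<^bsub>HH\<^esub> i"
      using monom by (simp add: H_class_mult smon_carrier Hg_pow)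
    then show ?case using free g_pow by (auto intro!: mult H_class_closed smon_carrier)
  qed (auto intro!: add H_class_closed simp: H_class_add)
  then show ?thesis using u by simp
qed

section \<open>The commutative subalgebra R and the Ore relation\<close>

sublocale HX: ring_eval HH "HS.ev (Hx p lam)"
  by (rule HS.ev_ring_eval) (simp_all add: Hscalar_central)

lemma Hg_ev_x: "HS.ev (Hx p lam) c \<otimes>\<^bsub>HH\<^esub> Hg p lam = Hg p lam \<otimes>\<^bsub>HH\<^esub> HS.ev (Hx p lam) c"
  by (rule HS.ev_commute[symmetric]) (simp_all add: Hg_Hx Hscalar_central)

text \<open>The subalgebra \<open>R\<close> is the image of \<open>k[x][T]\<close> under \<open>T \<mapsto> g\<close>.\<close>

abbreviation Phi :: "'k poly poly \<Rightarrow> 'k H_elem" where "Phi \<equiv> HX.ev (Hg p lam)"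

sublocale HR: ring_eval HH Phi
  by (rule HX.ev_ring_eval) (simp_all add: Hg_ev_x)

lemma Phi_simps: "Phi [:[:c:]:] = Hscalar p lam c" "Phi [:[:0, 1:]:] = Hx p lam" "Phi [:0, 1:] = Hg p lam"
  by (simp_all only: HX.ev_const HX.ev_var HS.ev_const HS.ev_var Hg_closed Hx_closed)

text \<open>The closing clause \<open>a + b * c\<close> is the Horner step, both in \<open>x\<close>
  inside the coefficients and in \<open>T\<close> outside.\<close>

lemma Phi_induct [case_names scalar x g step]:
  assumes "\<And>c. P [:[:c:]:]" "P [:[:0, 1:]:]" "P [:0, 1:]"
    and step: "\<And>a b c. P a \<Longrightarrow> P b \<Longrightarrow> P c \<Longrightarrow> P (a + b * c)"
  shows "P (q :: 'k poly poly)"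
proof -
  have c: "P [:c:]" for c
  proof (induction c)
    case (pCons a c)
    from step[OF assms(1) assms(2) pCons.IH, of a] show ?case by simp
  qed (use assms(1)[of 0] in simp)
  show ?thesis
  proof (induction q)
    case (pCons a q)
    from step[OF c assms(3) pCons.IH, of a] show ?case by simp
  qed (use c[of 0] in simp)
qed

lemma H_class_poly_in_x: "H_class p lam (smon (poly_in_x c) 0) = HS.ev (Hx p lam) c"
proof (induction c)
  case 0
  have "H_class p lam (smon (fscalar 0) 0) = \<zero>\<^bsub>HH\<^esub>"
    using HS.\<phi>_zero by (simp only: Hscalar_def)
  then show ?case by (simp only: fscalar_simps poly_in_x_0 HS.ev_0)
next
  case (pCons a c)
  have "smon (poly_in_x (pCons a c)) 0 = smon (fscalar a) 0 \<oplus>\<^bsub>Sm p\<^esub> smon (fvar LX) 0 \<otimes>\<^bsub>Sm p\<^esub> smon (poly_in_x c) 0"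
    using p_gt_1 by (simp add: smon_mult_0 smon_add poly_in_x_pCons)
  then have "H_class p lam (smon (poly_in_x (pCons a c)) 0) =
      Hscalar p lam a \<oplus>\<^bsub>HH\<^esub> Hx p lam \<otimes>\<^bsub>HH\<^esub> H_class p lam (smon (poly_in_x c) 0)"
    by (simp only: H_class_add H_class_mult smon_carrier Sm.m_closed Hscalar_def Hx_def)
  then show ?case by (simp only: pCons HS.ev_pCons Hx_closed)
qed

text \<open>Ties the embedding of \<open>R\<close> that enters the definition of \<open>Y\<close> to
  \<open>Phi\<close>, so that \<open>Y\<close> can be computed with \<open>rT\<close>.\<close>

lemma Rx_to_H_proj: "Rx_to_H p lam (Rx.proj q) = Phi q"
proof (induction q rule: poly_monom_induct)
  case (monom c i)
  have i: "i mod p < p" using p_gt_1 by simp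
  have "(\<lambda>j. poly_in_x (gmonom c (i mod p) j)) = smon (poly_in_x c) 0 \<otimes>\<^bsub>Sm p\<^esub> smon 1 (i mod p)"
    by (simp add: smon_mult_0[OF i]) (auto simp: gmonom_def)
  then have "Rx_to_H p lam (Rx.proj (monom c i)) = HS.ev (Hx p lam) c \<otimes>\<^bsub>HH\<^esub> Hg p lam [^]\<^bsub>HH\<^esub> i"
    unfolding Rx_to_H_def Rx.proj_monom Hg_pow H_class_poly_in_x[symmetric]
    using i by (simp only: H_class_mult smon_carrier Sm.gmonom_carrier)
  also have "\<dots> = HS.ev (Hx p lam) c \<otimes>\<^bsub>HH\<^esub> Phi [:0, 1:] [^]\<^bsub>HH\<^esub> i"
    by (simp only: Phi_simps)
  also have "\<dots> = Phi ([:c:] * [:0, 1:] ^ i)"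
    by (simp only: HR.\<phi>_mult HR.\<phi>_power HX.ev_const Hg_closed)
  also have "[:c:] * [:0, 1:] ^ i = monom c i"
    by (simp add: monom_altdef)
  finally show ?case .
next
  case (add q q')
  have *: "(\<lambda>i. poly_in_x (Rx.proj q i)) \<in> carrier (Sm p)" for q
    using Rx.proj_closed[of q] by (simp add: Sm.carrier_iff Rx.smash.carrier_iff)
  have "(\<lambda>i. poly_in_x (Rx.proj (q + q') i)) =
      (\<lambda>i. poly_in_x (Rx.proj q i)) \<oplus>\<^bsub>Sm p\<^esub> (\<lambda>i. poly_in_x (Rx.proj q' i))"
    by (simp add: Rx.proj_add Rx.smash.add_S Sm.add_S poly_in_x_add)
  then have "Rx_to_H p lam (Rx.proj (q + q')) = Rx_to_H p lam (Rx.proj q) \<oplus>\<^bsub>HH\<^esub> Rx_to_H p lam (Rx.proj q')"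
    unfolding Rx_to_H_def by (simp only: H_class_add *)
  then show ?case by (simp only: add HR.\<phi>_add)
qed

lemma Phi_lamT: "Phi (lamT p lam) = H_class p lam (\<lambda>i. fscalar (lam i))"
proof -
  have "poly_in_x [:c:] = fscalar c" for c :: 'k
    by (simp add: poly_in_x_pCons)
  then show ?thesis by (simp add: Rx_to_H_proj[symmetric] Rx_to_H_def proj_lamT)
qed

text \<open>The defining relation is the case of \<open>x\<close>, and the rule
  \<open>g y = (x + y) g\<close> is the case of \<open>T\<close>; products are handled by the
  product rule of \<open>deltaT\<close>.\<close>

lemma Phi_Hy: "Phi u \<otimes>\<^bsub>HH\<^esub> Hy p lam = Hy p lam \<otimes>\<^bsub>HH\<^esub> Phi u \<oplus>\<^bsub>HH\<^esub> Phi (deltaT p lam u)"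
proof (induction u rule: Phi_induct)
  case (scalar c)
  show ?case by (simp add: Phi_simps Hscalar_central)
next
  case x
  show ?case by (simp only: Phi_simps deltaT_x Phi_lamT Hx_Hy)
next
  case g
  have "deltaT p lam [:0, 1:] = [:[:0, 1:]:] * [:0, 1:]"
    by (simp add: deltaT_T)
  then show ?case by (simp only: Phi_simps HR.\<phi>_mult Hg_Hy)
next
  case (step a b c)
  let ?y = "Hy p lam" and ?d = "\<lambda>u. Phi (deltaT p lam u)"
  have "(Phi b \<otimes>\<^bsub>HH\<^esub> Phi c) \<otimes>\<^bsub>HH\<^esub> ?y = Phi b \<otimes>\<^bsub>HH\<^esub> (?y \<otimes>\<^bsub>HH\<^esub> Phi c \<oplus>\<^bsub>HH\<^esub> ?d c)"
    by (simp add: H.m_assoc step)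
  also have "\<dots> = (Phi b \<otimes>\<^bsub>HH\<^esub> ?y) \<otimes>\<^bsub>HH\<^esub> Phi c \<oplus>\<^bsub>HH\<^esub> Phi b \<otimes>\<^bsub>HH\<^esub> ?d c"
    by (simp add: H.m_assoc H.r_distr)
  also have "\<dots> = ?y \<otimes>\<^bsub>HH\<^esub> (Phi b \<otimes>\<^bsub>HH\<^esub> Phi c) \<oplus>\<^bsub>HH\<^esub> (?d b \<otimes>\<^bsub>HH\<^esub> Phi c \<oplus>\<^bsub>HH\<^esub> Phi b \<otimes>\<^bsub>HH\<^esub> ?d c)"
    by (simp add: H.m_assoc H.l_distr step H.a_assoc)
  finally show ?case
    by (simp add: deltaT.add deltaT.mult HR.\<phi>_add HR.\<phi>_mult H.l_distr H.r_distr step H.a_ac)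
qed

text \<open>\<open>Psi\<close> collects an element of \<open>R[y; \<delta>]\<close> with the powers of \<open>y\<close> on the left.\<close>

abbreviation Psi :: "'k poly poly poly \<Rightarrow> 'k H_elem" where "Psi \<equiv> HR.ev (Hy p lam)"

text \<open>With the identity at the right end, \<open>rho\<close> computes normal forms in
  \<open>H\<close> itself.\<close>

lemma ore_verma_id: "ore_verma (deltaT p lam) (\<lambda>a. a)"
  by unfold_locales simp_all

lemma Phi_Psi: "Phi u \<otimes>\<^bsub>HH\<^esub> Psi f = Psi (rho (\<lambda>a. a) (deltaT p lam) u f)"
proof (induction f arbitrary: u)
  case (pCons a f)
  let ?y = "Hy p lam"
  have "Phi u \<otimes>\<^bsub>HH\<^esub> (?y \<otimes>\<^bsub>HH\<^esub> Psi f) = (?y \<otimes>\<^bsub>HH\<^esub> Phi u \<oplus>\<^bsub>HH\<^esub> Phi (deltaT p lam u)) \<otimes>\<^bsub>HH\<^esub> Psi f"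
    by (simp add: H.m_assoc[symmetric] Phi_Hy)
  also have "\<dots> = ?y \<otimes>\<^bsub>HH\<^esub> Psi (rho (\<lambda>a. a) (deltaT p lam) u f) \<oplus>\<^bsub>HH\<^esub> Psi (rho (\<lambda>a. a) (deltaT p lam) (deltaT p lam u) f)"
    by (simp add: H.m_assoc H.l_distr pCons.IH)
  finally show ?case
    by (simp add: HR.ev_pCons H.r_distr rho_pCons HR.ev_add HR.\<phi>_mult H.a_assoc)
qed simp

lemma Phi_Hy_pow_p:
  "Phi u \<otimes>\<^bsub>HH\<^esub> Hy p lam [^]\<^bsub>HH\<^esub> p =
    Hy p lam [^]\<^bsub>HH\<^esub> p \<otimes>\<^bsub>HH\<^esub> Phi u \<oplus>\<^bsub>HH\<^esub> Phi ((deltaT p lam ^^ p) u)"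
proof -
  interpret O: ore_verma "deltaT p lam" "\<lambda>a :: 'k poly poly. a" by (rule ore_verma_id)
  have "rho (\<lambda>a. a) (deltaT p lam) u (monom 1 p) = monom u p + [:(deltaT p lam ^^ p) u:]"
    by (rule O.act_monom_char[OF p_prime]) (simp add: char_p)
  then have "Phi u \<otimes>\<^bsub>HH\<^esub> Psi (monom 1 p) = Psi (monom u p) \<oplus>\<^bsub>HH\<^esub> Phi ((deltaT p lam ^^ p) u)"
    by (simp only: Phi_Psi HR.ev_add HR.ev_const Hy_closed)
  then show ?thesis
    by (simp add: HR.ev_monom HR.\<phi>_one)
qed

section \<open>The central elements Y and x^p\<close>

lemma HY_eq: "HY p lam = Hy p lam [^]\<^bsub>HH\<^esub> p \<ominus>\<^bsub>HH\<^esub> Hy p lam \<otimes>\<^bsub>HH\<^esub> Phi (rT p lam)"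
  by (simp add: HY_def delta_quotient_eq Rx_to_H_proj)

lemma HY_closed [simp]: "HY p lam \<in> carrier HH"
  by (simp add: HY_eq)

text \<open>Moving \<open>u\<close> past \<open>y^p\<close> produces
  \<open>\<delta>^p(u) = r \<delta>(u)\<close>, and moving it past \<open>y r\<close> produces
  \<open>\<delta>(u) r\<close>. The two cancel because \<open>R\<close> is commutative.\<close>

lemma HY_Phi: "Phi u \<otimes>\<^bsub>HH\<^esub> HY p lam = HY p lam \<otimes>\<^bsub>HH\<^esub> Phi u"
proof -
  let ?y = "Hy p lam" and ?yp = "Hy p lam [^]\<^bsub>HH\<^esub> p" and ?r = "Phi (rT p lam)" and ?u = "Phi u"
    and ?du = "Phi (deltaT p lam u)"
  have comm: "Phi a \<otimes>\<^bsub>HH\<^esub> Phi b = Phi b \<otimes>\<^bsub>HH\<^esub> Phi a" for a b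
    by (simp only: HR.\<phi>_mult[symmetric] mult.commute)
  have 1: "?u \<otimes>\<^bsub>HH\<^esub> ?yp = ?yp \<otimes>\<^bsub>HH\<^esub> ?u \<oplus>\<^bsub>HH\<^esub> ?du \<otimes>\<^bsub>HH\<^esub> ?r"
    unfolding Phi_Hy_pow_p deltaT_funpow_p[where lam = lam, OF p_prime p_odd char_p lam_0]
    by (simp only: HR.\<phi>_mult comm)
  have 2: "?u \<otimes>\<^bsub>HH\<^esub> (?y \<otimes>\<^bsub>HH\<^esub> ?r) = (?y \<otimes>\<^bsub>HH\<^esub> ?r) \<otimes>\<^bsub>HH\<^esub> ?u \<oplus>\<^bsub>HH\<^esub> ?du \<otimes>\<^bsub>HH\<^esub> ?r"
    using comm[of u "rT p lam"]
    by (simp add: H.m_assoc[symmetric] Phi_Hy H.l_distr) (simp add: H.m_assoc)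
  have cancel: "(a \<oplus>\<^bsub>HH\<^esub> d) \<ominus>\<^bsub>HH\<^esub> (b \<oplus>\<^bsub>HH\<^esub> d) = a \<ominus>\<^bsub>HH\<^esub> b"
    if "a \<in> carrier HH" "b \<in> carrier HH" "d \<in> carrier HH" for a b d
  proof -
    have "(a \<oplus>\<^bsub>HH\<^esub> d) \<ominus>\<^bsub>HH\<^esub> (b \<oplus>\<^bsub>HH\<^esub> d) = a \<oplus>\<^bsub>HH\<^esub> (d \<oplus>\<^bsub>HH\<^esub> (\<ominus>\<^bsub>HH\<^esub> d \<oplus>\<^bsub>HH\<^esub> \<ominus>\<^bsub>HH\<^esub> b))"
      using that by (simp add: a_minus_def H.minus_add H.a_ac)
    then show ?thesis using that by (simp add: H.r_neg2 a_minus_def)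
  qed
  have "?u \<otimes>\<^bsub>HH\<^esub> HY p lam = ?u \<otimes>\<^bsub>HH\<^esub> ?yp \<ominus>\<^bsub>HH\<^esub> ?u \<otimes>\<^bsub>HH\<^esub> (?y \<otimes>\<^bsub>HH\<^esub> ?r)"
    by (simp add: HY_eq a_minus_def H.r_distr H.r_minus)
  also have "\<dots> = ?yp \<otimes>\<^bsub>HH\<^esub> ?u \<ominus>\<^bsub>HH\<^esub> (?y \<otimes>\<^bsub>HH\<^esub> ?r) \<otimes>\<^bsub>HH\<^esub> ?u"
    unfolding 1 2 by (rule cancel) simp_all
  also have "\<dots> = HY p lam \<otimes>\<^bsub>HH\<^esub> ?u"
    by (simp add: HY_eq a_minus_def H.l_distr H.l_minus)
  finally show ?thesis .
qed

text \<open>Scalars, \<open>x\<close> and \<open>g\<close> are covered by \<open>HY_Phi\<close>; the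
  generator \<open>y\<close> commutes with \<open>y^p - y r\<close> because
  \<open>\<delta>(r) = 0\<close>.\<close>

lemma HY_central: "h \<in> carrier HH \<Longrightarrow> HY p lam \<otimes>\<^bsub>HH\<^esub> h = h \<otimes>\<^bsub>HH\<^esub> HY p lam"
proof (induction rule: H_induct)
  case (scalar c)
  show ?case using HY_Phi[of "[:[:c:]:]"] by (simp only: Phi_simps)
next
  case x
  show ?case using HY_Phi[of "[:[:0, 1:]:]"] by (simp only: Phi_simps)
next
  case g
  show ?case using HY_Phi[of "[:0, 1:]"] by (simp only: Phi_simps)
next
  case y
  let ?y = "Hy p lam" and ?r = "Phi (rT p lam)"
  have "?r \<otimes>\<^bsub>HH\<^esub> ?y = ?y \<otimes>\<^bsub>HH\<^esub> ?r"
    by (simp add: Phi_Hy deltaT_rT[where lam = lam, OF p_prime p_odd char_p lam_0])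
  moreover have "?y [^]\<^bsub>HH\<^esub> p \<otimes>\<^bsub>HH\<^esub> ?y = ?y \<otimes>\<^bsub>HH\<^esub> ?y [^]\<^bsub>HH\<^esub> p"
    by (simp add: H.nat_pow_comm[of ?y p "1::nat", simplified])
  ultimately show ?case
    by (simp add: HY_eq a_minus_def H.l_distr H.r_distr H.l_minus H.r_minus H.m_assoc)
next
  case (add a b)
  then show ?case by (simp add: H.l_distr H.r_distr)
next
  case (mult a b)
  then show ?case by (metis H.m_assoc HY_closed)
qed

lemma deltaT_x_pow_p: "deltaT p lam ([:[:0, 1:]:] ^ p) = 0"
proof -
  have "(of_nat p :: 'k poly poly) = 0"
    unfolding of_nat_eq_0_iff_char_dvd by (simp add: char_p)
  then show ?thesis by (simp only: deltaT.power mult_zero_left)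
qed

lemma Hx_pow: "Phi ([:[:0, 1:]:] ^ n) = Hx p lam [^]\<^bsub>HH\<^esub> n"
  by (simp only: HR.\<phi>_power Phi_simps)

lemma Hx_pow_p_central: "h \<in> carrier HH \<Longrightarrow> Hx p lam [^]\<^bsub>HH\<^esub> p \<otimes>\<^bsub>HH\<^esub> h = h \<otimes>\<^bsub>HH\<^esub> Hx p lam [^]\<^bsub>HH\<^esub> p"
proof (induction rule: H_induct)
  case (scalar c)
  show ?case by (rule Hscalar_central[symmetric]) simp
next
  case x
  show ?case by (simp add: H.nat_pow_comm[of "Hx p lam" p "1::nat", simplified])
next
  case g
  show ?case using HR.\<phi>_mult[of "[:[:0, 1:]:] ^ p" "[:0, 1:]"] HR.\<phi>_mult[of "[:0, 1:]" "[:[:0, 1:]:] ^ p"]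
    by (simp only: Hx_pow Phi_simps mult.commute)
next
  case y
  show ?case using Phi_Hy[of "[:[:0, 1:]:] ^ p"] by (simp add: Hx_pow deltaT_x_pow_p)
next
  case (add a b)
  then show ?case by (simp add: H.l_distr H.r_distr)
next
  case (mult a b)
  then show ?case by (metis H.m_assoc H.nat_pow_closed Hx_closed)
qed

end

section \<open>The Verma module as an action on \<open>k[y]\<close>\<close>

lemma evT_x_pow: "evT \<alpha> ([:[:0, 1:]:] ^ n) = \<alpha> ^ n"
  by (simp add: evT_def poly_const_pow)

context heisenberg_setting
begin

section \<open>The action of H on k[y]\<close>

abbreviation vact :: "'k \<Rightarrow> 'k poly poly \<Rightarrow> 'k poly \<Rightarrow> 'k poly" where
  "vact \<alpha> \<equiv> rho (evT \<alpha>) (deltaT p lam)"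

abbreviation gV :: "'k \<Rightarrow> 'k poly \<Rightarrow> 'k poly" where
  "gV \<alpha> \<equiv> vact \<alpha> [:0, 1:]"

fun letterV :: "'k \<Rightarrow> letter \<Rightarrow> 'k poly \<Rightarrow> 'k poly" where
  "letterV \<alpha> LX f = vact \<alpha> [:[:0, 1:]:] f"
| "letterV \<alpha> LY f = pCons 0 f"

lemma letterV_add: "letterV \<alpha> l (f + h) = letterV \<alpha> l f + letterV \<alpha> l h"
  by (cases l) (simp_all add: verma.act_add)

lemma letterV_smult: "letterV \<alpha> l (Polynomial.smult c f) = Polynomial.smult c (letterV \<alpha> l f)"
  by (cases l) (simp_all add: verma.act_smult)

text \<open>The linear extension over words. The free algebra may act by arbitrary operators for its
  letters; the relations of \<open>H\<close> are imposed on this action afterwards.\<close>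

definition freeV :: "'k \<Rightarrow> 'k free_alg \<Rightarrow> 'k poly \<Rightarrow> 'k poly" where
  "freeV \<alpha> a f = (\<Sum>w\<in>Poly_Mapping.keys a.
     Polynomial.smult (Poly_Mapping.lookup a w) (foldr (letterV \<alpha>) (letters w) f))"

lemma freeV_add_left: "freeV \<alpha> (a + b) f = freeV \<alpha> a f + freeV \<alpha> b f"
  unfolding freeV_def by (rule sum_keys_add) (simp add: smult_add_left)

lemma freeV_0 [simp]: "freeV \<alpha> 0 f = 0"
  by (simp add: freeV_def)

lemma freeV_single:
  "freeV \<alpha> (Poly_Mapping.single w c) f = Polynomial.smult c (foldr (letterV \<alpha>) (letters w) f)"
  by (cases "c = 0") (simp_all add: freeV_def)

lemma freeV_scalar: "freeV \<alpha> (fscalar c) f = Polynomial.smult c f"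
  using freeV_single[of \<alpha> "Word []" c] by (simp add: single_Word_Nil)

lemma freeV_letter_mult: "freeV \<alpha> (fvar l * a) f = letterV \<alpha> l (freeV \<alpha> a f)"
proof (induction a rule: poly_mapping_single_induct)
  case zero
  show ?case using letterV_smult[of \<alpha> l 0 0] by simp
next
  case (single w c)
  obtain ws where w: "w = Word ws" by (cases w)
  show ?case
    by (simp add: w single_Word_Cons[symmetric] freeV_single letterV_smult)
qed (simp add: distrib_left freeV_add_left letterV_add)

lemma freeV_letter: "freeV \<alpha> (fvar l) f = letterV \<alpha> l f"
  using freeV_letter_mult[of \<alpha> l 1 f] freeV_scalar[of \<alpha> 1 f] by simp

lemma freeV_add: "freeV \<alpha> a (f + h) = freeV \<alpha> a f + freeV \<alpha> a h"
  by (induction a rule: free_alg_induct)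
    (simp_all add: freeV_scalar smult_add_right freeV_letter_mult letterV_add freeV_add_left)

lemma freeV_smult: "freeV \<alpha> a (Polynomial.smult c f) = Polynomial.smult c (freeV \<alpha> a f)"
  by (induction a rule: free_alg_induct)
    (simp_all add: freeV_scalar mult.commute freeV_letter_mult letterV_smult freeV_add_left smult_add_right)

lemma freeV_sum: "freeV \<alpha> a (sum f A) = (\<Sum>i\<in>A. freeV \<alpha> a (f i))"
  using freeV_smult[of \<alpha> a 0 0] by (induction A rule: infinite_finite_induct) (simp_all add: freeV_add)

lemma freeV_mult: "freeV \<alpha> (a * b) f = freeV \<alpha> a (freeV \<alpha> b f)"
proof -
  have scalar: "freeV \<alpha> (fscalar c * b) f = Polynomial.smult c (freeV \<alpha> b f)" for c b
  proof (induction b rule: free_alg_induct)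
    case (scalar d)
    show ?case by (simp add: freeV_scalar flip: fscalar_simps)
  next
    case (letter l b)
    have "fscalar c * (fvar l * b) = fvar l * (fscalar c * b)"
      by (metis fscalar_commute mult.assoc)
    then show ?case by (simp add: freeV_letter_mult letter letterV_smult)
  qed (simp add: distrib_left freeV_add_left smult_add_right)
  show ?thesis
    by (induction a rule: free_alg_induct)
      (simp_all add: scalar freeV_scalar mult.assoc freeV_letter_mult distrib_right freeV_add_left)
qed

text \<open>The case of \<open>y\<close> is the Ore rule for \<open>T\<close>:
  \<open>\<delta>(T) = x T\<close> corresponds to \<open>g y = (x + y) g\<close>.\<close>

lemma gV_letter: "gV \<alpha> (letterV \<alpha> l f) = freeV \<alpha> (g_letter l) (gV \<alpha> f)"
proof (cases l)
  case LX
  have "[:0, 1:] * [:[:0, 1:]:] = [:[:0, 1:]:] * [:0, 1 :: 'k poly:]"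
    by (rule mult.commute)
  then show ?thesis
    by (simp only: LX letterV.simps g_letter.simps freeV_letter verma.act_mult_left[symmetric])
next
  case LY
  have "deltaT p lam [:0, 1:] = [:[:0, 1:]:] * [:0, 1:]" by (simp add: deltaT_T)
  then show ?thesis
    by (simp only: LY letterV.simps g_letter.simps freeV_add_left freeV_letter verma.act_pCons_0
        verma.act_mult_left add.commute)
qed

lemma gV_free: "gV \<alpha> (freeV \<alpha> a f) = freeV \<alpha> (g_act a) (gV \<alpha> f)"
  by (induction a rule: free_alg_induct)
    (simp_all add: freeV_scalar verma.act_smult freeV_letter_mult gV_letter freeV_add_left
      verma.act_add g_act_add g_act_mult freeV_mult freeV_letter)

lemma gV_pow: "(gV \<alpha> ^^ i) f = vact \<alpha> ([:0, 1:] ^ i) f"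
  by (induction i) (simp_all only: funpow.simps id_apply o_apply power_0 power_Suc verma.act_one verma.act_mult_left)

lemma gV_pow_free: "(gV \<alpha> ^^ i) (freeV \<alpha> a f) = freeV \<alpha> ((g_act ^^ i) a) ((gV \<alpha> ^^ i) f)"
  by (induction i) (simp_all add: gV_free)

text \<open>\<open>T^p\<close> is a constant of the derivation, so it acts by its value at
  \<open>T = 1\<close>.\<close>

lemma gV_pow_p: "(gV \<alpha> ^^ p) f = f"
proof -
  have "(of_nat p :: 'k poly poly) = 0"
    unfolding of_nat_eq_0_iff_char_dvd by (simp add: char_p)
  then have "deltaT p lam ([:0, 1:] ^ p) = 0"
    by (simp only: deltaT.power mult_zero_left)
  then have "vact \<alpha> ([:0, 1:] ^ p) f = Polynomial.smult (evT \<alpha> ([:0, 1:] ^ p)) f"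
    by (rule verma.act_const)
  then show ?thesis by (simp add: gV_pow evT_def)
qed

lemma gV_pow_mod: "(gV \<alpha> ^^ (i mod p)) f = (gV \<alpha> ^^ i) f"
proof -
  have *: "(gV \<alpha> ^^ (p * k)) h = h" for k h
  proof (induction k)
    case (Suc k)
    have "(gV \<alpha> ^^ (p * Suc k)) h = (gV \<alpha> ^^ p) ((gV \<alpha> ^^ (p * k)) h)"
      by (simp only: mult_Suc_right funpow_add o_apply)
    then show ?case by (simp only: Suc gV_pow_p)
  qed simp
  have "(gV \<alpha> ^^ (i mod p + p * (i div p))) f = (gV \<alpha> ^^ (i mod p)) f"
    by (simp only: funpow_add o_apply *)
  then show ?thesis by simp
qed

definition smashV :: "'k \<Rightarrow> (nat \<Rightarrow> 'k free_alg) \<Rightarrow> 'k poly \<Rightarrow> 'k poly" where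
  "smashV \<alpha> u f = (\<Sum>i<p. freeV \<alpha> (u i) ((gV \<alpha> ^^ i) f))"

lemma smashV_add_left: "smashV \<alpha> (u \<oplus>\<^bsub>Sm p\<^esub> v) f = smashV \<alpha> u f + smashV \<alpha> v f"
  by (simp add: smashV_def Sm.add_S freeV_add_left sum.distrib)

lemma smashV_zero: "smashV \<alpha> \<zero>\<^bsub>Sm p\<^esub> f = 0"
  by (simp add: smashV_def Sm.zero_S)

lemma smashV_mult_left: "smashV \<alpha> (u \<otimes>\<^bsub>Sm p\<^esub> v) f = smashV \<alpha> u (smashV \<alpha> v f)"
proof -
  have pow_sum: "(gV \<alpha> ^^ i) (sum h A) = (\<Sum>j\<in>A. (gV \<alpha> ^^ i) (h j))" for i h and A :: "nat set"
    unfolding gV_pow by (induction A rule: infinite_finite_induct) (simp_all add: verma.act_add)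
  have "smashV \<alpha> (u \<otimes>\<^bsub>Sm p\<^esub> v) f =
      (\<Sum>i<p. \<Sum>j<p. freeV \<alpha> (u i * (g_act ^^ i) (v j)) ((gV \<alpha> ^^ ((i + j) mod p)) f))"
    unfolding smashV_def
    by (rule Sm.sum_mult_S[where \<phi> = "\<lambda>l a. freeV \<alpha> a ((gV \<alpha> ^^ l) f)"]) (rule freeV_add_left)
  also have "\<dots> = (\<Sum>i<p. \<Sum>j<p. freeV \<alpha> (u i) ((gV \<alpha> ^^ i) (freeV \<alpha> (v j) ((gV \<alpha> ^^ j) f))))"
    by (simp only: gV_pow_mod freeV_mult gV_pow_free funpow_add o_apply)
  also have "\<dots> = smashV \<alpha> u (smashV \<alpha> v f)"
    by (simp only: smashV_def freeV_sum pow_sum)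
  finally show ?thesis .
qed

lemma smashV_monom: "i < p \<Longrightarrow> smashV \<alpha> (smon a i) f = freeV \<alpha> a ((gV \<alpha> ^^ i) f)"
proof -
  assume i: "i < p"
  have "smashV \<alpha> (smon a i) f = (\<Sum>j<p. if j = i then freeV \<alpha> a ((gV \<alpha> ^^ i) f) else 0)"
    unfolding smashV_def by (rule sum.cong) (auto simp: gmonom_def)
  then show ?thesis using i by simp
qed

lemma smashV_one: "smashV \<alpha> \<one>\<^bsub>Sm p\<^esub> f = f"
  using smashV_monom[of 0 \<alpha> 1 f] p_gt_1 freeV_scalar[of \<alpha> 1 f] by (simp add: Sm.one_S)

lemma smashV_minus: 
  assumes "u \<in> carrier (Sm p)" "v \<in> carrier (Sm p)"
  shows "smashV \<alpha> (u \<ominus>\<^bsub>Sm p\<^esub> v) f = smashV \<alpha> u f - smashV \<alpha> v f"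
proof -
  have "(u \<ominus>\<^bsub>Sm p\<^esub> v) \<oplus>\<^bsub>Sm p\<^esub> v = u"
    using assms by (simp add: a_minus_def Sm.a_assoc Sm.l_neg)
  then have "smashV \<alpha> u f = smashV \<alpha> (u \<ominus>\<^bsub>Sm p\<^esub> v) f + smashV \<alpha> v f"
    by (metis smashV_add_left)
  then show ?thesis by simp
qed

lemma vact_lamT: "vact \<alpha> (lamT p lam) f = (\<Sum>i<p. Polynomial.smult (lam i) ((gV \<alpha> ^^ i) f))"
proof -
  have sum: "vact \<alpha> (sum h A) f = (\<Sum>i\<in>A. vact \<alpha> (h i) f)" for h and A :: "nat set"
    by (induction A rule: infinite_finite_induct) (simp_all add: verma.act_add_left)
  have "monom [:lam i:] i = [:[:lam i:]:] * [:0, 1:] ^ i" for i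
    by (simp add: monom_altdef)
  then have "vact \<alpha> (monom [:lam i:] i) f = Polynomial.smult (lam i) ((gV \<alpha> ^^ i) f)" for i
    by (simp only: verma.act_mult_left gV_pow verma.act_const[OF deltaT_const]) simp
  then show ?thesis by (simp add: lamT_def sum)
qed

text \<open>By the Ore rule \<open>x y - y x\<close> acts as \<open>\<delta>(x)\<close>, which is
  \<open>lam\<close>.\<close>

lemma smashV_relator: "smashV \<alpha> (relator p lam) f = 0"
proof -
  let ?x = "smon (fvar LX) 0" and ?y = "smon (fvar LY) 0"
  have letter: "smashV \<alpha> (smon (fvar l) 0) h = letterV \<alpha> l h" for l h
    using smashV_monom[of 0 \<alpha> "fvar l" h] p_gt_1 by (simp add: freeV_letter)
  have l: "smashV \<alpha> (\<lambda>i. fscalar (lam i)) f = vact \<alpha> (lamT p lam) f"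
    by (simp add: smashV_def vact_lamT freeV_scalar)
  have "smashV \<alpha> (relator p lam) f =
      letterV \<alpha> LX (letterV \<alpha> LY f) - letterV \<alpha> LY (letterV \<alpha> LX f) - vact \<alpha> (lamT p lam) f"
    unfolding relator_def
    by (simp only: smashV_minus Sm.minus_closed Sm.m_closed smon_carrier lam_Sm_carrier smashV_mult_left letter l)
  then show ?thesis by (simp add: verma.act_pCons_0 deltaT_x)
qed

text \<open>The elements that act as zero form a two-sided ideal, and the relator is one of
  them.\<close>

lemma smashV_H_ideal:
  assumes "u \<in> H_ideal p lam"
  shows "smashV \<alpha> u f = 0"
proof -
  let ?J = "{u \<in> carrier (Sm p). \<forall>f. smashV \<alpha> u f = 0}"
  have zero: "smashV \<alpha> u 0 = 0" for u
    using freeV_smult[of \<alpha> _ 0 0]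
    by (simp add: smashV_def gV_pow)
  have "ideal ?J (Sm p)"
  proof (rule idealI)
    show "ring (Sm p :: (nat \<Rightarrow> 'k free_alg) ring)" by (rule Sm.ring_axioms)
    show "subgroup ?J (add_monoid (Sm p))"
    proof (rule Sm.add.subgroupI)
      show "\<ominus>\<^bsub>Sm p\<^esub> a \<in> ?J" if "a \<in> ?J" for a
      proof -
        have "smashV \<alpha> (\<zero>\<^bsub>Sm p\<^esub> \<ominus>\<^bsub>Sm p\<^esub> a) f = 0" for f
          using that by (subst smashV_minus) (auto simp: smashV_zero)
        then show ?thesis using that by (simp add: a_minus_def)
      qed
    qed (auto simp: smashV_add_left smashV_zero intro!: exI[of _ "\<zero>\<^bsub>Sm p\<^esub>"])
  qed (auto simp: smashV_mult_left zero)
  then have "H_ideal p lam \<subseteq> ?J"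
    unfolding H_ideal_def using relator_carrier smashV_relator by (intro Sm.genideal_minimal) auto
  with assms show ?thesis by blast
qed

text \<open>A representative is chosen; since \<open>smashV\<close> vanishes on the ideal, the
  choice does not affect the action.\<close>

definition hact :: "'k \<Rightarrow> 'k H_elem \<Rightarrow> 'k poly \<Rightarrow> 'k poly" where
  "hact \<alpha> h = smashV \<alpha> (SOME u. u \<in> carrier (Sm p) \<and> h = H_class p lam u)"

lemma hact_class:
  assumes "u \<in> carrier (Sm p)"
  shows "hact \<alpha> (H_class p lam u) f = smashV \<alpha> u f"
proof -
  define v where "v = (SOME v. v \<in> carrier (Sm p) \<and> H_class p lam u = H_class p lam v)"
  have v: "v \<in> carrier (Sm p)" "H_class p lam u = H_class p lam v"
    using someI[of "\<lambda>v. v \<in> carrier (Sm p) \<and> H_class p lam u = H_class p lam v" u] assms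
    by (auto simp: v_def)
  then have "smashV \<alpha> (u \<ominus>\<^bsub>Sm p\<^esub> v) f = 0"
    using assms by (intro smashV_H_ideal) (simp flip: H_class_eq_iff)
  then show ?thesis
    using assms v(1) unfolding hact_def v_def[symmetric] by (simp add: smashV_minus)
qed

lemma hact_add_left:
  assumes "a \<in> carrier HH" "b \<in> carrier HH"
  shows "hact \<alpha> (a \<oplus>\<^bsub>HH\<^esub> b) f = hact \<alpha> a f + hact \<alpha> b f"
proof -
  obtain u v where "u \<in> carrier (Sm p)" "a = H_class p lam u" "v \<in> carrier (Sm p)" "b = H_class p lam v"
    using assms H_class_surj by meson
  then show ?thesis by (simp add: H_class_add[symmetric] hact_class smashV_add_left)
qed

lemma hact_mult_left:
  assumes "a \<in> carrier HH" "b \<in> carrier HH"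
  shows "hact \<alpha> (a \<otimes>\<^bsub>HH\<^esub> b) f = hact \<alpha> a (hact \<alpha> b f)"
proof -
  obtain u v where "u \<in> carrier (Sm p)" "a = H_class p lam u" "v \<in> carrier (Sm p)" "b = H_class p lam v"
    using assms H_class_surj by meson
  then show ?thesis by (simp add: H_class_mult[symmetric] hact_class smashV_mult_left)
qed

lemma hact_one: "hact \<alpha> \<one>\<^bsub>HH\<^esub> f = f"
  by (simp add: H_class_one[symmetric] hact_class smashV_one)

lemma hact_letter:
  "hact \<alpha> (Hx p lam) f = vact \<alpha> [:[:0, 1:]:] f" "hact \<alpha> (Hy p lam) f = pCons 0 f"
  "hact \<alpha> (Hg p lam) f = gV \<alpha> f" "hact \<alpha> (Hscalar p lam c) f = Polynomial.smult c f"
proof -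
  show "hact \<alpha> (Hx p lam) f = vact \<alpha> [:[:0, 1:]:] f" "hact \<alpha> (Hy p lam) f = pCons 0 f"
    "hact \<alpha> (Hscalar p lam c) f = Polynomial.smult c f"
    using p_gt_1 unfolding Hx_def Hy_def Hscalar_def hact_class[OF smon_carrier(1)]
    by (simp_all add: smashV_monom freeV_letter freeV_scalar)
  show "hact \<alpha> (Hg p lam) f = gV \<alpha> f"
    using p_gt_1 freeV_scalar[of \<alpha> 1] unfolding Hg_def hact_class[OF smon_carrier(2)]
    by (simp add: smashV_monom)
qed

lemma hact_smult: "h \<in> carrier HH \<Longrightarrow> hact \<alpha> h (Polynomial.smult c f) = Polynomial.smult c (hact \<alpha> h f)"
  by (induction arbitrary: f rule: H_induct)
    (simp_all add: hact_letter verma.act_smult mult.commute smult_add_right hact_add_left hact_mult_left)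

lemma hact_minus_left:
  assumes "a \<in> carrier HH" "b \<in> carrier HH"
  shows "hact \<alpha> (a \<ominus>\<^bsub>HH\<^esub> b) f = hact \<alpha> a f - hact \<alpha> b f"
proof -
  have "(a \<ominus>\<^bsub>HH\<^esub> b) \<oplus>\<^bsub>HH\<^esub> b = a"
    using assms by (simp add: a_minus_def H.a_assoc H.l_neg)
  then have "hact \<alpha> a f = hact \<alpha> (a \<ominus>\<^bsub>HH\<^esub> b) f + hact \<alpha> b f"
    using assms by (metis hact_add_left H.minus_closed)
  then show ?thesis by simp
qed

lemma hact_Phi: "hact \<alpha> (Phi u) f = vact \<alpha> u f"
proof (induction u arbitrary: f rule: Phi_induct)
  case (scalar c)
  show ?case by (simp only: Phi_simps hact_letter verma.act_const[OF deltaT_const]) simp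
next
  case (step a b c)
  then show ?case
    by (simp add: HR.\<phi>_add HR.\<phi>_mult hact_add_left hact_mult_left verma.act_add_left verma.act_mult_left)
qed (simp_all only: Phi_simps hact_letter)

lemma hact_Hy_pow: "hact \<alpha> (Hy p lam [^]\<^bsub>HH\<^esub> n) f = monom 1 n * f"
proof (induction n arbitrary: f)
  case 0
  show ?case by (simp add: hact_one)
next
  case (Suc n)
  show ?case by (simp add: hact_mult_left hact_letter Suc monom_Suc)
qed

text \<open>For \<open>h = 1\<close> the element \<open>f(y)\<close> returns \<open>f\<close>, so
  the vector \<open>1\<close> generates \<open>k[y]\<close> and no nonzero \<open>f(y)\<close>
  annihilates it.\<close>

lemma hact_ev_y: "hact \<alpha> (HS.ev (Hy p lam) f) h = f * h"
  by (induction f)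
    (simp_all add: HS.ev_pCons hact_add_left hact_mult_left hact_letter
      H.zero_closed hact_minus_left[OF H.zero_closed H.zero_closed, unfolded a_minus_def, simplified])

lemma hact_HY: "hact \<alpha> (HY p lam) f = (monom 1 p - Polynomial.smult (evT \<alpha> (rT p lam)) [:0, 1:]) * f"
proof -
  have "hact \<alpha> (Phi (rT p lam)) f = Polynomial.smult (evT \<alpha> (rT p lam)) f"
    unfolding hact_Phi by (rule verma.act_const) (rule deltaT_rT[where lam = lam, OF p_prime p_odd char_p lam_0])
  then show ?thesis
    by (simp add: HY_eq hact_minus_left hact_Hy_pow hact_mult_left hact_letter left_diff_distrib)
qed

lemma hact_Hx_pow_p: "hact \<alpha> (Hx p lam [^]\<^bsub>HH\<^esub> p) f = Polynomial.smult (\<alpha> ^ p) f"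
  unfolding Hx_pow[symmetric] hact_Phi verma.act_const[OF deltaT_x_pow_p] by (simp only: evT_x_pow)

text \<open>The central (respectively, for the one-dimensional modules, distinguished) element whose
  value \<open>\<beta>\<close> is prescribed on \<open>S\<^sub>\<alpha>\<^sub>,\<^sub>\<beta>\<close>, and the polynomial in \<open>y\<close> by which it minus \<open>\<beta>\<close> acts.\<close>

definition degenerate :: "'k \<Rightarrow> bool" where
  "degenerate \<alpha> \<longleftrightarrow> K.aug lam = 0 \<and> \<alpha> = 0"

definition Z_elem :: "'k \<Rightarrow> 'k H_elem" where
  "Z_elem \<alpha> = (if degenerate \<alpha> then Hy p lam else HY p lam)"

definition q_poly :: "'k \<Rightarrow> 'k \<Rightarrow> 'k poly" where
  "q_poly \<alpha> \<beta> = (if degenerate \<alpha> then [:- \<beta>, 1:]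
     else monom 1 p - Polynomial.smult (evT \<alpha> (rT p lam)) [:0, 1:] - [:\<beta>:])"

lemma Z_elem_closed [simp]: "Z_elem \<alpha> \<in> carrier HH"
  by (simp add: Z_elem_def)

lemma hact_Z_elem: "hact \<alpha> (Z_elem \<alpha>) f = (q_poly \<alpha> \<beta> + [:\<beta>:]) * f"
  by (simp add: Z_elem_def q_poly_def hact_letter hact_HY)

lemma hact_Z_elem_minus: "hact \<alpha> (Z_elem \<alpha> \<ominus>\<^bsub>HH\<^esub> Hscalar p lam \<beta>) f = q_poly \<alpha> \<beta> * f"
  by (simp add: hact_minus_left hact_Z_elem[of _ _ \<beta>] hact_letter distrib_right)

lemma degree_q_poly: "degree (q_poly \<alpha> \<beta>) = (if degenerate \<alpha> then 1 else p)"
proof -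
  have "degree (monom 1 p - Polynomial.smult (evT \<alpha> (rT p lam)) [:0, 1:] - [:\<beta>:]) = p"
  proof -
    have "degree (- Polynomial.smult (evT \<alpha> (rT p lam)) [:0, 1:] - [:\<beta>:]) \<le> 1"
      by (intro degree_diff_le) auto
    also have "1 < degree (monom 1 p :: 'k poly)"
      using p_gt_1 by (simp add: degree_monom_eq)
    finally have "degree (monom 1 p + (- Polynomial.smult (evT \<alpha> (rT p lam)) [:0, 1:] - [:\<beta>:])) = p"
      by (subst degree_add_eq_left) (simp_all add: degree_monom_eq)
    then show ?thesis by (simp only: add_diff_eq add_uminus_conv_diff)
  qed
  then show ?thesis by (simp add: q_poly_def)
qed

lemma q_poly_nonzero: "q_poly \<alpha> \<beta> \<noteq> 0"
  using degree_q_poly[of \<alpha> \<beta>] p_gt_1 by (auto split: if_splits)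

section \<open>Submodules as ideals of k[y]\<close>

definition stable :: "'k \<Rightarrow> 'k poly set \<Rightarrow> bool" where
  "stable \<alpha> W \<longleftrightarrow> 0 \<in> W \<and> (\<forall>f \<in> W. \<forall>h \<in> W. f + h \<in> W) \<and> (\<forall>h \<in> carrier HH. \<forall>f \<in> W. hact \<alpha> h f \<in> W)"

lemma stable_ideal: "stable \<alpha> W \<Longrightarrow> f \<in> W \<Longrightarrow> h * f \<in> W"
  unfolding stable_def by (metis hact_ev_y HS.ev_closed[OF Hy_closed])

lemma stable_UNIV: "stable \<alpha> W \<Longrightarrow> 1 \<in> W \<Longrightarrow> W = UNIV"
  using stable_ideal[of \<alpha> W 1] by auto

lemma stable_diff: "stable \<alpha> W \<Longrightarrow> f \<in> W \<Longrightarrow> h \<in> W \<Longrightarrow> f - h \<in> W"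
  using stable_ideal[of \<alpha> W h "-1"] unfolding stable_def by (metis diff_conv_add_uminus mult_minus1)

text \<open>In the degenerate case evaluation at \<open>x = 0\<close>, \<open>T = 1\<close> kills
  the image of \<open>\<delta>\<close>, so every element of \<open>H\<close> multiplies the value
  \<open>f(\<beta>)\<close> by a fixed scalar. Otherwise the multiples of \<open>q_poly\<close> are
  the image of a central element.\<close>

lemma stable_q_poly: "stable \<alpha> {f. q_poly \<alpha> \<beta> dvd f}"
proof -
  have "q_poly \<alpha> \<beta> dvd hact \<alpha> h f" if h: "h \<in> carrier HH" and f: "q_poly \<alpha> \<beta> dvd f" for h f
  proof (cases "degenerate \<alpha>")
    case True
    have "evT \<alpha> (lamT p lam) = 0" "evT \<alpha> [:0, [:0, 1:]:] = 0"
      using True by (simp_all add: evT_lamT degenerate_def K.aug_def)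
    then have e: "evT \<alpha> (deltaT p lam u) = 0" for u
      by (simp only: deltaT_def evT_simps(1,2)) simp
    have poly: "poly (vact \<alpha> u f) \<beta> = evT \<alpha> u * poly f \<beta>" for u f
      by (induction f arbitrary: u) (simp_all add: rho_pCons e algebra_simps)
    have "\<exists>c. \<forall>f. poly (hact \<alpha> h f) \<beta> = c * poly f \<beta>"
      using h
    proof (induction rule: H_induct)
      case (add a b)
      then show ?case by (auto simp: hact_add_left) (metis distrib_right)
    next
      case (mult a b)
      then show ?case by (auto simp: hact_mult_left)
    qed (auto simp: hact_letter poly)
    then show ?thesis using f True by (auto simp: q_poly_def simp flip: poly_eq_0_iff_dvd)
  next
    case False
    from f obtain f' where f': "f = q_poly \<alpha> \<beta> * f'" by blast
    let ?z = "Z_elem \<alpha> \<ominus>\<^bsub>HH\<^esub> Hscalar p lam \<beta>"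
    have z: "?z \<in> carrier HH" by simp
    have "h \<otimes>\<^bsub>HH\<^esub> ?z = ?z \<otimes>\<^bsub>HH\<^esub> h"
      using h False by (simp add: Z_elem_def a_minus_def H.l_distr H.r_distr H.l_minus H.r_minus
          HY_central Hscalar_central)
    then have "hact \<alpha> h (hact \<alpha> ?z f') = hact \<alpha> ?z (hact \<alpha> h f')"
      using h z by (metis hact_mult_left)
    then show ?thesis by (simp add: f' hact_Z_elem_minus)
  qed
  moreover have "h \<in> carrier HH \<Longrightarrow> hact \<alpha> h 0 = 0" for h
    using hact_smult[of h \<alpha> 0 0] by simp
  ultimately show ?thesis by (auto simp: stable_def)
qed

text \<open>Applying \<open>g - 1\<close> (if \<open>\<alpha> \<noteq> 0\<close>) or \<open>x - \<alpha>\<close> (if \<open>\<lambda>\<close> has nonzero augmentation) lowers a degree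
  \<open>n < p\<close> by exactly one, with leading coefficient multiplied by \<open>n \<alpha>\<close> or \<open>n \<epsilon>(\<lambda>)\<close>.\<close>

lemma stable_low_degree:
  assumes nondeg: "\<not> degenerate \<alpha>" and W: "stable \<alpha> W"
    and f: "f \<in> W" "f \<noteq> 0" "degree f < p"
  shows "W = UNIV"
  using f
proof (induction "degree f" arbitrary: f)
  case 0
  then obtain c where c: "f = [:c:]" by (metis degree_eq_zeroE)
  then have "[:inverse c:] * f = 1" using 0 by (simp flip: one_pCons)
  then show ?case using stable_ideal[OF W 0(2), of "[:inverse c:]"] stable_UNIV[OF W] by simp
next
  case (Suc n)
  obtain u where u: "evT \<alpha> (deltaT p lam u) \<noteq> 0"
  proof (cases "\<alpha> = 0")
    case True
    then have "evT \<alpha> (deltaT p lam [:[:0, 1:]:]) \<noteq> 0"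
      using nondeg by (simp add: deltaT_x evT_lamT degenerate_def K.aug_def)
    then show ?thesis by (rule that)
  next
    case False
    then have "evT \<alpha> (deltaT p lam [:0, 1:]) \<noteq> 0" by (simp add: deltaT_T)
    then show ?thesis by (rule that)
  qed
  define h where "h = vact \<alpha> u f - Polynomial.smult (evT \<alpha> u) f"
  have "vact \<alpha> u f \<in> W" using W Suc.prems(1) HR.\<phi>_closed unfolding stable_def by (metis hact_Phi)
  moreover have "Polynomial.smult (evT \<alpha> u) f \<in> W"
    using stable_ideal[OF W Suc.prems(1), of "[:evT \<alpha> u:]"] by simp
  ultimately have "h \<in> W" unfolding h_def by (rule stable_diff[OF W])
  note act_top = verma.act_top[where \<alpha> = \<alpha> and p = p and lam = lam and u = u,
      OF eq_imp_le[OF Suc.hyps(2)[symmetric]]]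
  have top: "coeff (vact \<alpha> u f) i = 0" if "i > Suc n" for i
    using act_top that by blast
  have top1: "coeff (vact \<alpha> u f) (Suc n) = evT \<alpha> u * coeff f (Suc n)"
    using act_top by blast
  have top2: "coeff (vact \<alpha> u f) n =
      evT \<alpha> u * coeff f n + of_nat (Suc n) * evT \<alpha> (deltaT p lam u) * coeff f (Suc n)"
    using act_top by blast
  have "degree h \<le> n"
  proof (rule degree_le, intro allI impI)
    fix i assume "n < i"
    then consider "i = Suc n" | "i > Suc n" by linarith
    then show "coeff h i = 0"
      using Suc.hyps(2)[symmetric] by cases (simp_all add: h_def top top1 coeff_eq_0)
  qed
  \<comment> \<open>\<open>Suc n\<close> is the degree of \<open>f\<close>, hence below
    \<open>p\<close> and invertible in \<open>k\<close>.\<close>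
  moreover have "\<not> CHAR('k) dvd Suc n"
    using Suc.prems(3) Suc.hyps(2) char_p by (auto dest: dvd_imp_le)
  then have "of_nat (Suc n) \<noteq> (0 :: 'k)"
    by (simp only: of_nat_eq_0_iff_char_dvd not_False_eq_True)
  then have cn: "coeff h n \<noteq> 0"
    using u Suc.prems(2) leading_coeff_neq_0[of f]
    by (simp add: h_def top2 Suc.hyps(2)[symmetric] del: of_nat_Suc leading_coeff_neq_0 leading_coeff_0_iff)
  ultimately have "degree h = n" by (simp add: le_antisym le_degree)
  moreover have "h \<noteq> 0" using cn by auto
  ultimately show ?case using Suc.hyps(1)[of h] \<open>h \<in> W\<close> Suc.hyps(2) Suc.prems(3) by simp
qed

text \<open>A nonzero remainder modulo \<open>q_poly\<close> forces everything: in the degenerate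
  case it is a constant and hence a unit, otherwise its degree is below \<open>p\<close> and
  \<open>stable_low_degree\<close> applies.\<close>

lemma stable_maximal:
  assumes W: "stable \<alpha> W" and sub: "{f. q_poly \<alpha> \<beta> dvd f} \<subseteq> W"
  shows "W = {f. q_poly \<alpha> \<beta> dvd f} \<or> W = UNIV"
proof (rule disjCI)
  assume "W \<noteq> UNIV"
  have "q_poly \<alpha> \<beta> dvd f" if f: "f \<in> W" for f
  proof (rule ccontr)
    assume "\<not> ?thesis"
    then have r0: "f mod q_poly \<alpha> \<beta> \<noteq> 0" by (simp add: dvd_eq_mod_eq_0)
    have "f - q_poly \<alpha> \<beta> * (f div q_poly \<alpha> \<beta>) \<in> W"
      using sub f by (intro stable_diff[OF W]) auto
    then have r: "f mod q_poly \<alpha> \<beta> \<in> W" by (simp add: minus_mult_div_eq_mod)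
    have deg: "degree (f mod q_poly \<alpha> \<beta>) < degree (q_poly \<alpha> \<beta>)"
      using degree_mod_less[OF q_poly_nonzero, of f \<alpha> \<beta>] r0 by simp
    have "W = UNIV"
    proof (cases "degenerate \<alpha>")
      case True
      with deg have "degree (f mod q_poly \<alpha> \<beta>) = 0" by (simp add: degree_q_poly)
      then obtain c where c: "f mod q_poly \<alpha> \<beta> = [:c:]" by (metis degree_eq_zeroE)
      then have "[:inverse c:] * (f mod q_poly \<alpha> \<beta>) = 1" using r0 by (simp flip: one_pCons)
      then show ?thesis using stable_ideal[OF W r, of "[:inverse c:]"] stable_UNIV[OF W] by simp
    next
      case False
      then show ?thesis using stable_low_degree[OF False W r r0] deg by (simp add: degree_q_poly)
    qed
    then show False using \<open>W \<noteq> UNIV\<close> by blast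
  qed
  then show "W = {f. q_poly \<alpha> \<beta> dvd f}" using sub by blast
qed

end

section \<open>Left modules\<close>

context left_module
begin

lemma lsmult_zero_right: "a \<in> carrier R \<Longrightarrow> a \<odot>\<^bsub>M\<^esub> \<zero>\<^bsub>M\<^esub> = \<zero>\<^bsub>M\<^esub>"
  using lsmult_r_distr[of a "\<zero>\<^bsub>M\<^esub>" "\<zero>\<^bsub>M\<^esub>"] lsmult_closed[of a "\<zero>\<^bsub>M\<^esub>"] M.add.l_cancel_one' M.zero_closed
  by (metis M.l_zero)

lemma lsmult_zero_left: "m \<in> carrier M \<Longrightarrow> \<zero> \<odot>\<^bsub>M\<^esub> m = \<zero>\<^bsub>M\<^esub>"
  using lsmult_l_distr[of \<zero> \<zero> m] lsmult_closed[of \<zero> m] M.add.l_cancel_one' R.zero_closed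
  by (metis R.l_zero)

lemma lsmult_minus_left: "a \<in> carrier R \<Longrightarrow> m \<in> carrier M \<Longrightarrow> (\<ominus> a) \<odot>\<^bsub>M\<^esub> m = \<ominus>\<^bsub>M\<^esub> (a \<odot>\<^bsub>M\<^esub> m)"
  using lsmult_l_distr[of "\<ominus> a" a m] lsmult_zero_left[of m]
  by (metis M.minus_equality R.a_inv_closed R.l_neg lsmult_closed)

lemma lsmult_minus_right: "a \<in> carrier R \<Longrightarrow> m \<in> carrier M \<Longrightarrow> a \<odot>\<^bsub>M\<^esub> (\<ominus>\<^bsub>M\<^esub> m) = \<ominus>\<^bsub>M\<^esub> (a \<odot>\<^bsub>M\<^esub> m)"
  using lsmult_r_distr[of a "\<ominus>\<^bsub>M\<^esub> m" m] lsmult_zero_right[of a]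
  by (metis M.minus_equality M.a_inv_closed M.l_neg lsmult_closed)

lemma lsmult_diff_left: "a \<in> carrier R \<Longrightarrow> b \<in> carrier R \<Longrightarrow> m \<in> carrier M \<Longrightarrow>
    (a \<ominus> b) \<odot>\<^bsub>M\<^esub> m = a \<odot>\<^bsub>M\<^esub> m \<ominus>\<^bsub>M\<^esub> b \<odot>\<^bsub>M\<^esub> m"
  by (simp add: R.minus_eq M.minus_eq lsmult_l_distr lsmult_minus_left)

text \<open>Closure under negation comes from scalar multiplication by
  \<open>\<ominus> \<one>\<close>.\<close>

lemma submoduleI:
  assumes "N \<subseteq> carrier M" "\<zero>\<^bsub>M\<^esub> \<in> N" "\<And>m n. m \<in> N \<Longrightarrow> n \<in> N \<Longrightarrow> m \<oplus>\<^bsub>M\<^esub> n \<in> N"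
    and smult: "\<And>a m. a \<in> carrier R \<Longrightarrow> m \<in> N \<Longrightarrow> a \<odot>\<^bsub>M\<^esub> m \<in> N"
  shows "Module.submodule N R M"
proof -
  have "\<ominus>\<^bsub>M\<^esub> m \<in> N" if "m \<in> N" for m
    using smult[of "\<ominus> \<one>" m] that assms(1) by (simp add: lsmult_minus_left lsmult_one subset_iff)
  then have "subgroup N (add_monoid M)"
    using assms by (intro M.add.subgroupI) (auto simp: a_inv_def)
  then show ?thesis
    using smult by (simp add: Module.submodule_def submodule_axioms_def)
qed

lemma submoduleD:
  assumes "Module.submodule N R M"
  shows "N \<subseteq> carrier M" "\<zero>\<^bsub>M\<^esub> \<in> N" "\<And>m n. m \<in> N \<Longrightarrow> n \<in> N \<Longrightarrow> m \<oplus>\<^bsub>M\<^esub> n \<in> N"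
    "\<And>a m. a \<in> carrier R \<Longrightarrow> m \<in> N \<Longrightarrow> a \<odot>\<^bsub>M\<^esub> m \<in> N"
proof -
  interpret Module.submodule N R M by fact
  show "N \<subseteq> carrier M" "\<zero>\<^bsub>M\<^esub> \<in> N" "\<And>m n. m \<in> N \<Longrightarrow> n \<in> N \<Longrightarrow> m \<oplus>\<^bsub>M\<^esub> n \<in> N"
    "\<And>a m. a \<in> carrier R \<Longrightarrow> m \<in> N \<Longrightarrow> a \<odot>\<^bsub>M\<^esub> m \<in> N"
    using subset one_closed m_closed smult_closed by auto
qed

lemma carrier_submodule: "Module.submodule (carrier M) R M"
  by (rule submoduleI) (auto simp: lsmult_closed)

lemma generated_submodule:
  assumes "U \<subseteq> carrier M"
  shows "Module.submodule (generated_submodule R M U) R M" "U \<subseteq> generated_submodule R M U"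
    "\<And>N. Module.submodule N R M \<Longrightarrow> U \<subseteq> N \<Longrightarrow> generated_submodule R M U \<subseteq> N"
proof -
  show "Module.submodule (generated_submodule R M U) R M"
  proof (rule submoduleI)
    show "generated_submodule R M U \<subseteq> carrier M"
      using carrier_submodule assms by (auto simp: generated_submodule_def)
  qed (auto simp: generated_submodule_def intro: submoduleD(2-4))
qed (auto simp: generated_submodule_def)

lemma submodule_coset_eq:
  assumes N: "Module.submodule N R M" and "m \<in> carrier M" "n \<in> carrier M"
  shows "N +>\<^bsub>M\<^esub> m = N +>\<^bsub>M\<^esub> n \<longleftrightarrow> m \<ominus>\<^bsub>M\<^esub> n \<in> N"
proof -
  have "additive_subgroup N M"
    using N by (simp add: Module.submodule_def additive_subgroup_def)
  then interpret N: abelian_subgroup N M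
    using M.abelian_group_axioms by (rule abelian_subgroupI3)
  show ?thesis
    using assms by (metis N.a_rcos_module_minus N.a_repr_independence' N.a_rcos_self R.ring_axioms M.minus_eq N.a_rcos_module N.a_repr_independenceD)
qed

lemma
  assumes N: "Module.submodule N R M"
  shows quotient_carrier: "carrier (quotient_module M N) = (\<lambda>m. N +>\<^bsub>M\<^esub> m) ` carrier M"
    and quotient_zero: "\<zero>\<^bsub>quotient_module M N\<^esub> = N +>\<^bsub>M\<^esub> \<zero>\<^bsub>M\<^esub>"
    and quotient_add: "\<And>m n. m \<in> carrier M \<Longrightarrow> n \<in> carrier M \<Longrightarrow>
      (N +>\<^bsub>M\<^esub> m) \<oplus>\<^bsub>quotient_module M N\<^esub> (N +>\<^bsub>M\<^esub> n) = N +>\<^bsub>M\<^esub> (m \<oplus>\<^bsub>M\<^esub> n)"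
    and quotient_smult: "\<And>a m. a \<in> carrier R \<Longrightarrow> m \<in> carrier M \<Longrightarrow>
      a \<odot>\<^bsub>quotient_module M N\<^esub> (N +>\<^bsub>M\<^esub> m) = N +>\<^bsub>M\<^esub> (a \<odot>\<^bsub>M\<^esub> m)"
    and left_module_quotient: "left_module R (quotient_module M N)"
proof -
  let ?Q = "quotient_module M N"
  have "additive_subgroup N M"
    using N by (simp add: Module.submodule_def additive_subgroup_def)
  then interpret N: abelian_subgroup N M
    using M.abelian_group_axioms by (rule abelian_subgroupI3)
  show carrier: "carrier ?Q = (\<lambda>m. N +>\<^bsub>M\<^esub> m) ` carrier M"
    by (auto simp: quotient_module_def A_RCOSETS_def')
  show zero: "\<zero>\<^bsub>?Q\<^esub> = N +>\<^bsub>M\<^esub> \<zero>\<^bsub>M\<^esub>"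
    using submoduleD(1)[OF N] by (simp add: quotient_module_def)
  show add: "(N +>\<^bsub>M\<^esub> m) \<oplus>\<^bsub>?Q\<^esub> (N +>\<^bsub>M\<^esub> n) = N +>\<^bsub>M\<^esub> (m \<oplus>\<^bsub>M\<^esub> n)"
    if "m \<in> carrier M" "n \<in> carrier M" for m n
    using that by (simp add: quotient_module_def N.a_rcos_sum)
  show smult: "a \<odot>\<^bsub>?Q\<^esub> (N +>\<^bsub>M\<^esub> m) = N +>\<^bsub>M\<^esub> (a \<odot>\<^bsub>M\<^esub> m)"
    if a: "a \<in> carrier R" and m: "m \<in> carrier M" for a m
  proof -
    have "N +>\<^bsub>M\<^esub> (a \<odot>\<^bsub>M\<^esub> u) = N +>\<^bsub>M\<^esub> (a \<odot>\<^bsub>M\<^esub> m)" if u: "u \<in> N +>\<^bsub>M\<^esub> m" for u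
    proof -
      have uM: "u \<in> carrier M" using u m N.a_elemrcos_carrier by blast
      then have "u \<ominus>\<^bsub>M\<^esub> m \<in> N" using u m N.a_rcos_module by (simp add: M.minus_eq)
      then have "a \<odot>\<^bsub>M\<^esub> (u \<ominus>\<^bsub>M\<^esub> m) \<in> N" using submoduleD(4)[OF N a] by simp
      then have "a \<odot>\<^bsub>M\<^esub> u \<ominus>\<^bsub>M\<^esub> a \<odot>\<^bsub>M\<^esub> m \<in> N"
        using a m uM by (simp add: M.minus_eq lsmult_r_distr lsmult_minus_right)
      then show ?thesis using a m uM by (simp add: submodule_coset_eq[OF N] lsmult_closed)
    qed
    then have "(\<Union>u \<in> N +>\<^bsub>M\<^esub> m. N +>\<^bsub>M\<^esub> (a \<odot>\<^bsub>M\<^esub> u)) = N +>\<^bsub>M\<^esub> (a \<odot>\<^bsub>M\<^esub> m)"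
      by (intro UN_constant_eq[OF N.a_rcos_self[OF m]] ballI)
    then show ?thesis by (simp add: quotient_module_def)
  qed
  have "abelian_group ?Q"
  proof (rule abelian_groupI)
    fix U assume "U \<in> carrier ?Q"
    then obtain m where "m \<in> carrier M" "U = N +>\<^bsub>M\<^esub> m" by (auto simp: carrier)
    then show "\<exists>V\<in>carrier ?Q. V \<oplus>\<^bsub>?Q\<^esub> U = \<zero>\<^bsub>?Q\<^esub>"
      by (intro bexI[of _ "N +>\<^bsub>M\<^esub> (\<ominus>\<^bsub>M\<^esub> m)"]) (auto simp: carrier add zero M.l_neg simp del: M.a_coset_add_zero)
  qed (auto simp: carrier add zero M.a_ac simp del: M.a_coset_add_zero)
  then interpret Q: abelian_group ?Q .
  show "left_module R ?Q"
  proof (unfold_locales, goal_cases)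
    case (1 a U)
    then show ?case by (auto simp: carrier smult lsmult_closed)
  next
    case (2 a b U)
    then show ?case by (auto simp: carrier smult add lsmult_closed lsmult_l_distr)
  next
    case (3 a U V)
    then show ?case by (auto simp: carrier smult add lsmult_closed lsmult_r_distr)
  next
    case (4 a b U)
    then show ?case by (auto simp: carrier smult lsmult_closed lsmult_assoc)
  next
    case (5 U)
    then show ?case by (auto simp: carrier smult lsmult_one)
  qed
qed

end

lemma (in ring) left_module_regular: "left_module R (regular_module R)"
proof -
  have "abelian_group (regular_module R)"
    by (rule abelian_groupI) (auto simp: regular_module_def a_ac intro: l_neg)
  then interpret Q: abelian_group "regular_module R" .
  show ?thesis
    by unfold_locales (auto simp: regular_module_def l_distr r_distr m_assoc)
qed

section \<open>Modules generated by a joint eigenvector of \<open>x\<close> and \<open>g\<close>\<close>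

locale H_module = heisenberg_setting p lam + Mod: left_module "Halg p lam" M
  for p :: nat and lam :: "nat \<Rightarrow> 'k::alg_closed_field" and M :: "('k H_elem, 'm) module" (structure)

locale H_eigen = H_module p lam M
  for p :: nat and lam :: "nat \<Rightarrow> 'k::alg_closed_field" and M :: "('k H_elem, 'm) module" (structure) +
  fixes m :: 'm and \<alpha> :: 'k
  assumes m_carrier [simp]: "m \<in> carrier M"
    and x_m: "Hx p lam \<odot> m = Hscalar p lam \<alpha> \<odot> m" and g_m: "Hg p lam \<odot> m = m"
begin

text \<open>The homomorphism from the Verma module \<open>\<Delta>\<^sub>\<alpha>\<close> (with underlying space \<open>k[y]\<close>) sending the
  generator to \<open>m\<close>.\<close>

definition theta :: "'k poly \<Rightarrow> 'm" where
  "theta f = HS.ev (Hy p lam) f \<odot> m"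

lemma theta_closed [simp]: "theta f \<in> carrier M"
  by (simp add: theta_def Mod.lsmult_closed)

lemma theta_pCons: "theta (pCons a f) = Hscalar p lam a \<odot> m \<oplus> Hy p lam \<odot> theta f"
  by (simp add: theta_def HS.ev_pCons Mod.lsmult_l_distr Mod.lsmult_assoc)

lemma theta_0: "theta 0 = \<zero>"
  by (simp add: theta_def Mod.lsmult_zero_left)

lemma theta_1: "theta 1 = m"
  by (simp add: theta_def one_pCons HS.ev_const HS.\<phi>_one Mod.lsmult_one)

lemma theta_add: "theta (f + h) = theta f \<oplus> theta h"
  by (simp add: theta_def HS.ev_add Mod.lsmult_l_distr)

lemma theta_smult: "theta (Polynomial.smult c f) = Hscalar p lam c \<odot> theta f"
  by (simp add: theta_def HS.ev_smult[OF Hy_closed Hscalar_central[OF Hy_closed]] Mod.lsmult_assoc)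

lemma theta_diff: "theta (f - h) = theta f \<ominus> theta h"
proof -
  have "theta (f - h) \<oplus> theta h = theta f"
    by (simp flip: theta_add)
  then show ?thesis
    by (metis Mod.M.add.inv_solve_right Mod.M.minus_eq theta_closed)
qed

lemma Phi_m: "Phi u \<odot> m = Hscalar p lam (evT \<alpha> u) \<odot> m"
proof (induction u rule: Phi_induct)
  case (step a b c)
  have "(Phi b \<otimes>\<^bsub>HH\<^esub> Phi c) \<odot> m = Phi b \<odot> (Hscalar p lam (evT \<alpha> c) \<odot> m)"
    by (simp add: Mod.lsmult_assoc step)
  also have "\<dots> = Hscalar p lam (evT \<alpha> c) \<odot> (Phi b \<odot> m)"
    by (simp add: Mod.lsmult_assoc[symmetric] Hscalar_central)
  also have "\<dots> = Hscalar p lam (evT \<alpha> b * evT \<alpha> c) \<odot> m"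
    by (simp add: step Mod.lsmult_assoc[symmetric] HS.\<phi>_mult[symmetric] mult.commute)
  finally show ?case
    by (simp add: HR.\<phi>_add HR.\<phi>_mult HS.\<phi>_add Mod.lsmult_l_distr step)
qed (simp_all add: Phi_simps x_m g_m HS.\<phi>_one Mod.lsmult_one)

text \<open>The recursion of \<open>rho\<close> mirrors the Ore relation, and \<open>Phi_m\<close>
  supplies the evaluation at the right end.\<close>

lemma Phi_theta: "Phi u \<odot> theta f = theta (vact \<alpha> u f)"
proof (induction f arbitrary: u)
  case 0
  show ?case by (simp add: theta_0 Mod.lsmult_zero_right)
next
  case (pCons a f)
  have 1: "Phi u \<odot> (Hscalar p lam a \<odot> m) = Hscalar p lam (evT \<alpha> u * a) \<odot> m"
  proof -
    have "Phi u \<odot> (Hscalar p lam a \<odot> m) = Hscalar p lam a \<odot> (Phi u \<odot> m)"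
      by (simp add: Mod.lsmult_assoc[symmetric] Hscalar_central)
    then show ?thesis
      by (simp add: Phi_m Mod.lsmult_assoc[symmetric] HS.\<phi>_mult[symmetric] mult.commute)
  qed
  have "Phi u \<odot> (Hy p lam \<odot> theta f) =
      (Hy p lam \<otimes>\<^bsub>HH\<^esub> Phi u \<oplus>\<^bsub>HH\<^esub> Phi (deltaT p lam u)) \<odot> theta f"
    by (simp add: Mod.lsmult_assoc[symmetric] Phi_Hy)
  also have "\<dots> = Hy p lam \<odot> theta (vact \<alpha> u f) \<oplus> theta (vact \<alpha> (deltaT p lam u) f)"
    by (simp add: Mod.lsmult_assoc Mod.lsmult_l_distr pCons.IH)
  finally show ?case
    by (simp add: theta_pCons rho_pCons theta_add Mod.lsmult_r_distr Mod.lsmult_closed 1 Mod.M.a_assoc)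
qed

lemma theta_hact: "h \<in> carrier HH \<Longrightarrow> theta (hact \<alpha> h f) = h \<odot> theta f"
proof (induction arbitrary: f rule: H_induct)
  case y
  show ?case by (simp add: hact_letter theta_pCons Mod.lsmult_zero_left Mod.lsmult_closed)
next
  case x
  show ?case using Phi_theta[of "[:[:0, 1:]:]" f] by (simp add: hact_letter Phi_simps)
next
  case g
  show ?case using Phi_theta[of "[:0, 1:]" f] by (simp only: hact_letter Phi_simps)
qed (simp_all add: hact_letter theta_smult hact_add_left theta_add Mod.lsmult_l_distr
    hact_mult_left Mod.lsmult_assoc)

lemma stable_preimage: "Module.submodule N HH M \<Longrightarrow> stable \<alpha> {f. theta f \<in> N}"
  using Mod.submoduleD[of N] by (auto simp: stable_def theta_0 theta_add theta_hact)

lemma submodule_image: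
  assumes "stable \<alpha> W"
  shows "Module.submodule (theta ` W) HH M"
proof (rule Mod.submoduleI)
  show "\<zero> \<in> theta ` W" using assms theta_0 by (force simp: stable_def)
  show "u \<oplus> v \<in> theta ` W" if "u \<in> theta ` W" "v \<in> theta ` W" for u v
    using that assms by (force simp: stable_def theta_add[symmetric])
  show "a \<odot> u \<in> theta ` W" if "a \<in> carrier HH" "u \<in> theta ` W" for a u
    using that assms by (force simp: stable_def theta_hact[symmetric])
qed auto

lemma submodule_zero: "Module.submodule {\<zero>} HH M"
  by (rule Mod.submoduleI) (auto simp: Mod.lsmult_zero_right)

end

text \<open>Says that \<open>M\<close> is \<open>k[y]/(q_poly \<alpha> \<beta>)\<close> with the
  Verma action: the common form of the constructed modules and of arbitrary simple ones.\<close>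

locale H_eigen_quotient = H_eigen p lam M m \<alpha>
  for p :: nat and lam :: "nat \<Rightarrow> 'k::alg_closed_field" and M :: "('k H_elem, 'm) module" (structure) and m \<alpha> +
  fixes \<beta> :: 'k
  assumes theta_surj: "range theta = carrier M"
    and theta_kernel: "theta f = \<zero> \<longleftrightarrow> q_poly \<alpha> \<beta> dvd f"
begin

lemma m_nonzero: "m \<noteq> \<zero>"
proof
  assume "m = \<zero>"
  then have "theta 1 = \<zero>" by (rule trans[OF theta_1])
  then have "q_poly \<alpha> \<beta> dvd 1" by (simp only: theta_kernel)
  then show False
    using degree_q_poly[of \<alpha> \<beta>] p_gt_1 by (auto simp: is_unit_poly_iff split: if_splits)
qed

text \<open>Submodules pull back along \<open>theta\<close> to stable sets that contain the
  multiples of \<open>q_poly\<close>; only the two extremes are possible.\<close>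

lemma simple: "simple_left_module HH M"
  unfolding simple_left_module_def
proof (intro conjI allI impI)
  show "left_module HH M" by (rule Mod.left_module_axioms)
  show "carrier M \<noteq> {\<zero>}" using m_carrier m_nonzero by blast
  fix N assume N: "Module.submodule N HH M"
  note st = stable_preimage[OF N]
  have sub: "{f. q_poly \<alpha> \<beta> dvd f} \<subseteq> {f. theta f \<in> N}"
    using theta_kernel[THEN iffD2] Mod.submoduleD(2)[OF N] by auto
  have eq: "N = theta ` {f. theta f \<in> N}"
  proof -
    have "n \<in> theta ` {f. theta f \<in> N}" if "n \<in> N" for n
    proof -
      have "n \<in> range theta" using that Mod.submoduleD(1)[OF N] theta_surj by auto
      then show ?thesis using that by auto
    qed
    then show ?thesis by auto
  qed
  from stable_maximal[OF st sub] show "N = {\<zero>} \<or> N = carrier M"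
  proof
    assume "{f. theta f \<in> N} = {f. q_poly \<alpha> \<beta> dvd f}"
    then have "N = theta ` {f. theta f = \<zero>}" using eq theta_kernel by auto
    then show ?thesis using theta_0 by auto
  qed (use eq theta_surj in auto)
qed

lemma x_pow_p: "v \<in> carrier M \<Longrightarrow> Hx p lam [^]\<^bsub>HH\<^esub> p \<odot> v = Hscalar p lam (\<alpha> ^ p) \<odot> v"
  unfolding theta_surj[symmetric]
  by (auto simp: theta_hact[symmetric] hact_Hx_pow_p theta_smult)

lemma Z_elem_eigen: "v \<in> carrier M \<Longrightarrow> Z_elem \<alpha> \<odot> v = Hscalar p lam \<beta> \<odot> v"
proof -
  assume "v \<in> carrier M"
  then obtain f where v: "v = theta f" using theta_surj by auto
  have "theta (q_poly \<alpha> \<beta> * f) = \<zero>" by (simp add: theta_kernel)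
  then have "theta ((q_poly \<alpha> \<beta> + [:\<beta>:]) * f) = theta (Polynomial.smult \<beta> f)"
    by (simp add: distrib_right theta_add theta_smult Mod.lsmult_closed)
  then show ?thesis
    by (simp add: v theta_hact[symmetric] hact_Z_elem[of _ _ \<beta>] theta_smult del: mult_pCons_left)
qed

lemma vectorspace_k_space: "vectorspace class_ring (k_space p lam M)"
proof -
  have "abelian_group (k_space p lam M)"
    by (rule abelian_groupI) (auto simp: k_space_def Mod.M.a_ac intro: Mod.M.l_neg)
  then have "module class_ring (k_space p lam M)"
    by (intro Module.moduleI[OF class_cring.cring_axioms])
      (auto simp: k_space_def Mod.lsmult_closed HS.\<phi>_add HS.\<phi>_mult HS.\<phi>_one Mod.lsmult_l_distr
        Mod.lsmult_r_distr Mod.lsmult_assoc Mod.lsmult_one)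
  then show ?thesis by (intro vectorspace.intro class_field)
qed

text \<open>Each element of \<open>M\<close> is represented by exactly one remainder modulo
  \<open>q_poly\<close>, so the coefficient vectors of length \<open>d\<close>, the degree of
  \<open>q_poly\<close>, map linearly and bijectively onto \<open>M\<close>.\<close>

lemma k_dim: "has_k_dim p lam M (if degenerate \<alpha> then 1 else p)"
proof -
  define d where "d = degree (q_poly \<alpha> \<beta>)"
  have d: "d = (if degenerate \<alpha> then 1 else p)" by (simp add: d_def degree_q_poly)
  interpret W: vectorspace class_ring "k_space p lam M" by (rule vectorspace_k_space)
  interpret V: vec_space "TYPE('k)" d .
  define F :: "'k vec \<Rightarrow> 'k poly" where "F v = (\<Sum>i<d. monom (v $ i) i)" for v
  have F_coeff: "coeff (F v) i = (if i < d then v $ i else 0)" for v i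
    by (simp add: F_def coeff_sum)
  have F_deg: "degree (F v) < d" for v
  proof -
    have "degree (F v) \<le> d - 1" by (rule degree_le) (auto simp: F_coeff)
    then show ?thesis using d p_gt_1 by (auto split: if_splits)
  qed
  have hom: "theta \<circ> F \<in> LinearCombinations.module_hom class_ring (module_vec TYPE('k) d) (k_space p lam M)"
  proof -
    have "F (v + w) = F v + F w" if "v \<in> carrier_vec d" "w \<in> carrier_vec d" for v w
      using that by (intro poly_eqI) (simp add: F_coeff)
    moreover have "F (c \<cdot>\<^sub>v v) = Polynomial.smult c (F v)" if "v \<in> carrier_vec d" for c v
      using that by (intro poly_eqI) (simp add: F_coeff)
    ultimately show ?thesis
      by (auto simp: LinearCombinations.module_hom_def k_space_def module_vec_def theta_add theta_smult)
  qed
  interpret L: linear_map class_ring "module_vec TYPE('k) d" "k_space p lam M" "theta \<circ> F"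
    by unfold_locales (rule hom)
  have inj: "inj_on (theta \<circ> F) (carrier (module_vec TYPE('k) d))"
  proof (rule inj_onI)
    fix v w assume vw: "v \<in> carrier (module_vec TYPE('k) d)" "w \<in> carrier (module_vec TYPE('k) d)"
      and eq: "(theta \<circ> F) v = (theta \<circ> F) w"
    have "theta (F v - F w) = \<zero>" using eq by (simp add: theta_diff Mod.M.minus_eq Mod.M.r_neg)
    then have "q_poly \<alpha> \<beta> dvd F v - F w" by (simp add: theta_kernel)
    moreover have "F v - F w = 0 \<or> degree (F v - F w) < d"
      using F_deg[of v] F_deg[of w] by (auto intro: degree_diff_less)
    ultimately have "F v - F w = 0" using dvd_imp_degree_le[of "q_poly \<alpha> \<beta>"] d_def by fastforce
    then have "F v = F w" by simp
    then have "v $ i = w $ i" if "i < d" for i using that F_coeff by metis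
    then show "v = w" using vw by (intro eq_vecI) (auto simp: module_vec_def)
  qed
  have surj: "(theta \<circ> F) ` carrier (module_vec TYPE('k) d) = carrier (k_space p lam M)"
  proof -
    have "theta f \<in> (theta \<circ> F) ` carrier_vec d" for f
    proof -
      let ?r = "f mod q_poly \<alpha> \<beta>"
      have deg: "degree ?r < d \<or> ?r = 0" using degree_mod_less[OF q_poly_nonzero] d_def by blast
      have "F (vec d (coeff ?r)) = ?r"
        using deg by (intro poly_eqI) (auto simp: F_coeff coeff_eq_0)
      moreover have "theta f = theta ?r"
      proof -
        have "theta (q_poly \<alpha> \<beta> * (f div q_poly \<alpha> \<beta>)) = \<zero>" by (simp add: theta_kernel)
        then have "theta (q_poly \<alpha> \<beta> * (f div q_poly \<alpha> \<beta>) + ?r) = theta ?r"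
          by (simp only: theta_add Mod.M.l_zero theta_closed)
        then show ?thesis by (simp only: mult_div_mod_eq)
      qed
      ultimately show ?thesis by (force intro!: image_eqI[of _ _ "vec d (coeff ?r)"])
    qed
    then have "range theta \<subseteq> (theta \<circ> F) ` carrier_vec d" by blast
    then have "carrier M \<subseteq> (theta \<circ> F) ` carrier_vec d" by (simp only: theta_surj)
    then show ?thesis by (auto simp: k_space_def module_vec_def)
  qed
  have "W.fin_dim" by (rule L.surj_fin_dim[OF V.fin_dim surj])
  moreover have "W.dim = d" using L.dim_eq[OF V.fin_dim inj surj] V.dim_is_n by simp
  ultimately show ?thesis using d vectorspace_k_space by (simp add: has_k_dim_def)
qed

end

section \<open>The modules \<open>S\<^sub>\<alpha>\<^sub>,\<^sub>\<beta>\<close>\<close>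

context heisenberg_setting
begin

lemma vact_1: "vact \<alpha> u 1 = [:evT \<alpha> u:]"
  by (simp add: one_pCons rho_pCons)

section \<open>The Verma module identified with k[y]\<close>

lemma verma_ideal_eq:
  "verma_ideal p lam \<alpha> = {a \<otimes>\<^bsub>HH\<^esub> (Hx p lam \<ominus>\<^bsub>HH\<^esub> Hscalar p lam \<alpha>) \<oplus>\<^bsub>HH\<^esub> b \<otimes>\<^bsub>HH\<^esub> (Hg p lam \<ominus>\<^bsub>HH\<^esub> \<one>\<^bsub>HH\<^esub>) | a b.
     a \<in> carrier HH \<and> b \<in> carrier HH}"
  unfolding verma_ideal_def set_add_def' r_coset_def by auto

text \<open>Bounds the Verma module from below: as \<open>f(y)\<close> sends \<open>1\<close> to
  \<open>f\<close>, no nonzero \<open>f(y)\<close> lies in the ideal.\<close>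

lemma verma_ideal_kernel:
  assumes "h \<in> verma_ideal p lam \<alpha>"
  shows "hact \<alpha> h 1 = 0"
proof -
  have 0: "hact \<alpha> a 0 = 0" if "a \<in> carrier HH" for a
    using hact_smult[OF that, of \<alpha> 0 0] by simp
  have "hact \<alpha> (Hx p lam \<ominus>\<^bsub>HH\<^esub> Hscalar p lam \<alpha>) 1 = 0" "hact \<alpha> (Hg p lam \<ominus>\<^bsub>HH\<^esub> \<one>\<^bsub>HH\<^esub>) 1 = 0"
    by (simp_all add: hact_minus_left hact_letter hact_one vact_1)
  then show ?thesis
    using assms by (auto simp: verma_ideal_eq hact_add_left hact_mult_left 0)
qed

sublocale Reg: left_module HH "regular_module HH"
  by (rule H.left_module_regular)

lemma verma_ideal_submodule: "Module.submodule (verma_ideal p lam \<alpha>) HH (regular_module HH)"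
proof (rule Reg.submoduleI)
  let ?a = "Hx p lam \<ominus>\<^bsub>HH\<^esub> Hscalar p lam \<alpha>" and ?b = "Hg p lam \<ominus>\<^bsub>HH\<^esub> \<one>\<^bsub>HH\<^esub>"
  have ab: "?a \<in> carrier HH" "?b \<in> carrier HH" by simp_all
  show "verma_ideal p lam \<alpha> \<subseteq> carrier (regular_module HH)"
    by (auto simp: verma_ideal_eq regular_module_def)
  have "\<zero>\<^bsub>HH\<^esub> = \<zero>\<^bsub>HH\<^esub> \<otimes>\<^bsub>HH\<^esub> ?a \<oplus>\<^bsub>HH\<^esub> \<zero>\<^bsub>HH\<^esub> \<otimes>\<^bsub>HH\<^esub> ?b"
    by simp
  then show "\<zero>\<^bsub>regular_module HH\<^esub> \<in> verma_ideal p lam \<alpha>"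
    unfolding verma_ideal_eq
    by (intro CollectI exI[of _ "\<zero>\<^bsub>HH\<^esub>"]) (simp add: regular_module_def)
  show "u \<oplus>\<^bsub>regular_module HH\<^esub> v \<in> verma_ideal p lam \<alpha>"
    if "u \<in> verma_ideal p lam \<alpha>" "v \<in> verma_ideal p lam \<alpha>" for u v
  proof -
    from that obtain s t s' t' where *: "s \<in> carrier HH" "t \<in> carrier HH" "s' \<in> carrier HH" "t' \<in> carrier HH"
      "u = s \<otimes>\<^bsub>HH\<^esub> ?a \<oplus>\<^bsub>HH\<^esub> t \<otimes>\<^bsub>HH\<^esub> ?b" "v = s' \<otimes>\<^bsub>HH\<^esub> ?a \<oplus>\<^bsub>HH\<^esub> t' \<otimes>\<^bsub>HH\<^esub> ?b"
      unfolding verma_ideal_eq by auto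
    then have "u \<oplus>\<^bsub>HH\<^esub> v = (s \<oplus>\<^bsub>HH\<^esub> s') \<otimes>\<^bsub>HH\<^esub> ?a \<oplus>\<^bsub>HH\<^esub> (t \<oplus>\<^bsub>HH\<^esub> t') \<otimes>\<^bsub>HH\<^esub> ?b"
      using ab by (simp only: H.l_distr H.a_ac H.m_closed H.a_closed)
    then show ?thesis
      unfolding verma_ideal_eq using * by (auto simp: regular_module_def)
  qed
  show "c \<odot>\<^bsub>regular_module HH\<^esub> u \<in> verma_ideal p lam \<alpha>"
    if c: "c \<in> carrier HH" and "u \<in> verma_ideal p lam \<alpha>" for c u
  proof -
    from that obtain s t where *: "s \<in> carrier HH" "t \<in> carrier HH"
      "u = s \<otimes>\<^bsub>HH\<^esub> ?a \<oplus>\<^bsub>HH\<^esub> t \<otimes>\<^bsub>HH\<^esub> ?b"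
      unfolding verma_ideal_eq by auto
    then have "c \<otimes>\<^bsub>HH\<^esub> u = (c \<otimes>\<^bsub>HH\<^esub> s) \<otimes>\<^bsub>HH\<^esub> ?a \<oplus>\<^bsub>HH\<^esub> (c \<otimes>\<^bsub>HH\<^esub> t) \<otimes>\<^bsub>HH\<^esub> ?b"
      using ab c by (simp only: H.r_distr H.m_assoc H.m_closed)
    then show ?thesis
      unfolding verma_ideal_eq using * c by (auto simp: regular_module_def)
  qed
qed

lemma verma_class_eq: "verma_class p lam \<alpha> h = verma_ideal p lam \<alpha> +>\<^bsub>regular_module HH\<^esub> h"
  by (simp add: verma_class_def a_r_coset_def' regular_module_def)

lemma H_module_verma: "H_module p lam (verma p lam \<alpha>)"
  unfolding verma_def
  by (intro H_module.intro heisenberg_setting_axioms Reg.left_module_quotient verma_ideal_submodule)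

lemma verma_class_smult:
  "a \<in> carrier HH \<Longrightarrow> h \<in> carrier HH \<Longrightarrow>
    a \<odot>\<^bsub>verma p lam \<alpha>\<^esub> verma_class p lam \<alpha> h = verma_class p lam \<alpha> (a \<otimes>\<^bsub>HH\<^esub> h)"
  unfolding verma_class_eq verma_def
  using Reg.quotient_smult[OF verma_ideal_submodule, of a h] by (simp add: regular_module_def)

lemma verma_class_eq_iff:
  "a \<in> carrier HH \<Longrightarrow> b \<in> carrier HH \<Longrightarrow>
    verma_class p lam \<alpha> a = verma_class p lam \<alpha> b \<longleftrightarrow> a \<ominus>\<^bsub>HH\<^esub> b \<in> verma_ideal p lam \<alpha>"
proof -
  assume *: "a \<in> carrier HH" "b \<in> carrier HH"
  have "\<ominus>\<^bsub>regular_module HH\<^esub> b = \<ominus>\<^bsub>HH\<^esub> b"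
    by (simp add: a_inv_def regular_module_def m_inv_def)
  then have "a \<ominus>\<^bsub>regular_module HH\<^esub> b = a \<ominus>\<^bsub>HH\<^esub> b"
    by (simp add: a_minus_def regular_module_def)
  then show ?thesis
    unfolding verma_class_eq using Reg.submodule_coset_eq[OF verma_ideal_submodule, of a b] *
    by (simp add: regular_module_def)
qed

lemma verma_carrier: "carrier (verma p lam \<alpha>) = verma_class p lam \<alpha> ` carrier HH"
  unfolding verma_def Reg.quotient_carrier[OF verma_ideal_submodule] verma_class_eq
  by (simp add: regular_module_def)

lemma verma_zero: "\<zero>\<^bsub>verma p lam \<alpha>\<^esub> = verma_class p lam \<alpha> \<zero>\<^bsub>HH\<^esub>"
  unfolding verma_def Reg.quotient_zero[OF verma_ideal_submodule] verma_class_eq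
  by (simp add: regular_module_def)

lemma H_eigen_verma: "H_eigen p lam (verma p lam \<alpha>) (verma_class p lam \<alpha> \<one>\<^bsub>HH\<^esub>) \<alpha>"
proof -
  interpret V: H_module p lam "verma p lam \<alpha>" by (rule H_module_verma)
  have "Hx p lam \<ominus>\<^bsub>HH\<^esub> Hscalar p lam \<alpha> = 
      \<one>\<^bsub>HH\<^esub> \<otimes>\<^bsub>HH\<^esub> (Hx p lam \<ominus>\<^bsub>HH\<^esub> Hscalar p lam \<alpha>) \<oplus>\<^bsub>HH\<^esub> \<zero>\<^bsub>HH\<^esub> \<otimes>\<^bsub>HH\<^esub> (Hg p lam \<ominus>\<^bsub>HH\<^esub> \<one>\<^bsub>HH\<^esub>)"
    "Hg p lam \<ominus>\<^bsub>HH\<^esub> \<one>\<^bsub>HH\<^esub> =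
      \<zero>\<^bsub>HH\<^esub> \<otimes>\<^bsub>HH\<^esub> (Hx p lam \<ominus>\<^bsub>HH\<^esub> Hscalar p lam \<alpha>) \<oplus>\<^bsub>HH\<^esub> \<one>\<^bsub>HH\<^esub> \<otimes>\<^bsub>HH\<^esub> (Hg p lam \<ominus>\<^bsub>HH\<^esub> \<one>\<^bsub>HH\<^esub>)"
    by simp_all
  then have "Hx p lam \<ominus>\<^bsub>HH\<^esub> Hscalar p lam \<alpha> \<in> verma_ideal p lam \<alpha>"
    "Hg p lam \<ominus>\<^bsub>HH\<^esub> \<one>\<^bsub>HH\<^esub> \<in> verma_ideal p lam \<alpha>"
    unfolding verma_ideal_eq by (blast intro: H.one_closed H.zero_closed)+
  then show ?thesis
    by unfold_locales (simp_all add: verma_carrier verma_class_smult verma_class_eq_iff)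
qed

section \<open>The quotients of Verma modules: simplicity and distinctness\<close>

lemma Smod_eq: "Smod p lam \<alpha> \<beta> = quotient_module (verma p lam \<alpha>)
    (generated_submodule HH (verma p lam \<alpha>)
      {verma_class p lam \<alpha> (Z_elem \<alpha> \<ominus>\<^bsub>HH\<^esub> Hscalar p lam \<beta>)})"
  by (simp add: Smod_def Let_def Z_elem_def degenerate_def kG_zero_divisor_iff)

text \<open>\<open>V.theta\<close> identifies the Verma module with \<open>k[y]\<close> and sends
  \<open>q_poly\<close> to the generator of the submodule. The multiples of \<open>q_poly\<close>
  are stable, so the submodule is exactly their image.\<close>

lemma H_eigen_quotient_Smod: "\<exists>m. H_eigen_quotient p lam (Smod p lam \<alpha> \<beta>) m \<alpha> \<beta>"
proof -
  let ?V = "verma p lam \<alpha>" and ?z = "Z_elem \<alpha> \<ominus>\<^bsub>HH\<^esub> Hscalar p lam \<beta>" and ?v = "verma_class p lam \<alpha> \<one>\<^bsub>HH\<^esub>"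
  interpret V: H_eigen p lam ?V ?v \<alpha> by (rule H_eigen_verma)
  define N where "N = generated_submodule HH ?V {verma_class p lam \<alpha> ?z}"
  have z: "?z \<in> carrier HH" by simp
  have theta_class: "V.theta (hact \<alpha> h 1) = verma_class p lam \<alpha> h" if "h \<in> carrier HH" for h
    using that by (simp add: V.theta_hact V.theta_1 verma_class_smult)
  have theta_z: "V.theta (q_poly \<alpha> \<beta>) = verma_class p lam \<alpha> ?z"
    using theta_class[OF z] by (simp add: hact_Z_elem_minus)
  have "{verma_class p lam \<alpha> ?z} \<subseteq> carrier ?V" by (simp add: verma_carrier)
  from V.Mod.generated_submodule[OF this]
  have N: "Module.submodule N HH ?V" "verma_class p lam \<alpha> ?z \<in> N"
    and least: "\<And>N'. Module.submodule N' HH ?V \<Longrightarrow> verma_class p lam \<alpha> ?z \<in> N' \<Longrightarrow> N \<subseteq> N'"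
    unfolding N_def by blast+
  have S: "Smod p lam \<alpha> \<beta> = quotient_module ?V N"
    unfolding Smod_eq N_def ..
  \<comment> \<open>If \<open>f(y)\<close> lies in the Verma ideal it annihilates \<open>1\<close>,
    but it also sends \<open>1\<close> to \<open>f\<close>.\<close>
  have inj: "f = 0" if "V.theta f = \<zero>\<^bsub>?V\<^esub>" for f
  proof -
    have "verma_class p lam \<alpha> (HS.ev (Hy p lam) f) = verma_class p lam \<alpha> \<zero>\<^bsub>HH\<^esub>"
      using that theta_class[of "HS.ev (Hy p lam) f"] by (simp add: hact_ev_y verma_zero)
    then have "HS.ev (Hy p lam) f \<ominus>\<^bsub>HH\<^esub> \<zero>\<^bsub>HH\<^esub> \<in> verma_ideal p lam \<alpha>"
      by (simp add: verma_class_eq_iff)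
    from verma_ideal_kernel[OF this] show ?thesis
      by (simp add: a_minus_def hact_ev_y)
  qed
  have mem_N: "V.theta f \<in> N \<longleftrightarrow> q_poly \<alpha> \<beta> dvd f" for f
  proof
    have "N \<subseteq> V.theta ` {f. q_poly \<alpha> \<beta> dvd f}"
      using theta_z by (intro least V.submodule_image stable_q_poly) force
    moreover assume "V.theta f \<in> N"
    ultimately obtain f' where f': "q_poly \<alpha> \<beta> dvd f'" "V.theta f = V.theta f'" by blast
    then have "V.theta (f - f') = \<zero>\<^bsub>?V\<^esub>"
      by (simp add: V.theta_diff V.Mod.M.minus_eq V.Mod.M.r_neg)
    then show "q_poly \<alpha> \<beta> dvd f" using inj f' by fastforce
  next
    assume "q_poly \<alpha> \<beta> dvd f"
    then obtain f' where f': "f = f' * q_poly \<alpha> \<beta>" by (metis dvd_def mult.commute)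
    have "V.theta f = HS.ev (Hy p lam) f' \<odot>\<^bsub>?V\<^esub> V.theta (q_poly \<alpha> \<beta>)"
      by (simp add: f' V.theta_hact[symmetric] hact_ev_y)
    then show "V.theta f \<in> N" using V.Mod.submoduleD(4)[OF N(1)] N(2) theta_z by simp
  qed
  let ?m = "N +>\<^bsub>?V\<^esub> ?v"
  note smult = V.Mod.quotient_smult[OF N(1)] and car = V.Mod.quotient_carrier[OF N(1)]
  interpret Q: H_module p lam "Smod p lam \<alpha> \<beta>"
    unfolding S by (intro H_module.intro heisenberg_setting_axioms V.Mod.left_module_quotient N(1))
  interpret Q: H_eigen p lam "Smod p lam \<alpha> \<beta>" ?m \<alpha>
    by unfold_locales (simp_all add: S car smult V.x_m V.g_m)
  have theta: "Q.theta f = N +>\<^bsub>?V\<^esub> V.theta f" for f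
    unfolding Q.theta_def V.theta_def by (simp add: S smult)
  have "H_eigen_quotient p lam (Smod p lam \<alpha> \<beta>) ?m \<alpha> \<beta>"
  proof
    show "range Q.theta = carrier (Smod p lam \<alpha> \<beta>)"
    proof -
      have "range V.theta = carrier ?V"
      proof
        show "range V.theta \<subseteq> carrier ?V" using V.theta_closed by blast
        show "carrier ?V \<subseteq> range V.theta"
          unfolding verma_carrier by (intro image_subsetI) (metis theta_class rangeI)
      qed
      moreover have "carrier (Smod p lam \<alpha> \<beta>) = (\<lambda>v. N +>\<^bsub>?V\<^esub> v) ` carrier ?V"
        by (simp only: S car)
      moreover have "Q.theta = (\<lambda>v. N +>\<^bsub>?V\<^esub> v) \<circ> V.theta"
        by (rule ext) (simp only: theta o_apply)
      ultimately show ?thesis by (simp only: image_comp[symmetric])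
    qed
    show "Q.theta f = \<zero>\<^bsub>Smod p lam \<alpha> \<beta>\<^esub> \<longleftrightarrow> q_poly \<alpha> \<beta> dvd f" for f
    proof -
      have zero: "\<zero>\<^bsub>Smod p lam \<alpha> \<beta>\<^esub> = N +>\<^bsub>?V\<^esub> \<zero>\<^bsub>?V\<^esub>"
        by (simp only: S V.Mod.quotient_zero[OF N(1)])
      show ?thesis
        unfolding theta zero V.theta_0[symmetric] V.theta_diff[symmetric] mem_N
          V.Mod.submodule_coset_eq[OF N(1) V.theta_closed V.theta_closed]
        by simp
    qed
  qed
  then show ?thesis by blast
qed

lemma simple_Smod: "simple_left_module HH (Smod p lam \<alpha> \<beta>)"
proof -
  obtain m where "H_eigen_quotient p lam (Smod p lam \<alpha> \<beta>) m \<alpha> \<beta>"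
    using H_eigen_quotient_Smod by meson
  then show ?thesis by (rule H_eigen_quotient.simple)
qed

text \<open>\<open>x^p\<close> acts on the two modules by the \<open>p\<close>-th powers of
  \<open>\<alpha>\<close> and \<open>\<alpha>'\<close>, and Frobenius is injective. Once these
  agree, \<open>Z_elem \<alpha>\<close> is the same element for both modules and its eigenvalues
  give \<open>\<beta> = \<beta>'\<close>.\<close>

lemma Smod_distinct:
  assumes "isomorphic_left_modules HH (Smod p lam \<alpha> \<beta>) (Smod p lam \<alpha>' \<beta>')"
  shows "\<alpha> = \<alpha>' \<and> \<beta> = \<beta>'"
proof -
  let ?S = "Smod p lam \<alpha> \<beta>" and ?S' = "Smod p lam \<alpha>' \<beta>'"
  obtain m m' where "H_eigen_quotient p lam ?S m \<alpha> \<beta>" "H_eigen_quotient p lam ?S' m' \<alpha>' \<beta>'"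
    using H_eigen_quotient_Smod by meson
  then interpret S: H_eigen_quotient p lam ?S m \<alpha> \<beta> + S': H_eigen_quotient p lam ?S' m' \<alpha>' \<beta>' .
  from assms obtain F where F: "F \<in> LinearCombinations.module_hom HH ?S ?S'"
    and bij: "bij_betw F (carrier ?S) (carrier ?S')"
    by (auto simp: isomorphic_left_modules_def)
  have "m' \<in> F ` carrier ?S"
    using bij by (simp add: bij_betw_def)
  then obtain v where v: "v \<in> carrier ?S" "F v = m'" by (metis imageE)
  have hom: "F (h \<odot>\<^bsub>?S\<^esub> v) = h \<odot>\<^bsub>?S'\<^esub> m'" if "h \<in> carrier HH" for h
    using module_hom_smult[OF F that v(1)] v(2) by simp
  \<comment> \<open>A nonzero constant is not divisible by \<open>q_poly\<close>, whose degree is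
    positive.\<close>
  have scalar: "c = d" if "Hscalar p lam c \<odot>\<^bsub>?S'\<^esub> m' = Hscalar p lam d \<odot>\<^bsub>?S'\<^esub> m'" for c d
  proof (rule ccontr)
    assume "c \<noteq> d"
    have "S'.theta [:c - d:] = S'.theta [:c:] \<ominus>\<^bsub>?S'\<^esub> S'.theta [:d:]"
      by (simp flip: S'.theta_diff)
    also have "\<dots> = \<zero>\<^bsub>?S'\<^esub>"
      using that by (simp add: S'.theta_def HS.ev_const S'.Mod.M.minus_eq S'.Mod.M.r_neg S'.Mod.lsmult_closed)
    finally have "q_poly \<alpha>' \<beta>' dvd [:c - d:]" by (simp only: S'.theta_kernel)
    then have "degree (q_poly \<alpha>' \<beta>') \<le> 0"
      using \<open>c \<noteq> d\<close> dvd_imp_degree_le[of "q_poly \<alpha>' \<beta>'" "[:c - d:]"] by simp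
    then show False using p_gt_1 by (simp add: degree_q_poly split: if_splits)
  qed
  have "Hscalar p lam (\<alpha> ^ p) \<odot>\<^bsub>?S'\<^esub> m' = Hscalar p lam (\<alpha>' ^ p) \<odot>\<^bsub>?S'\<^esub> m'"
    using hom[of "Hx p lam [^]\<^bsub>HH\<^esub> p"] hom[of "Hscalar p lam (\<alpha> ^ p)"] S.x_pow_p[OF v(1)] S'.x_pow_p[OF S'.m_carrier]
    by simp
  then have pow: "\<alpha> ^ p = \<alpha>' ^ p" by (rule scalar)
  have "(\<alpha> - \<alpha>' + \<alpha>') ^ p = (\<alpha> - \<alpha>') ^ p + \<alpha>' ^ p"
    by (rule freshmans_dream) (use p_prime char_p in simp_all)
  then have \<alpha>: "\<alpha> = \<alpha>'" using pow by simp
  have "Hscalar p lam \<beta> \<odot>\<^bsub>?S'\<^esub> m' = Hscalar p lam \<beta>' \<odot>\<^bsub>?S'\<^esub> m'"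
    using hom[of "Z_elem \<alpha>"] hom[of "Hscalar p lam \<beta>"] S.Z_elem_eigen[OF v(1)] S'.Z_elem_eigen[OF S'.m_carrier] \<alpha>
    by simp
  then show ?thesis using scalar \<alpha> by blast
qed

end

section \<open>Simple modules\<close>

locale simple_H_module = H_module p lam M
  for p :: nat and lam :: "nat \<Rightarrow> 'k::alg_closed_field" and M :: "('k H_elem, 'm) module" (structure) +
  assumes simple: "simple_left_module (Halg p lam) M"
begin

lemma nontrivial: "carrier M \<noteq> {\<zero>}"
  using simple by (simp add: simple_left_module_def)

lemma submodule_trivial: "Module.submodule N HH M \<Longrightarrow> N = {\<zero>} \<or> N = carrier M"
  using simple by (simp add: simple_left_module_def)

lemma submodule_generators:
  assumes "N \<subseteq> carrier M" "\<zero> \<in> N" "\<And>u v. u \<in> N \<Longrightarrow> v \<in> N \<Longrightarrow> u \<oplus> v \<in> N"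
    and "\<And>u v. v \<in> N \<Longrightarrow> Phi u \<odot> v \<in> N" "\<And>v. v \<in> N \<Longrightarrow> Hy p lam \<odot> v \<in> N"
  shows "Module.submodule N HH M"
proof (rule Mod.submoduleI[OF assms(1-3)])
  fix h v assume "h \<in> carrier HH" "v \<in> N"
  then show "h \<odot> v \<in> N"
  proof (induction arbitrary: v rule: H_induct)
    case (scalar c)
    then show ?case using assms(4)[of v "[:[:c:]:]"] by (simp add: Phi_simps)
  next
    case x
    then show ?case using assms(4)[of v "[:[:0, 1:]:]"] by (simp add: Phi_simps)
  next
    case g
    then show ?case using assms(4)[of v "[:0, 1:]"] by (simp only: Phi_simps)
  next
    case (add a b)
    then show ?case using assms(1,3) by (auto simp: Mod.lsmult_l_distr subset_iff)
  next
    case (mult a b)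
    then show ?case using assms(1) by (auto simp: Mod.lsmult_assoc subset_iff)
  qed (rule assms(5))
qed

section \<open>The central subalgebra k[x^p, Y] acting on a simple module\<close>

sublocale HB: ring_eval HH "HS.ev (Hx p lam [^]\<^bsub>HH\<^esub> p)"
  by (rule HS.ev_ring_eval) (simp_all add: Hscalar_central)

lemma HB_commute:
  assumes "h \<in> carrier HH"
  shows "h \<otimes>\<^bsub>HH\<^esub> HS.ev (Hx p lam [^]\<^bsub>HH\<^esub> p) q = HS.ev (Hx p lam [^]\<^bsub>HH\<^esub> p) q \<otimes>\<^bsub>HH\<^esub> h"
  by (rule HS.ev_commute) (simp_all add: assms Hx_pow_p_central Hscalar_central)

text \<open>The inner variable goes to \<open>x^p\<close> and the outer one to
  \<open>Y\<close>.\<close>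

abbreviation Theta :: "'k poly poly \<Rightarrow> 'k H_elem" where "Theta \<equiv> HB.ev (HY p lam)"

sublocale HZ: ring_eval HH Theta
  by (rule HB.ev_ring_eval) (simp_all add: HB_commute)

lemma Theta_central: "h \<in> carrier HH \<Longrightarrow> h \<otimes>\<^bsub>HH\<^esub> Theta q = Theta q \<otimes>\<^bsub>HH\<^esub> h"
  by (rule HB.ev_commute) (simp_all add: HB_commute HY_central)

lemma Theta_simps: "Theta [:[:c:]:] = Hscalar p lam c" "Theta [:[:0, 1:]:] = Hx p lam [^]\<^bsub>HH\<^esub> p"
  "Theta [:0, 1:] = HY p lam"
  by (simp_all only: HB.ev_const HB.ev_var HS.ev_const HS.ev_var HY_closed H.nat_pow_closed Hx_closed)

abbreviation zact :: "'k poly poly \<Rightarrow> 'm \<Rightarrow> 'm" where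
  "zact c v \<equiv> Theta c \<odot> v"

sublocale Z: comm_ring_action M zact
  by unfold_locales
    (simp_all add: Mod.lsmult_closed Mod.lsmult_r_distr HZ.\<phi>_add HZ.\<phi>_mult HZ.\<phi>_one
      Mod.lsmult_l_distr Mod.lsmult_assoc Mod.lsmult_one)

lemma zact_commute:
  "h \<in> carrier HH \<Longrightarrow> v \<in> carrier M \<Longrightarrow> h \<odot> zact c v = zact c (h \<odot> v)"
  by (simp add: Mod.lsmult_assoc[symmetric] Theta_central)

text \<open>Centrality makes the image of \<open>zact c\<close> a submodule.\<close>

lemma schur: "(\<forall>v \<in> carrier M. zact c v = \<zero>) \<or> zact c ` carrier M = carrier M"
proof -
  have "Module.submodule (zact c ` carrier M) HH M"
  proof (rule Mod.submoduleI)
    show "\<zero> \<in> zact c ` carrier M"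
      using Z.act_zero[of c] by (intro image_eqI[of _ _ "\<zero>"]) auto
    show "u \<oplus> v \<in> zact c ` carrier M" if "u \<in> zact c ` carrier M" "v \<in> zact c ` carrier M" for u v
      using that by (auto simp: Z.act_add[symmetric])
    show "h \<odot> v \<in> zact c ` carrier M" if "h \<in> carrier HH" "v \<in> zact c ` carrier M" for h v
      using that by (auto simp: zact_commute Mod.lsmult_closed)
  qed (auto intro: Z.act_closed)
  from submodule_trivial[OF this] show ?thesis by auto
qed

lemma lspan_commute:
  assumes h: "h \<in> carrier HH" and ms: "set ms \<subseteq> carrier M" and ns: "set ns \<subseteq> carrier M"
    and gens: "\<And>m. m \<in> set ms \<Longrightarrow> h \<odot> m \<in> Z.lspan ns" and v: "v \<in> Z.lspan ms"
  shows "h \<odot> v \<in> Z.lspan ns"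
proof -
  have "Z.lspan ms \<subseteq> {v \<in> carrier M. h \<odot> v \<in> Z.lspan ns}"
  proof (rule Z.lspan_least)
    show "\<zero> \<in> {v \<in> carrier M. h \<odot> v \<in> Z.lspan ns}"
      using Z.zero_lspan[OF ns] h by (simp add: Mod.lsmult_zero_right)
  qed (use h ms gens in \<open>auto simp: Mod.lsmult_r_distr zact_commute intro: Z.lspan_add[OF ns] Z.lspan_act[OF ns]\<close>)
  with v show ?thesis by blast
qed

text \<open>The exponent \<open>j\<close> is the last one for which the power of \<open>h\<close>
  does not kill \<open>v\<close>.\<close>

lemma nilpotent_kernel:
  assumes h: "h \<in> carrier HH" and v: "v \<in> carrier M" "v \<noteq> \<zero>"
    and nil: "h [^]\<^bsub>HH\<^esub> (n::nat) \<odot> v = \<zero>"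
  shows "\<exists>j::nat. h [^]\<^bsub>HH\<^esub> j \<odot> v \<noteq> \<zero> \<and> h \<odot> (h [^]\<^bsub>HH\<^esub> j \<odot> v) = \<zero>"
proof -
  have "h [^]\<^bsub>HH\<^esub> (0::nat) \<odot> v \<noteq> \<zero>" using v by (simp add: Mod.lsmult_one)
  then obtain j where "h [^]\<^bsub>HH\<^esub> j \<odot> v \<noteq> \<zero>" "h [^]\<^bsub>HH\<^esub> Suc j \<odot> v = \<zero>"
    using ex_least_nat_less[of "\<lambda>j. h [^]\<^bsub>HH\<^esub> j \<odot> v = \<zero>" n] nil by blast
  moreover from this(2) have "h \<odot> (h [^]\<^bsub>HH\<^esub> j \<odot> v) = \<zero>"
    using h v by (simp only: H.nat_pow_Suc2 Mod.lsmult_assoc H.nat_pow_closed)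
  ultimately show ?thesis by blast
qed

lemma freshman_P: "(u + v) ^ p = u ^ p + (v :: 'k poly poly) ^ p"
  by (rule freshmans_dream) (use p_prime char_p in simp_all)

lemma ex_g_fixed: "\<exists>m \<in> carrier M. m \<noteq> \<zero> \<and> Hg p lam \<odot> m = m"
proof -
  obtain v where v: "v \<in> carrier M" "v \<noteq> \<zero>" using nontrivial Mod.M.zero_closed by blast
  \<comment> \<open>Written as a sum for the freshman's dream; \<open>(- 1) ^ p = - 1\<close>
    because \<open>p\<close> is odd. The image of \<open>?u\<close> is \<open>g - 1\<close>, whose
    \<open>p\<close>-th power is \<open>g^p - 1 = 0\<close>.\<close>
  let ?u = "[:0, 1:] + (- 1) :: 'k poly poly"
  have "?u ^ p = [:0, 1:] ^ p - 1"
    unfolding freshman_P using p_odd by simp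
  then have "Phi ?u [^]\<^bsub>HH\<^esub> p = \<zero>\<^bsub>HH\<^esub>"
    using Hg_pow_p by (simp only: HR.\<phi>_power[symmetric] HR.\<phi>_diff HR.\<phi>_one)
      (simp only: HR.\<phi>_power Phi_simps, simp add: a_minus_def H.r_neg)
  then have "Phi ?u [^]\<^bsub>HH\<^esub> p \<odot> v = \<zero>" using v by (simp add: Mod.lsmult_zero_left)
  from nilpotent_kernel[OF HR.\<phi>_closed v this]
  obtain j :: nat where j: "Phi ?u [^]\<^bsub>HH\<^esub> j \<odot> v \<noteq> \<zero>"
    "Phi ?u \<odot> (Phi ?u [^]\<^bsub>HH\<^esub> j \<odot> v) = \<zero>" by blast
  define m where "m = Phi ?u [^]\<^bsub>HH\<^esub> j \<odot> v"
  have m: "m \<in> carrier M" using v by (simp add: m_def Mod.lsmult_closed)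
  have "Phi ?u = Hg p lam \<ominus>\<^bsub>HH\<^esub> \<one>\<^bsub>HH\<^esub>"
    by (simp only: add_uminus_conv_diff HR.\<phi>_diff HR.\<phi>_one Phi_simps)
  then have "Hg p lam \<odot> m \<ominus> m = \<zero>"
    using j(2) m unfolding m_def[symmetric] by (simp add: Mod.lsmult_diff_left Mod.lsmult_one)
  then have "Hg p lam \<odot> m = m"
    using m by (simp add: Mod.lsmult_closed)
  then show ?thesis using m j(1) by (auto simp: m_def)
qed

text \<open>For a vector \<open>m\<close> fixed by \<open>g\<close>, the span \<open>L\<close> of
  the \<open>x^i m\<close> with \<open>i < p\<close> is \<open>R\<close>-stable, because
  \<open>x^p\<close> belongs to the scalars. The sums \<open>L + y L + ... + y^(l-1) L\<close> are
  \<open>R\<close>-stable too and stop growing at \<open>l = p\<close>, because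
  \<open>y^p = Y + y r\<close> with \<open>Y\<close> among the scalars.\<close>

lemma finitely_generated: "\<exists>ms. set ms \<subseteq> carrier M \<and> carrier M \<subseteq> Z.lspan ms"
proof -
  obtain m where m: "m \<in> carrier M" "m \<noteq> \<zero>" "Hg p lam \<odot> m = m"
    using ex_g_fixed by blast
  let ?x = "Hx p lam" and ?y = "Hy p lam"
  define L where "L = map (\<lambda>i. ?x [^]\<^bsub>HH\<^esub> i \<odot> m) [0..<p]"
  have L: "set L \<subseteq> carrier M" by (auto simp: L_def m Mod.lsmult_closed)
  have L_mem: "?x [^]\<^bsub>HH\<^esub> i \<odot> m \<in> Z.lspan L" if "i < p" for i
    by (rule Z.lspan_mem[OF L]) (use that in \<open>simp add: L_def\<close>)
  have m_L: "m \<in> Z.lspan L" using L_mem[of 0] p_gt_1 m by (simp add: Mod.lsmult_one)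
  have x_L: "?x \<odot> v \<in> Z.lspan L" if "v \<in> Z.lspan L" for v
  proof (rule lspan_commute[OF Hx_closed L L _ that])
    fix u assume "u \<in> set L"
    then obtain i where i: "i < p" "u = ?x [^]\<^bsub>HH\<^esub> i \<odot> m" by (auto simp: L_def)
    have u: "?x \<odot> u = ?x [^]\<^bsub>HH\<^esub> Suc i \<odot> m"
      using m i by (simp only: H.nat_pow_Suc2 Mod.lsmult_assoc Hx_closed H.nat_pow_closed)
    show "?x \<odot> u \<in> Z.lspan L"
    proof (cases "Suc i < p")
      case True
      then show ?thesis unfolding u by (rule L_mem)
    next
      case False
      then have "Suc i = p" using i by simp
      then show ?thesis unfolding u using Z.lspan_act[OF L m_L, of "[:[:0, 1:]:]"] by (simp only: Theta_simps)
    qed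
  qed
  have scalar_L: "Hscalar p lam a \<odot> m \<in> Z.lspan L" for a
    using Z.lspan_act[OF L m_L, of "[:[:a:]:]"] by (simp only: Theta_simps)
  have kx_L: "Phi [:c:] \<odot> m \<in> Z.lspan L" for c
  proof (induction c)
    case 0
    have "Phi [:0:] \<odot> m = \<zero>" using m by (simp add: Mod.lsmult_zero_left)
    then show ?case using Z.zero_lspan[OF L] by simp
  next
    case (pCons a c)
    have "Phi [:pCons a c:] = Hscalar p lam a \<oplus>\<^bsub>HH\<^esub> ?x \<otimes>\<^bsub>HH\<^esub> Phi [:c:]"
      by (simp only: HX.ev_const HS.ev_pCons Hx_closed Hg_closed)
    then have "Phi [:pCons a c:] \<odot> m = Hscalar p lam a \<odot> m \<oplus> ?x \<odot> (Phi [:c:] \<odot> m)"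
      using m by (simp only: Mod.lsmult_l_distr Mod.lsmult_assoc Hscalar_closed Hx_closed HR.\<phi>_closed H.m_closed)
    then show ?case using Z.lspan_add[OF L scalar_L x_L[OF pCons.IH]] by simp
  qed
  \<comment> \<open>As \<open>g\<close> fixes \<open>m\<close>, the action of \<open>k[x][T]\<close>
    on \<open>m\<close> factors through \<open>T = 1\<close>.\<close>
  have g_fix: "Phi u \<odot> m = Phi [:poly u 1:] \<odot> m" for u
  proof (induction u)
    case 0
    show ?case by simp
  next
    case (pCons c u)
    have comm: "Hg p lam \<otimes>\<^bsub>HH\<^esub> Phi u = Phi u \<otimes>\<^bsub>HH\<^esub> Hg p lam"
      using HR.\<phi>_mult[of "[:0, 1:]" u] HR.\<phi>_mult[of u "[:0, 1:]"] by (simp only: Phi_simps mult.commute)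
    have "Phi (pCons c u) = Phi [:c:] \<oplus>\<^bsub>HH\<^esub> Hg p lam \<otimes>\<^bsub>HH\<^esub> Phi u"
      by (simp only: HX.ev_pCons[OF Hg_closed, of c u] HX.ev_const[OF Hg_closed])
    then have "Phi (pCons c u) \<odot> m = Phi [:c:] \<odot> m \<oplus> (Hg p lam \<otimes>\<^bsub>HH\<^esub> Phi u) \<odot> m"
      using m by (simp only: Mod.lsmult_l_distr Hg_closed HR.\<phi>_closed H.m_closed)
    also have "(Hg p lam \<otimes>\<^bsub>HH\<^esub> Phi u) \<odot> m = Phi u \<odot> m"
      unfolding comm using m by (simp only: Mod.lsmult_assoc HR.\<phi>_closed Hg_closed)
    also have "Phi [:c:] \<odot> m \<oplus> Phi u \<odot> m = Phi ([:c:] + [:poly u 1:]) \<odot> m"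
      unfolding pCons.IH using m by (simp only: HR.\<phi>_add Mod.lsmult_l_distr HR.\<phi>_closed)
    finally show ?case by (simp only: poly_pCons mult_1 add_pCons add_0_left)
  qed
  have Phi_L: "Phi u \<odot> v \<in> Z.lspan L" if "v \<in> Z.lspan L" for u v
  proof (rule lspan_commute[OF HR.\<phi>_closed L L _ that])
    fix w assume "w \<in> set L"
    then obtain i where i: "w = Phi ([:[:0, 1:]:] ^ i) \<odot> m" by (auto simp: L_def Hx_pow)
    have "Phi u \<odot> w = Phi (u * [:[:0, 1:]:] ^ i) \<odot> m"
      using m by (simp only: i HR.\<phi>_mult Mod.lsmult_assoc HR.\<phi>_closed)
    then show "Phi u \<odot> w \<in> Z.lspan L"
      using kx_L g_fix by metis
  qed
  define K where "K = rec_nat {\<zero>} (\<lambda>_ N. {v \<oplus> ?y \<odot> w | v w. v \<in> Z.lspan L \<and> w \<in> N})"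
  have K_0: "K 0 = {\<zero>}"
    and K_Suc: "K (Suc l) = {v \<oplus> ?y \<odot> w | v w. v \<in> Z.lspan L \<and> w \<in> K l}" for l
    by (simp_all add: K_def)
  note LM = Z.lspan_closed[OF L, THEN subsetD]
  have KM: "v \<in> K l \<Longrightarrow> v \<in> carrier M" for l v
    by (induction l arbitrary: v) (auto simp: K_0 K_Suc LM Mod.lsmult_closed)
  have K_fg: "\<exists>ms. set ms \<subseteq> carrier M \<and> K l \<subseteq> Z.lspan ms" for l
  proof (induction l)
    case 0
    show ?case by (intro exI[of _ "[]"]) (simp add: K_0)
  next
    case (Suc l)
    then obtain ms where ms: "set ms \<subseteq> carrier M" "K l \<subseteq> Z.lspan ms" by blast
    let ?ns = "L @ map (\<lambda>v. ?y \<odot> v) ms"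
    have ns: "set ?ns \<subseteq> carrier M" using L ms by (auto simp: Mod.lsmult_closed)
    have "?y \<odot> w \<in> Z.lspan ?ns" if "w \<in> K l" for w
      by (rule lspan_commute[OF Hy_closed ms(1) ns, of w]) (use that ms Z.lspan_mem[OF ns] in auto)
    moreover have "Z.lspan L \<subseteq> Z.lspan ?ns" by (rule Z.lspan_mono) (use ns in auto)
    ultimately have "K (Suc l) \<subseteq> Z.lspan ?ns" by (auto simp: K_Suc intro!: Z.lspan_add[OF ns])
    then show ?case using ns by blast
  qed
  have L_0: "\<zero> \<in> Z.lspan L" by (rule Z.zero_lspan[OF L])
  have K_zero: "\<zero> \<in> K l" for l
  proof (induction l)
    case (Suc l)
    then show ?case using L_0 unfolding K_Suc
      by (intro CollectI exI[of _ "\<zero>"]) (simp add: Mod.lsmult_zero_right)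
  qed (simp add: K_0)
  have K_add: "u \<in> K l \<Longrightarrow> v \<in> K l \<Longrightarrow> u \<oplus> v \<in> K l" for l u v
  proof (induction l arbitrary: u v)
    case (Suc l)
    then obtain a b c d where *: "u = a \<oplus> ?y \<odot> b" "v = c \<oplus> ?y \<odot> d"
      "a \<in> Z.lspan L" "c \<in> Z.lspan L" "b \<in> K l" "d \<in> K l"
      by (auto simp: K_Suc)
    then have "u \<oplus> v = (a \<oplus> c) \<oplus> ?y \<odot> (b \<oplus> d)"
      by (simp add: Mod.lsmult_r_distr Mod.lsmult_closed KM LM Mod.M.a_ac)
    then show ?case using * Suc.IH Z.lspan_add[OF L] unfolding K_Suc by blast
  qed (simp add: K_0)
  have K_mono: "K l \<subseteq> K (Suc l)" for l
  proof (induction l)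
    case 0
    show ?case using K_zero by (simp add: K_0)
  next
    case (Suc l)
    show ?case
    proof
      fix u assume "u \<in> K (Suc l)"
      then obtain v w where "u = v \<oplus> ?y \<odot> w" "v \<in> Z.lspan L" "w \<in> K l"
        unfolding K_Suc[of l] by blast
      with Suc show "u \<in> K (Suc (Suc l))" unfolding K_Suc[of "Suc l"] by blast
    qed
  qed
  have K_y: "?y \<odot> w \<in> K (Suc l)" if "w \<in> K l" for l w
    using that L_0 unfolding K_Suc
    by (intro CollectI exI[of _ "\<zero>"] exI[of _ w]) (simp add: Mod.lsmult_closed KM)
  \<comment> \<open>Moving \<open>u\<close> past \<open>y\<close> leaves the extra term
    \<open>\<delta>(u) b\<close> with \<open>b\<close> one level lower, which \<open>K_mono\<close>
    keeps inside.\<close>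
  have K_Phi: "Phi u \<odot> v \<in> K l" if "v \<in> K l" for l u v
    using that
  proof (induction l arbitrary: u v)
    case 0
    then show ?case by (simp add: K_0 Mod.lsmult_zero_right)
  next
    case (Suc l)
    then obtain a b where *: "v = a \<oplus> ?y \<odot> b" "a \<in> Z.lspan L" "b \<in> K l"
      by (auto simp: K_Suc)
    have "Phi u \<odot> (?y \<odot> b) = (?y \<otimes>\<^bsub>HH\<^esub> Phi u \<oplus>\<^bsub>HH\<^esub> Phi (deltaT p lam u)) \<odot> b"
      using KM[OF *(3)] by (simp add: Mod.lsmult_assoc[symmetric] Phi_Hy)
    also have "\<dots> = ?y \<odot> (Phi u \<odot> b) \<oplus> Phi (deltaT p lam u) \<odot> b"
      using KM[OF *(3)] by (simp add: Mod.lsmult_assoc Mod.lsmult_l_distr)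
    finally have eq: "Phi u \<odot> v = (Phi u \<odot> a \<oplus> ?y \<odot> (Phi u \<odot> b)) \<oplus> Phi (deltaT p lam u) \<odot> b"
      using KM[OF *(3)] LM[OF *(2)]
      by (simp add: *(1) Mod.lsmult_r_distr Mod.lsmult_closed Mod.M.a_assoc)
    have "Phi u \<odot> a \<oplus> ?y \<odot> (Phi u \<odot> b) \<in> K (Suc l)"
      unfolding K_Suc using Phi_L[OF *(2)] Suc.IH[OF *(3)] by blast
    moreover have "Phi (deltaT p lam u) \<odot> b \<in> K (Suc l)"
      using Suc.IH[OF *(3)] K_mono by blast
    ultimately show ?case unfolding eq by (rule K_add)
  qed
  have K_mono': "K l \<subseteq> K l'" if "l \<le> l'" for l l'
    using lift_Suc_mono_le[of K, OF _ that] K_mono by blast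
  have L_K: "Z.lspan L \<subseteq> K (Suc l)" for l
  proof
    fix v assume v: "v \<in> Z.lspan L"
    then show "v \<in> K (Suc l)" unfolding K_Suc using K_zero[of l]
      by (intro CollectI exI[of _ v] exI[of _ "\<zero>"]) (simp add: Mod.lsmult_zero_right LM)
  qed
  \<comment> \<open>Relative to \<open>K l\<close>, only \<open>y^l L\<close> is new in
    \<open>K (Suc l)\<close>; at \<open>l = p\<close> this isolates the power of \<open>y\<close> to
    be reduced.\<close>
  have K_top: "K (Suc l) \<subseteq> {w \<oplus> ?y [^]\<^bsub>HH\<^esub> l \<odot> v | w v. w \<in> K l \<and> v \<in> Z.lspan L}" for l
  proof (induction l)
    case 0
    have "v \<oplus> ?y \<odot> \<zero> = \<zero> \<oplus> ?y [^]\<^bsub>HH\<^esub> (0::nat) \<odot> v" if "v \<in> Z.lspan L" for v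
      using LM[OF that] by (simp add: Mod.lsmult_zero_right Mod.lsmult_one)
    then show ?case by (auto simp: K_Suc K_0)
  next
    case (Suc l)
    show ?case
    proof
      fix u assume "u \<in> K (Suc (Suc l))"
      then obtain a b where *: "u = a \<oplus> ?y \<odot> b" "a \<in> Z.lspan L" "b \<in> K (Suc l)"
        unfolding K_Suc[of "Suc l"] by auto
      with Suc obtain w v where wv: "b = w \<oplus> ?y [^]\<^bsub>HH\<^esub> l \<odot> v" "w \<in> K l" "v \<in> Z.lspan L" by blast
      have "?y \<odot> (?y [^]\<^bsub>HH\<^esub> l \<odot> v) = ?y [^]\<^bsub>HH\<^esub> Suc l \<odot> v"
        using LM[OF wv(3)] by (simp only: H.nat_pow_Suc2 Mod.lsmult_assoc Hy_closed H.nat_pow_closed)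
      then have "u = (a \<oplus> ?y \<odot> w) \<oplus> ?y [^]\<^bsub>HH\<^esub> Suc l \<odot> v"
        using LM[OF *(2)] LM[OF wv(3)] KM[OF wv(2)]
        by (simp add: *(1) wv(1) Mod.lsmult_r_distr Mod.lsmult_closed Mod.M.a_assoc del: H.nat_pow_Suc)
      moreover have "a \<oplus> ?y \<odot> w \<in> K (Suc l)" unfolding K_Suc using *(2) wv(2) by blast
      ultimately show "u \<in> {w \<oplus> ?y [^]\<^bsub>HH\<^esub> Suc l \<odot> v | w v. w \<in> K (Suc l) \<and> v \<in> Z.lspan L}"
        using wv(3) by blast
    qed
  qed
  \<comment> \<open>Since \<open>p \<ge> 2\<close>, both \<open>L\<close> and \<open>y L\<close> lie
    in \<open>K p\<close>; these contain the terms \<open>Y v\<close> and \<open>y r v\<close> of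
    \<open>y^p v\<close>.\<close>
  obtain n where n: "p = Suc (Suc n)" using less_imp_Suc_add[OF p_gt_1] by auto
  have L_Kp: "Z.lspan L \<subseteq> K p"
    using L_K[of "Suc n"] unfolding n[symmetric] .
  have yL_Kp: "?y \<odot> w \<in> K p" if "w \<in> Z.lspan L" for w
    using K_y[of w "Suc n"] L_K[of n] that unfolding n[symmetric] by blast
  have K_p: "K (Suc p) \<subseteq> K p"
  proof
    fix u assume "u \<in> K (Suc p)"
    then obtain w v where wv: "u = w \<oplus> ?y [^]\<^bsub>HH\<^esub> p \<odot> v" "w \<in> K p" "v \<in> Z.lspan L" using K_top by blast
    have v: "v \<in> carrier M" by (rule LM) fact
    have "?y [^]\<^bsub>HH\<^esub> p = HY p lam \<oplus>\<^bsub>HH\<^esub> ?y \<otimes>\<^bsub>HH\<^esub> Phi (rT p lam)"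
      by (simp add: HY_eq a_minus_def H.a_assoc H.l_neg)
    then have "?y [^]\<^bsub>HH\<^esub> p \<odot> v = HY p lam \<odot> v \<oplus> ?y \<odot> (Phi (rT p lam) \<odot> v)"
      using v by (simp add: Mod.lsmult_l_distr Mod.lsmult_assoc)
    moreover have "HY p lam \<odot> v \<in> K p"
      using Z.lspan_act[OF L wv(3), of "[:0, 1:]"] L_Kp by (auto simp only: Theta_simps)
    moreover have "?y \<odot> (Phi (rT p lam) \<odot> v) \<in> K p"
      by (rule yL_Kp) (rule Phi_L[OF wv(3)])
    ultimately show "u \<in> K p" using wv K_add by metis
  qed
  have "Module.submodule (K p) HH M"
  proof (rule submodule_generators)
    show "?y \<odot> v \<in> K p" if "v \<in> K p" for v
      using K_y[OF that] K_p by blast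
  qed (auto intro: KM K_zero K_add K_Phi)
  moreover have "m \<in> K p" using m_L L_Kp by blast
  ultimately have "K p = carrier M" using submodule_trivial m(2) by blast
  then show ?thesis using K_fg by metis
qed

end

section \<open>Classification of the simple modules\<close>

context simple_H_module
begin

lemma central_scalars:
  "\<exists>c d. (\<forall>v \<in> carrier M. Hx p lam [^]\<^bsub>HH\<^esub> p \<odot> v = Hscalar p lam c \<odot> v) \<and>
    (\<forall>v \<in> carrier M. HY p lam \<odot> v = Hscalar p lam d \<odot> v)"
proof -
  obtain ms where "set ms \<subseteq> carrier M" "carrier M \<subseteq> Z.lspan ms"
    using finitely_generated by blast
  from maximal_ideal_bivariate[OF Z.annihilator_maximal[OF schur this nontrivial]]
  obtain c d where c: "\<And>v. v \<in> carrier M \<Longrightarrow> zact [:[:- c, 1:]:] v = \<zero>"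
    and d: "\<And>v. v \<in> carrier M \<Longrightarrow> zact [:[:- d:], 1:] v = \<zero>" by blast
  have "[:[:- c, 1:]:] = [:[:0, 1:]:] - [:[:c:]:]" "[:[:- d:], 1:] = [:0, 1:] - [:[:d:]:]"
    by simp_all
  then have "Theta [:[:- c, 1:]:] = Hx p lam [^]\<^bsub>HH\<^esub> p \<ominus>\<^bsub>HH\<^esub> Hscalar p lam c"
    "Theta [:[:- d:], 1:] = HY p lam \<ominus>\<^bsub>HH\<^esub> Hscalar p lam d"
    by (simp_all only: HZ.\<phi>_diff Theta_simps)
  then have "Hx p lam [^]\<^bsub>HH\<^esub> p \<odot> v \<ominus> Hscalar p lam c \<odot> v = \<zero>"
    "HY p lam \<odot> v \<ominus> Hscalar p lam d \<odot> v = \<zero>" if "v \<in> carrier M" for v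
    using c[OF that] d[OF that] that
    by (simp_all only: Mod.lsmult_diff_left H.nat_pow_closed Hx_closed Hscalar_closed HY_closed)
  then show ?thesis
    by (intro exI[of _ c] exI[of _ d]) (simp add: Mod.lsmult_closed)
qed

text \<open>For a root \<open>\<alpha>\<close> of \<open>\<alpha>^p = c\<close>, the
  \<open>p\<close>-th power of \<open>x - \<alpha>\<close> is \<open>x^p - c\<close>, which kills
  the module. The last nonzero image of a \<open>g\<close>-fixed vector under powers of
  \<open>x - \<alpha>\<close> is the required eigenvector.\<close>

lemma ex_eigen: "\<exists>m \<alpha>. H_eigen p lam M m \<alpha> \<and> m \<noteq> \<zero>"
proof -
  obtain c where c: "\<And>v. v \<in> carrier M \<Longrightarrow> Hx p lam [^]\<^bsub>HH\<^esub> p \<odot> v = Hscalar p lam c \<odot> v"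
    using central_scalars by blast
  obtain v where v: "v \<in> carrier M" "v \<noteq> \<zero>" "Hg p lam \<odot> v = v"
    using ex_g_fixed by blast
  obtain \<alpha> where \<alpha>: "\<alpha> ^ p = c" using nth_root_exists[of p c] p_gt_1 by auto
  let ?u = "[:[:0, 1:]:] + [:[:- \<alpha>:]:]"
  have u: "?u = [:[:0, 1:]:] - [:[:\<alpha>:]:]" by simp
  have "?u ^ p = [:[:0, 1:]:] ^ p - [:[:c:]:]"
    unfolding freshman_P using p_odd \<alpha> by (simp add: poly_const_pow)
  then have "Phi ?u [^]\<^bsub>HH\<^esub> p = Hx p lam [^]\<^bsub>HH\<^esub> p \<ominus>\<^bsub>HH\<^esub> Hscalar p lam c"
    by (simp only: HR.\<phi>_power[symmetric] HR.\<phi>_diff) (simp only: HR.\<phi>_power Phi_simps)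
  then have "Phi ?u [^]\<^bsub>HH\<^esub> p \<odot> v = \<zero>"
    using v c[OF v(1)]
    by (simp only: Mod.lsmult_diff_left H.nat_pow_closed Hx_closed Hscalar_closed)
      (simp add: Mod.M.minus_eq Mod.M.r_neg Mod.lsmult_closed)
  from nilpotent_kernel[OF HR.\<phi>_closed v(1,2) this]
  obtain j :: nat where j: "Phi ?u [^]\<^bsub>HH\<^esub> j \<odot> v \<noteq> \<zero>"
    "Phi ?u \<odot> (Phi ?u [^]\<^bsub>HH\<^esub> j \<odot> v) = \<zero>" by blast
  define m where "m = Phi ?u [^]\<^bsub>HH\<^esub> j \<odot> v"
  have m: "m \<in> carrier M" using v by (simp add: m_def Mod.lsmult_closed)
  have "Phi ?u = Hx p lam \<ominus>\<^bsub>HH\<^esub> Hscalar p lam \<alpha>"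
    by (simp only: u HR.\<phi>_diff Phi_simps)
  then have "Hx p lam \<odot> m \<ominus> Hscalar p lam \<alpha> \<odot> m = \<zero>"
    using j(2) m unfolding m_def[symmetric] by (simp only: Mod.lsmult_diff_left Hx_closed Hscalar_closed)
  then have x: "Hx p lam \<odot> m = Hscalar p lam \<alpha> \<odot> m"
    using m by (simp add: Mod.lsmult_closed)
  \<comment> \<open>\<open>m\<close> arises from \<open>v\<close> by an element of the commutative
    ring \<open>R\<close>, so it is still fixed by \<open>g\<close>.\<close>
  have "Hg p lam \<otimes>\<^bsub>HH\<^esub> Phi (?u ^ j) = Phi (?u ^ j) \<otimes>\<^bsub>HH\<^esub> Hg p lam"
    using HR.\<phi>_mult[of "[:0, 1:]" "?u ^ j"] HR.\<phi>_mult[of "?u ^ j" "[:0, 1:]"]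
    by (simp only: Phi_simps mult.commute)
  then have "Hg p lam \<odot> m = m"
    unfolding m_def HR.\<phi>_power[symmetric] using v
    by (metis HR.\<phi>_closed Hg_closed Mod.lsmult_assoc)
  then have "H_eigen p lam M m \<alpha>"
    using m x by unfold_locales
  then show ?thesis using j(1) by (auto simp: m_def)
qed

text \<open>Outside the degenerate case \<open>\<beta>\<close> is the scalar of \<open>Y\<close>. In
  the degenerate case it is a root of a generator of the kernel of \<open>E.theta\<close>: the
  kernel then lies in the multiples of \<open>y - \<beta>\<close>, whose image is a proper submodule
  and hence zero, so that the two coincide.\<close>

lemma ex_eigen_quotient: "\<exists>m \<alpha> \<beta>. H_eigen_quotient p lam M m \<alpha> \<beta>"
proof -
  obtain m \<alpha> where eig: "H_eigen p lam M m \<alpha>" and m0: "m \<noteq> \<zero>" using ex_eigen by blast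
  interpret E: H_eigen p lam M m \<alpha> by (rule eig)
  obtain d where d: "\<And>v. v \<in> carrier M \<Longrightarrow> HY p lam \<odot> v = Hscalar p lam d \<odot> v"
    using central_scalars by blast
  define W where "W = {f. E.theta f = \<zero>}"
  have W: "stable \<alpha> W"
    using E.stable_preimage[OF E.submodule_zero] by (simp add: W_def)
  have W_1: "1 \<notin> W" using m0 by (simp add: W_def E.theta_1)
  have "stable \<alpha> UNIV" by (simp add: stable_def)
  from submodule_trivial[OF E.submodule_image[OF this]]
  have surj: "range E.theta = carrier M"
    using m0 E.theta_1 by (metis rangeI singletonD)
  have Y_mem: "hact \<alpha> (HY p lam \<ominus>\<^bsub>HH\<^esub> Hscalar p lam d) f \<in> W" for f
    by (simp add: W_def E.theta_hact Mod.lsmult_diff_left d Mod.M.minus_eq Mod.M.r_neg Mod.lsmult_closed)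
  have "\<exists>\<beta>. W = {f. q_poly \<alpha> \<beta> dvd f}"
  proof (cases "degenerate \<alpha>")
    case False
    then have "q_poly \<alpha> d * f \<in> W" for f
      using Y_mem[of f] hact_Z_elem_minus[of \<alpha> d f] by (simp add: Z_elem_def)
    then have "{f. q_poly \<alpha> d dvd f} \<subseteq> W" by auto
    from stable_maximal[OF W this] W_1 show ?thesis by blast
  next
    case True
    \<comment> \<open>\<open>Y - d\<close> sends \<open>1\<close> to a polynomial with
      \<open>p\<close>-th coefficient \<open>1\<close>, so the kernel is nonzero and has an element
      of least degree.\<close>
    let ?f = "hact \<alpha> (HY p lam \<ominus>\<^bsub>HH\<^esub> Hscalar p lam d) 1"
    obtain n where n: "p = Suc (Suc n)" using less_imp_Suc_add[OF p_gt_1] by auto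
    have "coeff [:a, b:] p = 0" "coeff [:a:] p = 0" for a b :: 'k
      by (simp_all add: n)
    then have "coeff ?f p = 1"
      by (simp add: hact_minus_left hact_HY hact_letter)
    then have "?f \<in> W \<and> ?f \<noteq> 0" using Y_mem by force
    then obtain f where f: "f \<in> W" "f \<noteq> 0" and min: "\<And>h. h \<in> W \<Longrightarrow> h \<noteq> 0 \<Longrightarrow> degree f \<le> degree h"
      using ex_has_least_nat[of "\<lambda>f. f \<in> W \<and> f \<noteq> 0" ?f degree] by metis
    have "degree f > 0"
    proof (rule ccontr)
      assume "\<not> ?thesis"
      then obtain c where c: "f = [:c:]" by (metis degree_eq_zeroE neq0_conv)
      then have "[:inverse c:] * f = 1" using f by (simp flip: one_pCons)
      then show False using stable_ideal[OF W f(1), of "[:inverse c:]"] W_1 by simp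
    qed
    then obtain \<beta> where "poly f \<beta> = 0" using alg_closed_imp_poly_has_root by blast
    then have root: "[:- \<beta>, 1:] dvd f" by (simp add: poly_eq_0_iff_dvd)
    have q: "q_poly \<alpha> \<beta> = [:- \<beta>, 1:]" using True by (simp add: q_poly_def)
    have sub: "W \<subseteq> {h. q_poly \<alpha> \<beta> dvd h}"
    proof
      fix h assume h: "h \<in> W"
      have "h - (h div f) * f \<in> W"
        by (rule stable_diff[OF W h stable_ideal[OF W f(1)]])
      then have "h mod f \<in> W" by (simp add: minus_div_mult_eq_mod)
      then have "h mod f = 0" using min[of "h mod f"] degree_mod_less[OF f(2), of h] by force
      then have "f dvd h" by (simp add: dvd_eq_mod_eq_0)
      then show "h \<in> {h. q_poly \<alpha> \<beta> dvd h}" using root by (simp add: q) (rule dvd_trans)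
    qed
    \<comment> \<open>If a multiple \<open>h\<close> of \<open>y - \<beta>\<close> had the same
      image as \<open>1\<close>, then \<open>1 - h\<close> would lie in the kernel, and
      \<open>y - \<beta>\<close> would divide \<open>1\<close>.\<close>
    have "E.theta ` {f. q_poly \<alpha> \<beta> dvd f} \<noteq> carrier M"
    proof
      assume "E.theta ` {f. q_poly \<alpha> \<beta> dvd f} = carrier M"
      then obtain h where h: "q_poly \<alpha> \<beta> dvd h" "E.theta h = E.theta 1"
        using E.theta_closed[of 1] by (metis (mono_tags, lifting) imageE mem_Collect_eq)
      then have "1 - h \<in> W"
        by (simp add: W_def E.theta_diff Mod.M.minus_eq Mod.M.r_neg)
      then have "q_poly \<alpha> \<beta> dvd (1 - h) + h" using sub h(1) by (intro dvd_add) auto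
      then have "is_unit (q_poly \<alpha> \<beta>)" by simp
      then show False by (auto simp: q is_unit_poly_iff)
    qed
    then have "E.theta ` {f. q_poly \<alpha> \<beta> dvd f} = {\<zero>}"
      using submodule_trivial[OF E.submodule_image[OF stable_q_poly[of \<alpha> \<beta>]]] by meson
    then have "{f. q_poly \<alpha> \<beta> dvd f} \<subseteq> W" by (auto simp: W_def)
    with sub show ?thesis by blast
  qed
  then obtain \<beta> where "W = {f. q_poly \<alpha> \<beta> dvd f}" by blast
  then have "E.theta f = \<zero> \<longleftrightarrow> q_poly \<alpha> \<beta> dvd f" for f
    unfolding W_def by blast
  then have "H_eigen_quotient p lam M m \<alpha> \<beta>"
    using surj by unfold_locales
  then show ?thesis by blast
qed

end

theorem proposition5p14:
  fixes p :: nat and lam :: "nat \<Rightarrow> 'k::alg_closed_field"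
  assumes "prime p" and "odd p" and "CHAR('k) = p"
    and "lam \<in> carrier (kG p)" and "lam \<noteq> \<zero>\<^bsub>kG p\<^esub>" and "lam 0 = 0"
  shows "(\<forall>\<alpha> \<beta>. simple_left_module (Halg p lam) (Smod p lam \<alpha> \<beta>)) \<and>
    (\<forall>\<alpha> \<beta> \<alpha>' \<beta>'. isomorphic_left_modules (Halg p lam) (Smod p lam \<alpha> \<beta>) (Smod p lam \<alpha>' \<beta>') \<longrightarrow>
       \<alpha> = \<alpha>' \<and> \<beta> = \<beta>') \<and>
    (lam \<in> Units (kG p) \<longrightarrow>
       (\<forall>M :: ('k H_elem, 'm) module. simple_left_module (Halg p lam) M \<longrightarrow> has_k_dim p lam M p)) \<and>
    (kG_zero_divisor p lam \<longrightarrow>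
       (\<forall>M :: ('k H_elem, 'm) module. simple_left_module (Halg p lam) M \<longrightarrow>
          (over_smooth_locus p lam M \<longrightarrow> has_k_dim p lam M p) \<and>
          (over_singular_locus p lam M \<longrightarrow> has_k_dim p lam M 1)))"
proof -
  interpret heisenberg_setting p lam by standard (use assms in auto)
  have ex: "\<exists>m \<alpha> \<beta>. H_eigen_quotient p lam M m \<alpha> \<beta>"
    if "simple_left_module (Halg p lam) M" for M :: "('k H_elem, 'm) module"
  proof -
    have "left_module (Halg p lam) M" using that by (simp add: simple_left_module_def)
    with that have "simple_H_module p lam M"
      by (intro simple_H_module.intro H_module.intro simple_H_module_axioms.intro heisenberg_setting_axioms)
    then show ?thesis by (rule simple_H_module.ex_eigen_quotient)
  qed
  have invertible: "has_k_dim p lam M p"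
    if inv: "lam \<in> Units (kG p)" and M: "simple_left_module (Halg p lam) M" for M :: "('k H_elem, 'm) module"
  proof -
    obtain m \<alpha> \<beta> where "H_eigen_quotient p lam M m \<alpha> \<beta>" using ex[OF M] by blast
    from H_eigen_quotient.k_dim[OF this] show ?thesis
      using Units_aug[OF inv] by (simp add: degenerate_def)
  qed
  have zero_divisor: "(over_smooth_locus p lam M \<longrightarrow> has_k_dim p lam M p) \<and>
      (over_singular_locus p lam M \<longrightarrow> has_k_dim p lam M 1)"
    if zd: "kG_zero_divisor p lam" and M: "simple_left_module (Halg p lam) M" for M :: "('k H_elem, 'm) module"
  proof -
    obtain m \<alpha> \<beta> where E: "H_eigen_quotient p lam M m \<alpha> \<beta>" using ex[OF M] by blast
    interpret E: H_eigen_quotient p lam M m \<alpha> \<beta> by (rule E)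
    \<comment> \<open>For a zero divisor \<open>lam\<close> the dimension depends on
      \<open>\<alpha>\<close> alone. As \<open>x^p\<close> acts by \<open>\<alpha>^p\<close>, the
      smooth locus means \<open>\<alpha> \<noteq> 0\<close> and the singular locus
      \<open>\<alpha> = 0\<close>.\<close>
    have deg: "degenerate \<alpha> \<longleftrightarrow> \<alpha> = 0"
      using zd by (simp add: degenerate_def kG_zero_divisor_iff)
    have scalar: "c = 0" if "Hscalar p lam c \<odot>\<^bsub>M\<^esub> m = \<zero>\<^bsub>M\<^esub>" for c
    proof (rule ccontr)
      assume "c \<noteq> 0"
      then have "m = Hscalar p lam (inverse c) \<odot>\<^bsub>M\<^esub> (Hscalar p lam c \<odot>\<^bsub>M\<^esub> m)"
        by (simp add: E.Mod.lsmult_assoc[symmetric] HS.\<phi>_mult[symmetric] HS.\<phi>_one E.Mod.lsmult_one)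
      then show False using that E.m_nonzero by (simp add: E.Mod.lsmult_zero_right)
    qed
    have x: "Hx p lam [^]\<^bsub>HH\<^esub> p \<odot>\<^bsub>M\<^esub> m = Hscalar p lam (\<alpha> ^ p) \<odot>\<^bsub>M\<^esub> m"
      by (rule E.x_pow_p) simp
    have "\<alpha> \<noteq> 0" if smooth: "over_smooth_locus p lam M"
    proof
      assume "\<alpha> = 0"
      then have "Hx p lam [^]\<^bsub>HH\<^esub> p \<odot>\<^bsub>M\<^esub> m = \<zero>\<^bsub>M\<^esub>"
        using x p_gt_1 by (simp add: power_0_left E.Mod.lsmult_zero_left)
      moreover obtain c where "c \<noteq> 0" "Hx p lam [^]\<^bsub>HH\<^esub> p \<odot>\<^bsub>M\<^esub> m = Hscalar p lam c \<odot>\<^bsub>M\<^esub> m"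
        using smooth E.m_carrier by (auto simp: over_smooth_locus_def)
      ultimately show False using scalar[of c] by simp
    qed
    moreover have "\<alpha> = 0" if "over_singular_locus p lam M"
      using that x scalar[of "\<alpha> ^ p"] E.m_carrier by (simp add: over_singular_locus_def)
    ultimately show ?thesis using E.k_dim by (auto simp: deg)
  qed
  show ?thesis
    using simple_Smod Smod_distinct invertible zero_divisor by blast
qed

end
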